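(* Let $\mathbb{k}$ be an algebraically closed field of characteristic $p>3$, let $\ell\geq 1$ be an integer, and let $\chi\in W_\ell^*$ be a linear form of height $r(\chi)=1$ with $\chi(e_{-1}t^{\ell})\neq 0$ and $\chi(e_0t^{\ell})=0$. Then $\mathcal{Z}_\chi(\lambda)\cong\mathcal{Z}_\chi(\mu)$ as $U_\chi(W_\ell)$-modules for all $\lambda,\mu\in\Lambda(\chi)$. In particular, $U_\chi(W_\ell)$ has only one simple module up to isomorphism.
   Context: The Witt algebra $W$ is the Lie algebra of derivations of $\mathbb{k}[X]/(X^p)$, with basis $e_i=x^{i+1}\partial$, $-1\le i\le p-2$, and bracket $[e_i,e_j]=(j-i)e_{i+j}$, where $e_{i+j}:=0$ if $i+j\notin\{-1,\dots,p-2\}$. For an integer $\ell\ge 0$, the truncated current Lie algebra is $W_\ell:=W\otimes\mathbb{k}[t]/(t^{\ell+1})$, with basis $e_it^j:=e_i\otimes t^j$ ($-1\le i\le p-2$, $0\le j\le\ell$) and bracket $[e_it^k,e_jt^l]=(j-i)e_{i+j}t^{k+l}$. It is a restricted Lie algebra with $p$-map determined by $(e_it^k)^{[p]}=\delta_{i,0}\,e_it^{kp}$ (with $t^m=0$ for $m>\ell$). Set $W_{\ell,[i]}:=\mathbb{k}e_i\otimes\mathbb{k}[t]/(t^{\ell+1})$ and $W_{\ell,(i)}:=\sum_{j\ge i}W_{\ell,[j]}$ for $i\geq -1$. For $\chi\in W_\ell^*$, the height $r(\chi)$ is the smallest integer $i\ge -1$ with $\chi(W_{\ell,(i)})=(0)$.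 For a restricted Lie algebra $L$ and $\chi\in L^*$, the reduced enveloping algebra is $U_\chi(L):=U(L)/(x^p-x^{[p]}-\chi(x)^p\cdot 1:\ x\in L)$; for a restricted subalgebra $L'\subseteq L$, $U_\chi(L')$ is formed with $\chi|_{L'}$. Suppose $r(\chi)\le 1$. Put $\Lambda(\chi):=\{\lambda\in\mathbb{k}:\lambda^p-\lambda=\chi(e_0)^p\}$. For $\lambda\in\Lambda(\chi)$, let $\mathbb{k}_\lambda=\mathbb{k}v_\lambda$ be the one-dimensional $U_\chi(W_{\ell,(0)})$-module with $e_0.v_\lambda=\lambda v_\lambda$, $W_{\ell,(1)}.v_\lambda=0$, and $e_0t^i.v_\lambda=\chi_iv_\lambda$ for $1\le i\le\ell$, where the scalars $\chi_i$ are uniquely determined by $\chi$ through $\chi_i^p-\chi_{ip}=\chi(e_0t^i)^p$ (with $\chi_m:=0$ for $m>\ell$). The $\chi$-reduced Verma module is $\mathcal{Z}_\chi(\lambda):=U_\chi(W_\ell)\otimes_{U_\chi(W_{\ell,(0)})}\mathbb{k}_\lambda$. *)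

theory Defs
  imports
    "HOL-Computational_Algebra.Polynomial"
    "HOL-Algebra.Module"
    "HOL-Algebra.QuotRing"
    "HOL-Algebra.Free_Abelian_Groups"
begin

section \<open>Restricted Lie algebras\<close>

text \<open>
  A restricted Lie algebra is a subspace \<^term>\<open>space\<close> of an ambient vector space (addition is
  that of the type class), together with its operations. Only the values on \<^term>\<open>space\<close> matter,
  so a restricted subalgebra is obtained by shrinking \<^term>\<open>space\<close>.
\<close>

record ('k, 'a) rlie =
  space :: "'a set"
  scl :: "'k \<Rightarrow> 'a \<Rightarrow> 'a"
  brk :: "'a \<Rightarrow> 'a \<Rightarrow> 'a"
  pmap :: "'a \<Rightarrow> 'a"

locale lie_algebra = vector_space "scl L"
  for L :: "('k::field, 'a::ab_group_add) rlie" +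
  assumes subspace_space: "subspace (space L)"
    and brk_closed: "x \<in> space L \<Longrightarrow> y \<in> space L \<Longrightarrow> brk L x y \<in> space L"
    and brk_add_left:
      "x \<in> space L \<Longrightarrow> y \<in> space L \<Longrightarrow> z \<in> space L \<Longrightarrow>
        brk L (x + y) z = brk L x z + brk L y z"
    and brk_add_right:
      "x \<in> space L \<Longrightarrow> y \<in> space L \<Longrightarrow> z \<in> space L \<Longrightarrow>
        brk L x (y + z) = brk L x y + brk L x z"
    and brk_scl_left:
      "x \<in> space L \<Longrightarrow> y \<in> space L \<Longrightarrow> brk L (scl L c x) y = scl L c (brk L x y)"
    and brk_scl_right:
      "x \<in> space L \<Longrightarrow> y \<in> space L \<Longrightarrow> brk L x (scl L c y) = scl L c (brk L x y)"
    and brk_self: "x \<in> space L \<Longrightarrow> brk L x x = 0"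
    and jacobi:
      "x \<in> space L \<Longrightarrow> y \<in> space L \<Longrightarrow> z \<in> space L \<Longrightarrow>
        brk L x (brk L y z) + brk L y (brk L z x) + brk L z (brk L x y) = 0"

text \<open>
  The terms $s_i(x,y)$ of Jacobson's formula, i.e.
  $\mathrm{ad}(Tx+y)^{p-1}(x) = \sum_{i=1}^{p-1} i\, s_i(x,y)\, T^{i-1}$. Expanding the left-hand
  side, $i\, s_i(x,y)$ is the sum of all $\mathrm{ad}(z_1)\cdots\mathrm{ad}(z_{p-1})(x)$ in which
  exactly $i-1$ of the $z$'s are $x$ and the others are $y$; a word in $x$ and $y$ is encoded by
  the list of booleans marking the positions of $x$.
\<close>

definition jacobson_s :: "('k::field, 'a::ab_group_add) rlie \<Rightarrow> nat \<Rightarrow> 'a \<Rightarrow> 'a \<Rightarrow> 'a" where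
  "jacobson_s L i x y = scl L (inverse (of_nat i))
    (\<Sum>bs | length bs = CHAR('k) - 1 \<and> count_list bs True = i - 1.
      foldr (\<lambda>b. brk L (if b then x else y)) bs x)"

locale restricted_lie_algebra = lie_algebra L
  for L :: "('k::field, 'a::ab_group_add) rlie" +
  assumes pmap_closed: "x \<in> space L \<Longrightarrow> pmap L x \<in> space L"
    and pmap_scl: "x \<in> space L \<Longrightarrow> pmap L (scl L c x) = scl L (c ^ CHAR('k)) (pmap L x)"
    and pmap_brk:
      "x \<in> space L \<Longrightarrow> y \<in> space L \<Longrightarrow> brk L (pmap L x) y = (brk L x ^^ CHAR('k)) y"
    and pmap_add:
      "x \<in> space L \<Longrightarrow> y \<in> space L \<Longrightarrow>
        pmap L (x + y) = pmap L x + pmap L y + (\<Sum>i = 1..CHAR('k) - 1. jacobson_s L i x y)"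

definition linear_form :: "('k::field, 'a::ab_group_add) rlie \<Rightarrow> ('a \<Rightarrow> 'k) \<Rightarrow> bool" where
  "linear_form L \<chi> \<longleftrightarrow>
    (\<forall>x\<in>space L. \<forall>y\<in>space L. \<chi> (x + y) = \<chi> x + \<chi> y) \<and>
    (\<forall>c. \<forall>x\<in>space L. \<chi> (scl L c x) = c * \<chi> x)"


section \<open>Enveloping algebras\<close>

text \<open>
  With concatenation of words as the additive monoid operation on lists, the convolution product
  of finitely supported functions on lists is the product of the free associative algebra.
\<close>

instantiation list :: (type) monoid_add
begin

definition zero_list :: "'a list" where "zero_list = []"
definition plus_list :: "'a list \<Rightarrow> 'a list \<Rightarrow> 'a list" where "plus_list = (@)"

instance by standard (simp_all add: zero_list_def plus_list_def)

end

type_synonym ('k, 'a) free = "'a list \<Rightarrow>\<^sub>0 'k"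

definition free_alg :: "'a set \<Rightarrow> ('k::field, 'a) free ring" where
  "free_alg S = \<lparr>carrier = {f. \<forall>w\<in>Poly_Mapping.keys f. set w \<subseteq> S},
     monoid.mult = (*), one = 1, ring.zero = 0, add = (+)\<rparr>"

definition gen :: "'a \<Rightarrow> ('k::field, 'a) free" where
  "gen x = Poly_Mapping.single [x] 1"

definition const :: "'k::field \<Rightarrow> ('k, 'a) free" where
  "const c = Poly_Mapping.single [] c"

text \<open>
  The generators of the free algebra are all elements of the Lie algebra; the relations of the
  first two kinds turn it into the tensor algebra.
\<close>

definition env_rels :: "('k::field, 'a::ab_group_add) rlie \<Rightarrow> ('k, 'a) free set" where
  "env_rels L =
    {gen (x + y) - gen x - gen y | x y. x \<in> space L \<and> y \<in> space L} \<union>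
    {gen (scl L c x) - const c * gen x | c x. x \<in> space L} \<union>
    {gen x * gen y - gen y * gen x - gen (brk L x y) | x y. x \<in> space L \<and> y \<in> space L}"

definition env_ideal :: "('k::field, 'a::ab_group_add) rlie \<Rightarrow> ('k, 'a) free set" where
  "env_ideal L = Idl\<^bsub>free_alg (space L)\<^esub> (env_rels L)"

definition env_alg :: "('k::field, 'a::ab_group_add) rlie \<Rightarrow> ('k, 'a) free set ring" where
  "env_alg L = free_alg (space L) Quot env_ideal L"

definition env_proj ::
    "('k::field, 'a::ab_group_add) rlie \<Rightarrow> ('k, 'a) free \<Rightarrow> ('k, 'a) free set" where
  "env_proj L f = env_ideal L +>\<^bsub>free_alg (space L)\<^esub> f"

definition red_ideal ::
    "('k::field, 'a::ab_group_add) rlie \<Rightarrow> ('a \<Rightarrow> 'k) \<Rightarrow> ('k, 'a) free set set" where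
  "red_ideal L \<chi> = Idl\<^bsub>env_alg L\<^esub>
    {(env_proj L (gen x) [^]\<^bsub>env_alg L\<^esub> CHAR('k) \<ominus>\<^bsub>env_alg L\<^esub> env_proj L (gen (pmap L x)))
       \<ominus>\<^bsub>env_alg L\<^esub> env_proj L (const (\<chi> x ^ CHAR('k))) | x. x \<in> space L}"

type_synonym ('k, 'a) red = "('k, 'a) free set set"

definition red_env_alg ::
    "('k::field, 'a::ab_group_add) rlie \<Rightarrow> ('a \<Rightarrow> 'k) \<Rightarrow> ('k, 'a) red ring" where
  "red_env_alg L \<chi> = env_alg L Quot red_ideal L \<chi>"

definition red_proj ::
    "('k::field, 'a::ab_group_add) rlie \<Rightarrow> ('a \<Rightarrow> 'k) \<Rightarrow> ('k, 'a) free \<Rightarrow> ('k, 'a) red" where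
  "red_proj L \<chi> f = red_ideal L \<chi> +>\<^bsub>env_alg L\<^esub> env_proj L f"

text \<open>
  The map on cosets induced by a map \<^term>\<open>h\<close> that is constant on each coset, and its two-step
  version, for maps on the free algebra factoring through a reduced enveloping algebra.
\<close>

definition quot_lift :: "('a \<Rightarrow> 'b) \<Rightarrow> 'a set \<Rightarrow> 'b" where
  "quot_lift h C = the_elem (h ` C)"

definition red_lift :: "(('k, 'a) free \<Rightarrow> 'b) \<Rightarrow> ('k::field, 'a) red \<Rightarrow> 'b" where
  "red_lift h = quot_lift (quot_lift h)"


section \<open>Modules over non-commutative rings\<close>

text \<open>
  The locale \<^locale>\<open>module\<close> of HOL-Algebra with a not necessarily commutative ring of scalars. The
  fields \<^const>\<open>mult\<close> and \<^const>\<open>one\<close> of a module record are irrelevant.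
\<close>

locale left_module = R?: ring + M?: abelian_group M for M (structure) +
  assumes smult_closed: "a \<in> carrier R \<Longrightarrow> x \<in> carrier M \<Longrightarrow> a \<odot>\<^bsub>M\<^esub> x \<in> carrier M"
    and smult_l_distr:
      "a \<in> carrier R \<Longrightarrow> b \<in> carrier R \<Longrightarrow> x \<in> carrier M \<Longrightarrow>
        (a \<oplus> b) \<odot>\<^bsub>M\<^esub> x = a \<odot>\<^bsub>M\<^esub> x \<oplus>\<^bsub>M\<^esub> b \<odot>\<^bsub>M\<^esub> x"
    and smult_r_distr:
      "a \<in> carrier R \<Longrightarrow> x \<in> carrier M \<Longrightarrow> y \<in> carrier M \<Longrightarrow>
        a \<odot>\<^bsub>M\<^esub> (x \<oplus>\<^bsub>M\<^esub> y) = a \<odot>\<^bsub>M\<^esub> x \<oplus>\<^bsub>M\<^esub> a \<odot>\<^bsub>M\<^esub> y"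
    and smult_assoc:
      "a \<in> carrier R \<Longrightarrow> b \<in> carrier R \<Longrightarrow> x \<in> carrier M \<Longrightarrow>
        (a \<otimes> b) \<odot>\<^bsub>M\<^esub> x = a \<odot>\<^bsub>M\<^esub> (b \<odot>\<^bsub>M\<^esub> x)"
    and smult_one: "x \<in> carrier M \<Longrightarrow> \<one> \<odot>\<^bsub>M\<^esub> x = x"

definition module_iso :: "'r ring \<Rightarrow> ('r, 'm) module \<Rightarrow> ('r, 'n) module \<Rightarrow> bool" where
  "module_iso R M N \<longleftrightarrow> left_module R M \<and> left_module R N \<and>
    (\<exists>f. bij_betw f (carrier M) (carrier N) \<and>
      (\<forall>x\<in>carrier M. \<forall>y\<in>carrier M. f (x \<oplus>\<^bsub>M\<^esub> y) = f x \<oplus>\<^bsub>N\<^esub> f y) \<and>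
      (\<forall>a\<in>carrier R. \<forall>x\<in>carrier M. f (a \<odot>\<^bsub>M\<^esub> x) = a \<odot>\<^bsub>N\<^esub> f x))"

definition simple_module :: "'r ring \<Rightarrow> ('r, 'm) module \<Rightarrow> bool" where
  "simple_module R M \<longleftrightarrow> left_module R M \<and> carrier M \<noteq> {\<zero>\<^bsub>M\<^esub>} \<and>
    (\<forall>H. submodule H R M \<longrightarrow> H = {\<zero>\<^bsub>M\<^esub>} \<or> H = carrier M)"

text \<open>
  For a ring homomorphism \<open>\<theta> : R \<rightarrow> S\<close> and a left \<open>R\<close>-module \<open>N\<close>, the induced left \<open>S\<close>-module
  \<open>S \<otimes>\<^sub>R N\<close>: the free abelian group on \<open>S \<times> N\<close> modulo biadditivity and \<open>R\<close>-balancedness.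
\<close>

definition tensor_rels ::
    "'s ring \<Rightarrow> 'r ring \<Rightarrow> ('r \<Rightarrow> 's) \<Rightarrow> ('r, 'n) module \<Rightarrow> ('s \<times> 'n \<Rightarrow>\<^sub>0 int) set" where
  "tensor_rels S R \<theta> N =
    {frag_of (s \<oplus>\<^bsub>S\<^esub> s', n) - frag_of (s, n) - frag_of (s', n) | s s' n.
       s \<in> carrier S \<and> s' \<in> carrier S \<and> n \<in> carrier N} \<union>
    {frag_of (s, n \<oplus>\<^bsub>N\<^esub> n') - frag_of (s, n) - frag_of (s, n') | s n n'.
       s \<in> carrier S \<and> n \<in> carrier N \<and> n' \<in> carrier N} \<union>
    {frag_of (s \<otimes>\<^bsub>S\<^esub> \<theta> r, n) - frag_of (s, r \<odot>\<^bsub>N\<^esub> n) | s r n.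
       s \<in> carrier S \<and> r \<in> carrier R \<and> n \<in> carrier N}"

definition induced_module ::
    "'s ring \<Rightarrow> 'r ring \<Rightarrow> ('r \<Rightarrow> 's) \<Rightarrow> ('r, 'n) module \<Rightarrow> ('s, ('s \<times> 'n \<Rightarrow>\<^sub>0 int) set) module" where
  "induced_module S R \<theta> N =
    (let G = free_Abelian_group (carrier S \<times> carrier N);
         H = generate G (tensor_rels S R \<theta> N)
     in \<lparr>carrier = carrier (G Mod H), monoid.mult = undefined, one = undefined,
         ring.zero = \<one>\<^bsub>G Mod H\<^esub>, add = (\<lambda>C D. C \<otimes>\<^bsub>G Mod H\<^esub> D),
         module.smult = (\<lambda>s. quot_lift
           (\<lambda>f. H #>\<^bsub>G\<^esub> frag_extend (\<lambda>(s', n). frag_of (s \<otimes>\<^bsub>S\<^esub> s', n)) f))\<rparr>)"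

text \<open>
  The one-dimensional module on which the elements \<open>x\<close> of a Lie algebra act by the scalars \<open>\<phi> x\<close>.
  Its action comes from the algebra homomorphism from the free algebra to the field that extends
  \<open>\<phi>\<close>.
\<close>

definition char_eval :: "('a \<Rightarrow> 'k) \<Rightarrow> ('k::field, 'a) free \<Rightarrow> 'k" where
  "char_eval \<phi> f = (\<Sum>w\<in>Poly_Mapping.keys f. Poly_Mapping.lookup f w * prod_list (map \<phi> w))"

definition char_module :: "('a \<Rightarrow> 'k) \<Rightarrow> (('k::field, 'a) red, 'k) module" where
  "char_module \<phi> = \<lparr>carrier = UNIV, monoid.mult = undefined, one = undefined, ring.zero = 0, add = (+),
     module.smult = (\<lambda>u c. red_lift (char_eval \<phi>) u * c)\<rparr>"


section \<open>The truncated current algebra of the Witt algebra\<close>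

text \<open>
  An element is given by its coordinates: \<^term>\<open>Poly_Mapping.lookup x (i, k)\<close> is the coefficient of
  \<open>e\<^sub>i t\<^sup>k\<close> in \<open>x\<close>. Throughout, \<open>p\<close> is the characteristic \<open>CHAR('k)\<close>.
\<close>

type_synonym 'k witt = "int \<times> nat \<Rightarrow>\<^sub>0 'k"

definition witt_space :: "nat \<Rightarrow> 'k::field witt set" where
  "witt_space l = {x. Poly_Mapping.keys x \<subseteq> {-1..int CHAR('k) - 2} \<times> {0..l}}"

definition witt_e :: "nat \<Rightarrow> int \<Rightarrow> nat \<Rightarrow> 'k::field witt" where
  "witt_e l i k =
    (if -1 \<le> i \<and> i \<le> int CHAR('k) - 2 \<and> k \<le> l then Poly_Mapping.single (i, k) 1 else 0)"

definition witt_scl :: "'k::field \<Rightarrow> 'k witt \<Rightarrow> 'k witt" where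
  "witt_scl c x = Poly_Mapping.map ((*) c) x"

definition witt_brk :: "nat \<Rightarrow> 'k::field witt \<Rightarrow> 'k witt \<Rightarrow> 'k witt" where
  "witt_brk l x y =
    (\<Sum>(i, k)\<in>Poly_Mapping.keys x. \<Sum>(j, m)\<in>Poly_Mapping.keys y.
      witt_scl (Poly_Mapping.lookup x (i, k) * Poly_Mapping.lookup y (j, m) * of_int (j - i))
        (witt_e l (i + j) (k + m)))"

definition witt_alg :: "nat \<Rightarrow> ('k::field witt \<Rightarrow> 'k witt) \<Rightarrow> ('k, 'k witt) rlie" where
  "witt_alg l pm = \<lparr>space = witt_space l, scl = witt_scl, brk = witt_brk l, pmap = pm\<rparr>"

text \<open>\<open>W\<^bsub>\<ell>,(i)\<^esub>\<close>, the sum of the \<open>W\<^bsub>\<ell>,[j]\<^esub>\<close> with \<open>j \<ge> i\<close>.\<close>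

definition witt_filt :: "nat \<Rightarrow> int \<Rightarrow> 'k::field witt set" where
  "witt_filt l i = {x \<in> witt_space l. Poly_Mapping.keys x \<subseteq> {i..} \<times> UNIV}"

definition witt_alg0 :: "nat \<Rightarrow> ('k::field witt \<Rightarrow> 'k witt) \<Rightarrow> ('k, 'k witt) rlie" where
  "witt_alg0 l pm = (witt_alg l pm)\<lparr>space := witt_filt l 0\<rparr>"

definition height :: "nat \<Rightarrow> ('k::field witt \<Rightarrow> 'k) \<Rightarrow> int" where
  "height l \<chi> = (LEAST i. -1 \<le> i \<and> (\<forall>x\<in>witt_filt l i. \<chi> x = 0))"

definition weights :: "nat \<Rightarrow> ('k::field witt \<Rightarrow> 'k) \<Rightarrow> 'k set" where
  "weights l \<chi> = {a. a ^ CHAR('k) - a = \<chi> (witt_e l 0 0) ^ CHAR('k)}"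

text \<open>
  The scalars \<open>\<chi>\<^sub>i\<close> for \<open>1 \<le> i \<le> \<ell>\<close>, and \<open>\<chi>\<^sub>i = 0\<close> for \<open>i > \<ell>\<close>. The value at the unused index
  \<open>0\<close> is fixed as \<open>0\<close> to make the sequence unique.
\<close>

definition chi_seq :: "nat \<Rightarrow> ('k::field witt \<Rightarrow> 'k) \<Rightarrow> nat \<Rightarrow> 'k" where
  "chi_seq l \<chi> = (THE c. c 0 = 0 \<and> (\<forall>m>l. c m = 0) \<and>
    (\<forall>i\<in>{1..l}. c i ^ CHAR('k) - c (i * CHAR('k)) = \<chi> (witt_e l 0 i) ^ CHAR('k)))"

text \<open>
  The scalar by which \<open>x \<in> W\<^bsub>\<ell>,(0)\<^esub>\<close> acts on \<open>v\<^sub>\<lambda>\<close>; the coordinates of \<open>x\<close> in \<open>W\<^bsub>\<ell>,(1)\<^esub>\<close>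
  do not contribute.
\<close>

definition weight_form :: "nat \<Rightarrow> ('k::field witt \<Rightarrow> 'k) \<Rightarrow> 'k \<Rightarrow> 'k witt \<Rightarrow> 'k" where
  "weight_form l \<chi> a x = a * Poly_Mapping.lookup x (0, 0) +
    (\<Sum>i = 1..l. chi_seq l \<chi> i * Poly_Mapping.lookup x (0, i))"

type_synonym 'k ured = "('k, 'k witt) red"

definition verma :: "nat \<Rightarrow> ('k::field witt \<Rightarrow> 'k witt) \<Rightarrow> ('k witt \<Rightarrow> 'k) \<Rightarrow> 'k \<Rightarrow>
    ('k ured, ('k ured \<times> 'k \<Rightarrow>\<^sub>0 int) set) module" where
  "verma l pm \<chi> a = induced_module
    (red_env_alg (witt_alg l pm) \<chi>) (red_env_alg (witt_alg0 l pm) \<chi>)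
    (red_lift (red_proj (witt_alg l pm) \<chi>))
    (char_module (weight_form l \<chi> a))"

end

theory Submission
  imports Defs "HOL-Computational_Algebra.Formal_Power_Series"
begin

text \<open>
  The element \<open>X = e\<^bsub>-1\<^esub>t\<^sup>\<ell>\<close> is invertible in the reduced enveloping algebra, because
  \<open>X\<^sup>p = \<chi>(X)\<^sup>p \<noteq> 0\<close>. As \<open>\<chi>(e\<^sub>0t\<^sup>\<ell>) = 0\<close> forces \<open>\<chi>\<^sub>\<ell> = 0\<close>, it maps vectors of weight \<open>\<lambda>\<close> to vectors
  of weight \<open>\<lambda> - 1\<close>; since \<open>\<Lambda>(\<chi>)\<close> is a coset of the prime field, powers of \<open>X\<close> identify all Verma
  modules. Every simple module contains a weight vector, so it is a quotient of a Verma module. Such a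
  quotient is unique: the \<open>e\<^bsub>-1\<^esub>t\<^sup>i\<close> commute and each has the single eigenvalue \<open>\<chi>(e\<^bsub>-1\<^esub>t\<^sup>i)\<close>, so that
  an element of the algebra they generate has augmentation zero if it kills a nonzero weight vector,
  and this algebra already generates the module from that vector. That there is a simple module
  at all needs the reduced enveloping algebra to be nonzero; it acts on functions on the space of
  \<open>\<ell>\<close>-jets of the line by twisted vector fields.

  All computations take place in the free algebra, modulo left ideals containing the kernel \<open>K\<close> of
  the projection to the reduced enveloping algebra.
\<close>

section \<open>The free algebra\<close>

text \<open>The enveloping algebras are given by generators and relations, so Verma modules are
  handled through universal properties: the canonical generator is annihilated exactly by the least
  left ideal \<open>J a\<close> that contains \<open>K\<close> and prescribes the action of the
  nonnegative part. Isomorphisms are found by comparing these ideals under right multiplication by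
  powers of X. For \<open>1 \<notin> K\<close> an explicit module is required. Functions on
  exponents are read as divided power series: there the p-th power of d/dx_i is not zero, which
  leaves room for arbitrary values \<chi>(e_{-1}t^i), while x_i^p = 0 matches the truncation of the
  Witt algebra at degree p - 2. The p-relations are not checked by computing p-th powers of vector
  fields. In degree >= 0 the defect of the relation commutes with every d/dx_i and vanishes at the
  origin, which forces it to be zero; in degree -1 the relation is enforced by passing to a stable
  subspace. Jacobson's formula, proved for associative rings, extends it from basis elements to all
  elements.\<close>

lemma sum_single_lookup:
  fixes f :: "'a \<Rightarrow>\<^sub>0 'b::comm_monoid_add"
  shows "(\<Sum>w\<in>Poly_Mapping.keys f. Poly_Mapping.single w (Poly_Mapping.lookup f w)) = f"
proof (rule poly_mapping_eqI)
  fix w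
  have "(\<Sum>v\<in>Poly_Mapping.keys f. Poly_Mapping.lookup (Poly_Mapping.single v (Poly_Mapping.lookup f v)) w)
     = (\<Sum>v\<in>Poly_Mapping.keys f. if v = w then Poly_Mapping.lookup f w else 0)"
    by (rule sum.cong) (auto simp: lookup_single when_def)
  then show "Poly_Mapping.lookup (\<Sum>v\<in>Poly_Mapping.keys f. Poly_Mapping.single v (Poly_Mapping.lookup f v)) w
      = Poly_Mapping.lookup f w"
    by (simp add: lookup_sum in_keys_iff)
qed

lemma poly_mapping_induct_sum [case_names zero add single]:
  fixes f :: "'a \<Rightarrow>\<^sub>0 'b::comm_monoid_add"
  assumes "P 0" and "\<And>f g. P f \<Longrightarrow> P g \<Longrightarrow> P (f + g)"
    and "\<And>w c. w \<in> Poly_Mapping.keys f \<Longrightarrow> P (Poly_Mapping.single w c)"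
  shows "P f"
proof -
  have "P (\<Sum>w\<in>A. Poly_Mapping.single w (Poly_Mapping.lookup f w))"
    if "finite A" "A \<subseteq> Poly_Mapping.keys f" for A
    using that by induction (auto intro: assms)
  from this[OF finite_keys order_refl] show ?thesis by (simp add: sum_single_lookup)
qed

lemma gen_mult_single: "gen x * Poly_Mapping.single w c = Poly_Mapping.single (x # w) c"
  by (simp add: gen_def mult_single plus_list_def)

lemma const_mult_single: "const c * Poly_Mapping.single w d = Poly_Mapping.single w (c * d)"
  by (simp add: const_def mult_single plus_list_def)

lemma single_mult_const: "Poly_Mapping.single w d * const c = Poly_Mapping.single w (d * c)"
  by (simp add: const_def mult_single plus_list_def)

lemma const_0 [simp]: "const 0 = 0"
  and const_1 [simp]: "const 1 = 1"
  and const_add: "const (c + d) = const c + const d"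
  and const_diff: "const (c - d) = const c - const d"
  and const_uminus: "const (- c) = - const c"
  and const_mult: "const (c * d) = const c * const d"
  by (simp_all add: const_def single_add single_diff single_uminus mult_single plus_list_def
      flip: single_one) (simp_all add: zero_list_def)

lemma const_central: "const c * f = f * const c"
  by (induction f rule: poly_mapping_induct_sum)
    (simp_all add: distrib_left distrib_right const_mult_single single_mult_const mult.commute)

lemma single_Nil: "Poly_Mapping.single [] c = const c"
  by (simp add: const_def)

lemma mem_free_alg: "f \<in> carrier (free_alg S) \<longleftrightarrow> (\<forall>w\<in>Poly_Mapping.keys f. set w \<subseteq> S)"
  by (simp add: free_alg_def)

lemma free_alg_simps [simp]:
  "x \<oplus>\<^bsub>free_alg S\<^esub> y = x + y" "x \<otimes>\<^bsub>free_alg S\<^esub> y = x * y"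
  "\<zero>\<^bsub>free_alg S\<^esub> = 0" "\<one>\<^bsub>free_alg S\<^esub> = 1"
  by (simp_all add: free_alg_def)

lemma free_alg_closed [simp, intro]:
  shows "0 \<in> carrier (free_alg S)" "1 \<in> carrier (free_alg S)" "const c \<in> carrier (free_alg S)"
    and "x \<in> S \<Longrightarrow> gen x \<in> carrier (free_alg S)"
    and "f \<in> carrier (free_alg S) \<Longrightarrow> g \<in> carrier (free_alg S) \<Longrightarrow> f + g \<in> carrier (free_alg S)"
    and "f \<in> carrier (free_alg S) \<Longrightarrow> g \<in> carrier (free_alg S) \<Longrightarrow> f * g \<in> carrier (free_alg S)"
    and "f \<in> carrier (free_alg S) \<Longrightarrow> - f \<in> carrier (free_alg S)"
    and "f \<in> carrier (free_alg S) \<Longrightarrow> g \<in> carrier (free_alg S) \<Longrightarrow> f - g \<in> carrier (free_alg S)"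
  by (auto simp: mem_free_alg const_def gen_def zero_list_def
      simp del: keys_eq_empty split: if_splits
      dest!: subsetD[OF keys_add] subsetD[OF keys_diff] subsetD[OF keys_mult])
    (auto simp: plus_list_def)

lemma free_alg_power_closed [simp, intro]:
  "f \<in> carrier (free_alg S) \<Longrightarrow> f ^ n \<in> carrier (free_alg S)"
  by (induction n) auto

lemma free_alg_mono: "S \<subseteq> T \<Longrightarrow> carrier (free_alg S) \<subseteq> carrier (free_alg T)"
  by (fastforce simp: mem_free_alg)

lemma ring_free_alg: "ring (free_alg S :: ('k::field, 'a) free ring)"
  by (rule ringI)
    (auto intro!: abelian_groupI Group.monoidI exI[of _ "- _"] simp: algebra_simps
      intro: bexI[of _ "- _"])

lemma a_inv_free_alg [simp]: "f \<in> carrier (free_alg S) \<Longrightarrow> \<ominus>\<^bsub>free_alg S\<^esub> f = - f"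
  using ring.ring_simprules(9)[OF ring_free_alg, of f S] 
  by (intro abelian_group.minus_equality) (auto intro: ring.is_abelian_group ring_free_alg)

lemma a_minus_free_alg [simp]:
  "f \<in> carrier (free_alg S) \<Longrightarrow> g \<in> carrier (free_alg S) \<Longrightarrow> f \<ominus>\<^bsub>free_alg S\<^esub> g = f - g"
  by (simp add: a_minus_def)

lemma nat_pow_free_alg [simp]: "f [^]\<^bsub>free_alg S\<^esub> (n::nat) = f ^ n"
  by (induction n) (simp_all add: nat_pow_def power_commutes)

text \<open>Words grow on the left, as suits left ideals and left actions.\<close>

lemma free_alg_induct [consumes 1, case_names add const gen]:
  assumes "f \<in> carrier (free_alg S)"
    and add: "\<And>f g. f \<in> carrier (free_alg S) \<Longrightarrow> g \<in> carrier (free_alg S) \<Longrightarrow> P f \<Longrightarrow> P g \<Longrightarrow> P (f + g)"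
    and const: "\<And>c. P (const c)"
    and gen: "\<And>x f. x \<in> S \<Longrightarrow> f \<in> carrier (free_alg S) \<Longrightarrow> P f \<Longrightarrow> P (gen x * f)"
  shows "P f"
proof -
  have word: "Poly_Mapping.single w c \<in> carrier (free_alg S) \<and> P (Poly_Mapping.single w c)"
    if "set w \<subseteq> S" for w c
    using that
  proof (induction w)
    case (Cons x w)
    then show ?case
      using gen[of x "Poly_Mapping.single w c"] free_alg_closed(6)[of "gen x" S "Poly_Mapping.single w c"]
      by (simp add: gen_mult_single free_alg_closed)
  qed (simp add: single_Nil const)
  have "f \<in> carrier (free_alg S) \<and> P f"
  proof (induction f rule: poly_mapping_induct_sum)
    case zero
    then show ?case using const[of 0] by simp
  next
    case (add f g)
    then show ?case using assms(2) by auto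
  next
    case (single w c)
    then show ?case using word assms(1) by (auto simp: mem_free_alg)
  qed
  then show ?thesis ..
qed

text \<open>Two instances matter: the identity of the field, whose evaluation is
  \<open>char_eval\<close>, and the scalar operators, whose evaluation gives the representation
  behind \<open>1 \<notin> K\<close>.\<close>

locale scalar_map =
  fixes \<sigma> :: "'k::field \<Rightarrow> 'r::ring_1"
  assumes \<sigma>_add: "\<sigma> (c + d) = \<sigma> c + \<sigma> d"
    and \<sigma>_mult: "\<sigma> (c * d) = \<sigma> c * \<sigma> d"
    and \<sigma>_1: "\<sigma> 1 = 1"
    and \<sigma>_central: "\<sigma> c * r = r * \<sigma> c"
begin

lemma \<sigma>_0: "\<sigma> 0 = 0"
  using \<sigma>_add[of 0 0] by simp

definition free_eval :: "('a \<Rightarrow> 'r) \<Rightarrow> ('k, 'a) free \<Rightarrow> 'r" where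
  "free_eval \<phi> f = (\<Sum>w\<in>Poly_Mapping.keys f. \<sigma> (Poly_Mapping.lookup f w) * prod_list (map \<phi> w))"

lemma free_eval_single: "free_eval \<phi> (Poly_Mapping.single w c) = \<sigma> c * prod_list (map \<phi> w)"
  by (simp add: free_eval_def \<sigma>_0)

lemma free_eval_zero: "free_eval \<phi> 0 = 0"
  by (simp add: free_eval_def)

lemma free_eval_add: "free_eval \<phi> (f + g) = free_eval \<phi> f + free_eval \<phi> g"
  unfolding free_eval_def
  by (rule setsum_keys_plus_distrib) (simp_all add: \<sigma>_0 \<sigma>_add distrib_right)

lemma free_eval_mult: "free_eval \<phi> (f * g) = free_eval \<phi> f * free_eval \<phi> g"
proof (induction f rule: poly_mapping_induct_sum)
  case (single w c)
  show ?case
  proof (induction g rule: poly_mapping_induct_sum)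
    case (single v d)
    have "\<sigma> c * \<sigma> d * (prod_list (map \<phi> w) * prod_list (map \<phi> v))
       = \<sigma> c * (\<sigma> d * prod_list (map \<phi> w)) * prod_list (map \<phi> v)"
      by (simp add: mult.assoc)
    also have "\<dots> = \<sigma> c * (prod_list (map \<phi> w) * \<sigma> d) * prod_list (map \<phi> v)"
      by (simp add: \<sigma>_central)
    finally show ?case
      by (simp add: mult_single free_eval_single plus_list_def \<sigma>_mult mult.assoc)
  qed (simp_all add: free_eval_zero free_eval_add distrib_left)
qed (simp_all add: free_eval_zero free_eval_add distrib_right)

lemma free_eval_const: "free_eval \<phi> (const c) = \<sigma> c"
  by (simp add: const_def free_eval_single)

lemma free_eval_gen: "free_eval \<phi> (gen x) = \<phi> x"
  by (simp add: gen_def free_eval_single \<sigma>_1)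

lemma free_eval_one: "free_eval \<phi> 1 = 1"
  using free_eval_const[of \<phi> 1] by (simp add: \<sigma>_1)

lemma free_eval_diff: "free_eval \<phi> (f - g) = free_eval \<phi> f - free_eval \<phi> g"
  using free_eval_add[of \<phi> "f - g" g] by simp

lemma free_eval_power: "free_eval \<phi> (f ^ n) = free_eval \<phi> f ^ n"
  by (induction n) (simp_all add: free_eval_one free_eval_mult)

end

lemma scalar_map_id: "scalar_map (\<lambda>c::'k::field. c)"
  by unfold_locales (simp_all add: mult.commute)

lemma char_eval_eq_free_eval: "char_eval = scalar_map.free_eval (\<lambda>c. c)"
  by (intro ext) (simp add: char_eval_def scalar_map.free_eval_def[OF scalar_map_id])

lemmas char_eval_simps =
  scalar_map.free_eval_zero[OF scalar_map_id, folded char_eval_eq_free_eval]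
  scalar_map.free_eval_one[OF scalar_map_id, folded char_eval_eq_free_eval]
  scalar_map.free_eval_add[OF scalar_map_id, folded char_eval_eq_free_eval]
  scalar_map.free_eval_diff[OF scalar_map_id, folded char_eval_eq_free_eval]
  scalar_map.free_eval_mult[OF scalar_map_id, folded char_eval_eq_free_eval]
  scalar_map.free_eval_power[OF scalar_map_id, folded char_eval_eq_free_eval]
  scalar_map.free_eval_const[OF scalar_map_id, folded char_eval_eq_free_eval]
  scalar_map.free_eval_gen[OF scalar_map_id, folded char_eval_eq_free_eval]

section \<open>Reduced enveloping algebras as quotients of the free algebra\<close>

text \<open>Closure of \<open>space L\<close> is what puts the relations inside the free algebra. In
  this form the locale is instantiated both by the whole current algebra and by its nonnegative
  part.\<close>

locale env =
  fixes L :: "('k::field, 'a::ab_group_add) rlie" and \<chi> :: "'a \<Rightarrow> 'k"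
  assumes add_space: "x \<in> space L \<Longrightarrow> y \<in> space L \<Longrightarrow> x + y \<in> space L"
    and scl_space: "x \<in> space L \<Longrightarrow> scl L c x \<in> space L"
    and brk_space: "x \<in> space L \<Longrightarrow> y \<in> space L \<Longrightarrow> brk L x y \<in> space L"
    and pmap_space: "x \<in> space L \<Longrightarrow> pmap L x \<in> space L"
begin

abbreviation "F \<equiv> free_alg (space L)"
abbreviation "U \<equiv> red_env_alg L \<chi>"
abbreviation "\<pi> \<equiv> red_proj L \<chi>"

definition p_rels :: "('k, 'a) free set" where
  "p_rels = {gen x ^ CHAR('k) - gen (pmap L x) - const (\<chi> x ^ CHAR('k)) | x. x \<in> space L}"

definition K :: "('k, 'a) free set" where
  "K = {f \<in> carrier F. \<pi> f = \<zero>\<^bsub>U\<^esub>}"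

lemma env_rels_closed: "env_rels L \<subseteq> carrier F"
  unfolding env_rels_def using add_space scl_space brk_space by auto

lemma p_rels_closed: "p_rels \<subseteq> carrier F"
  unfolding p_rels_def using pmap_space by auto

interpretation F: ring F by (rule ring_free_alg)

lemma env_ideal: "ideal (env_ideal L) F"
  unfolding env_ideal_def by (rule F.genideal_ideal[OF env_rels_closed])

lemma env_rels_subset: "env_rels L \<subseteq> env_ideal L"
  unfolding env_ideal_def by (rule F.genideal_self[OF env_rels_closed])

interpretation EI: ideal "env_ideal L" F by (rule env_ideal)

interpretation E: ring "env_alg L"
  unfolding env_alg_def by (rule EI.quotient_is_ring)

interpretation EP: ring_hom_ring F "env_alg L" "env_proj L"
proof -
  have "env_proj L = (+>\<^bsub>F\<^esub>) (env_ideal L)" by (intro ext) (simp add: env_proj_def)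
  then show "ring_hom_ring F (env_alg L) (env_proj L)"
    unfolding env_alg_def using EI.rcos_ring_hom_ring by simp
qed

lemma env_proj_surj: "C \<in> carrier (env_alg L) \<Longrightarrow> \<exists>f\<in>carrier F. C = env_proj L f"
  by (auto simp: env_alg_def FactRing_def A_RCOSETS_def' env_proj_def)

lemma env_proj_eq_iff:
  "f \<in> carrier F \<Longrightarrow> g \<in> carrier F \<Longrightarrow> env_proj L f = env_proj L g \<longleftrightarrow> f - g \<in> env_ideal L"
  using F.quotient_eq_iff_same_a_r_cos[OF env_ideal, of f g] by (simp add: env_proj_def)

lemma env_proj_mem: "f \<in> carrier F \<Longrightarrow> g \<in> env_proj L f \<Longrightarrow> g \<in> carrier F \<and> env_proj L g = env_proj L f"
  using EI.a_elemrcos_carrier[of f g] EI.a_repr_independence'[of g f]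
  by (simp add: env_proj_def)

lemma env_proj_self: "f \<in> carrier F \<Longrightarrow> f \<in> env_proj L f"
  unfolding env_proj_def by (rule EI.a_rcos_self)

lemma red_rel_eq:
  assumes "x \<in> space L"
  shows "(env_proj L (gen x) [^]\<^bsub>env_alg L\<^esub> CHAR('k) \<ominus>\<^bsub>env_alg L\<^esub> env_proj L (gen (pmap L x)))
       \<ominus>\<^bsub>env_alg L\<^esub> env_proj L (const (\<chi> x ^ CHAR('k)))
     = env_proj L (gen x ^ CHAR('k) - gen (pmap L x) - const (\<chi> x ^ CHAR('k)))"
proof -
  have minus: "env_proj L f \<ominus>\<^bsub>env_alg L\<^esub> env_proj L g = env_proj L (f - g)"
    if "f \<in> carrier F" "g \<in> carrier F" for f g
    using that EP.hom_add[of f "- g"] EP.hom_a_inv[of g] by (simp add: a_minus_def)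
  have pow: "env_proj L (gen x) [^]\<^bsub>env_alg L\<^esub> n = env_proj L (gen x ^ n)" for n :: nat
    using assms EP.hom_nat_pow[of "gen x" n] by simp
  show ?thesis using assms pmap_space by (simp add: minus pow)
qed

definition red_gens :: "('k, 'a) free set set" where
  "red_gens = env_proj L ` p_rels"

lemma red_ideal_eq: "red_ideal L \<chi> = Idl\<^bsub>env_alg L\<^esub> red_gens"
proof -
  have "red_gens = {(env_proj L (gen x) [^]\<^bsub>env_alg L\<^esub> CHAR('k) \<ominus>\<^bsub>env_alg L\<^esub> env_proj L (gen (pmap L x)))
       \<ominus>\<^bsub>env_alg L\<^esub> env_proj L (const (\<chi> x ^ CHAR('k))) | x. x \<in> space L}"
    unfolding red_gens_def p_rels_def image_def using red_rel_eq by blast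
  then show ?thesis by (simp add: red_ideal_def)
qed

lemma red_gens_closed: "red_gens \<subseteq> carrier (env_alg L)"
  unfolding red_gens_def using p_rels_closed by auto

interpretation RI: ideal "red_ideal L \<chi>" "env_alg L"
  unfolding red_ideal_eq by (rule E.genideal_ideal[OF red_gens_closed])

lemma ring_U: "ring U"
  unfolding red_env_alg_def by (rule RI.quotient_is_ring)

interpretation U: ring U by (rule ring_U)

lemma red_proj_hom: "ring_hom_ring F U \<pi>"
proof -
  interpret RP: ring_hom_ring "env_alg L" U "(+>\<^bsub>env_alg L\<^esub>) (red_ideal L \<chi>)"
    unfolding red_env_alg_def by (rule RI.rcos_ring_hom_ring)
  have "\<pi> = (+>\<^bsub>env_alg L\<^esub>) (red_ideal L \<chi>) \<circ> env_proj L" by (intro ext) (simp add: red_proj_def)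
  then have "\<pi> \<in> ring_hom F U"
    using ring_hom_trans[OF EP.homh RP.homh] by simp
  then show ?thesis by (rule ring_hom_ringI2[OF F.ring_axioms U.ring_axioms])
qed

sublocale red: ring_hom_ring F U \<pi> by (rule red_proj_hom)

lemma U_zero: "\<zero>\<^bsub>U\<^esub> = red_ideal L \<chi>"
  by (simp add: red_env_alg_def FactRing_def)

lemma red_proj_surj: "u \<in> carrier U \<Longrightarrow> \<exists>f\<in>carrier F. u = \<pi> f"
proof -
  assume "u \<in> carrier U"
  then obtain C where C: "C \<in> carrier (env_alg L)" "u = red_ideal L \<chi> +>\<^bsub>env_alg L\<^esub> C"
    by (auto simp: red_env_alg_def FactRing_def A_RCOSETS_def')
  then show ?thesis using env_proj_surj[OF C(1)] by (auto simp: red_proj_def)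
qed

lemma red_proj_closed [simp, intro]: "f \<in> carrier F \<Longrightarrow> \<pi> f \<in> carrier U"
  by (rule red.hom_closed)

lemma red_proj_add: "f \<in> carrier F \<Longrightarrow> g \<in> carrier F \<Longrightarrow> \<pi> (f + g) = \<pi> f \<oplus>\<^bsub>U\<^esub> \<pi> g"
  using red.hom_add by simp

lemma red_proj_mult: "f \<in> carrier F \<Longrightarrow> g \<in> carrier F \<Longrightarrow> \<pi> (f * g) = \<pi> f \<otimes>\<^bsub>U\<^esub> \<pi> g"
  using red.hom_mult by simp

lemma red_proj_one: "\<pi> 1 = \<one>\<^bsub>U\<^esub>"
  using red.hom_one by simp

lemma red_proj_zero: "\<pi> 0 = \<zero>\<^bsub>U\<^esub>"
  using red.hom_zero by simp

lemma red_proj_eq_iff: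
  assumes "f \<in> carrier F" "g \<in> carrier F"
  shows "\<pi> f = \<pi> g \<longleftrightarrow> f - g \<in> K"
proof -
  have "\<pi> f = \<pi> (f - g) \<oplus>\<^bsub>U\<^esub> \<pi> g"
    using assms red_proj_add[of "f - g" g] by auto
  then show ?thesis using assms by (auto simp: K_def)
qed

lemma K_closed: "K \<subseteq> carrier F" by (auto simp: K_def)

lemma K_add: "f \<in> K \<Longrightarrow> g \<in> K \<Longrightarrow> f + g \<in> K"
  by (auto simp: K_def red_proj_add)

lemma K_zero: "0 \<in> K"
  by (auto simp: K_def red_proj_zero)

lemma K_left: "f \<in> carrier F \<Longrightarrow> g \<in> K \<Longrightarrow> f * g \<in> K"
  by (auto simp: K_def red_proj_mult)

lemma K_right: "g \<in> carrier F \<Longrightarrow> f \<in> K \<Longrightarrow> f * g \<in> K"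
  by (auto simp: K_def red_proj_mult)

lemma mem_KI:
  assumes "f \<in> env_rels L \<union> p_rels"
  shows "f \<in> K"
proof -
  have f: "f \<in> carrier F" using assms env_rels_closed p_rels_closed by auto
  have "env_proj L f \<in> red_ideal L \<chi>"
  proof (cases "f \<in> env_rels L")
    case True
    then have "env_proj L f = env_proj L 0"
      using env_rels_subset f by (subst env_proj_eq_iff) auto
    then show ?thesis using EP.hom_zero by (simp add: RI.zero_closed)
  next
    case False
    then show ?thesis
      using assms E.genideal_self[OF red_gens_closed] by (auto simp: red_ideal_eq red_gens_def)
  qed
  then have "\<pi> f = \<zero>\<^bsub>U\<^esub>"
    by (simp add: red_proj_def U_zero E.a_rcos_zero[OF RI.is_ideal])
  then show ?thesis using f by (simp add: K_def)
qed

lemma gen_add_K: "x \<in> space L \<Longrightarrow> y \<in> space L \<Longrightarrow> gen (x + y) - gen x - gen y \<in> K"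
  by (rule mem_KI) (auto simp: env_rels_def)

lemma gen_scl_K: "x \<in> space L \<Longrightarrow> gen (scl L c x) - const c * gen x \<in> K"
  by (rule mem_KI) (auto simp: env_rels_def)

lemma gen_brk_K:
  "x \<in> space L \<Longrightarrow> y \<in> space L \<Longrightarrow> gen x * gen y - gen y * gen x - gen (brk L x y) \<in> K"
  by (rule mem_KI) (auto simp: env_rels_def)

lemma gen_pmap_K:
  "x \<in> space L \<Longrightarrow> gen x ^ CHAR('k) - gen (pmap L x) - const (\<chi> x ^ CHAR('k)) \<in> K"
  by (rule mem_KI) (auto simp: p_rels_def)

text \<open>Universal property of the two successive quotients: the kernel of their composite is
  generated by both kinds of relations together. Bounds on \<open>K\<close> from above are obtained
  by exhibiting an ideal that contains all relations.\<close>

lemma K_minimal: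
  assumes I: "ideal I F" and rels: "env_rels L \<subseteq> I" "p_rels \<subseteq> I"
  shows "K \<subseteq> I"
proof
  fix f assume f: "f \<in> K"
  interpret I: ideal I F by (rule I)
  have sub: "env_ideal L \<subseteq> I"
    unfolding env_ideal_def by (rule F.genideal_minimal[OF I rels(1)])
  \<comment> \<open>The image of I is an ideal of the enveloping algebra that contains the
    p-relations. So every element of \<open>K\<close> agrees with an element of I up to
    \<open>env_ideal L\<close>, which itself lies in I.\<close>
  have "ideal (env_proj L ` I) (env_alg L)"
    using F.ring_ideal_imp_quot_ideal[OF env_ideal I]
    by (simp add: env_alg_def env_proj_def[abs_def])
  moreover have "red_gens \<subseteq> env_proj L ` I" using rels(2) by (auto simp: red_gens_def)
  ultimately have red: "red_ideal L \<chi> \<subseteq> env_proj L ` I"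
    unfolding red_ideal_eq by (rule E.genideal_minimal)
  have fF: "f \<in> carrier F" and "red_ideal L \<chi> +>\<^bsub>env_alg L\<^esub> env_proj L f = red_ideal L \<chi>"
    using f by (auto simp: K_def red_proj_def U_zero)
  then have "env_proj L f \<in> red_ideal L \<chi>"
    by (intro RI.rcos_const_imp_mem) auto
  then obtain g where g: "g \<in> I" "env_proj L f = env_proj L g" using red by auto
  then have "f - g \<in> env_ideal L" using fF I.Icarr env_proj_eq_iff by blast
  then have "(f - g) \<oplus>\<^bsub>F\<^esub> g \<in> I" using g sub by (intro I.a_closed) auto
  then show "f \<in> I" by simp
qed

text \<open>\<open>red_lift\<close> takes the only value of h on a coset, twice: on cosets of
  \<open>env_ideal L\<close>, and then on cosets whose elements are such cosets. Constancy modulo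
  \<open>K\<close> makes both values unique.\<close>

lemma red_lift_proj:
  assumes h: "\<And>f g. f \<in> carrier F \<Longrightarrow> g \<in> carrier F \<Longrightarrow> f - g \<in> K \<Longrightarrow> h f = h g"
    and f: "f \<in> carrier F"
  shows "red_lift h (\<pi> f) = h f"
proof -
  have inner: "quot_lift h (env_proj L g) = h g" if "g \<in> carrier F" for g
  proof -
    have "h k = h g" if "k \<in> env_proj L g" for k
    proof (rule h)
      have k: "k \<in> carrier F" "env_proj L k = env_proj L g"
        using env_proj_mem[of g k] \<open>g \<in> carrier F\<close> that by simp_all
      then have "\<pi> k = \<pi> g" by (simp add: red_proj_def)
      then show "k - g \<in> K" by (rule iffD1[OF red_proj_eq_iff[OF k(1) \<open>g \<in> carrier F\<close>]])
    qed (use env_proj_mem[of g k] \<open>g \<in> carrier F\<close> that in simp_all)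
    then have "h ` env_proj L g = {h g}" using env_proj_self[OF that] by blast
    then show ?thesis by (simp add: quot_lift_def)
  qed
  have "quot_lift h C = h f" if "C \<in> \<pi> f" for C
  proof -
    have C: "C \<in> carrier (env_alg L)" "red_ideal L \<chi> +>\<^bsub>env_alg L\<^esub> C = \<pi> f"
      using RI.a_elemrcos_carrier[of "env_proj L f" C]
        RI.a_repr_independence'[of C "env_proj L f"] f that
      by (simp_all add: red_proj_def)
    then obtain g where g: "g \<in> carrier F" "C = env_proj L g" using env_proj_surj by blast
    then have "\<pi> g = \<pi> f" using C by (simp add: red_proj_def)
    then show ?thesis using g f h inner by (simp add: red_proj_eq_iff)
  qed
  moreover have "env_proj L f \<in> \<pi> f"
    unfolding red_proj_def by (rule RI.a_rcos_self) (use f in auto)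
  ultimately have "quot_lift h ` \<pi> f = {h f}" by force
  then show ?thesis by (simp add: red_lift_def quot_lift_def[of "quot_lift h"])
qed

end

section \<open>Modules over reduced enveloping algebras\<close>

lemma left_module_smult_zeros:
  assumes "left_module R M"
  shows "a \<in> carrier R \<Longrightarrow> a \<odot>\<^bsub>M\<^esub> \<zero>\<^bsub>M\<^esub> = \<zero>\<^bsub>M\<^esub>"
    and "x \<in> carrier M \<Longrightarrow> \<zero>\<^bsub>R\<^esub> \<odot>\<^bsub>M\<^esub> x = \<zero>\<^bsub>M\<^esub>"
proof -
  interpret left_module R M by fact
  show "a \<odot>\<^bsub>M\<^esub> \<zero>\<^bsub>M\<^esub> = \<zero>\<^bsub>M\<^esub>" if "a \<in> carrier R"
  proof -
    have "a \<odot>\<^bsub>M\<^esub> \<zero>\<^bsub>M\<^esub> \<oplus>\<^bsub>M\<^esub> a \<odot>\<^bsub>M\<^esub> \<zero>\<^bsub>M\<^esub> = a \<odot>\<^bsub>M\<^esub> \<zero>\<^bsub>M\<^esub>"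
      using smult_r_distr[OF that M.zero_closed M.zero_closed] by simp
    then show ?thesis using smult_closed[OF that M.zero_closed] by simp
  qed
  show "\<zero>\<^bsub>R\<^esub> \<odot>\<^bsub>M\<^esub> x = \<zero>\<^bsub>M\<^esub>" if "x \<in> carrier M"
  proof -
    have "\<zero>\<^bsub>R\<^esub> \<odot>\<^bsub>M\<^esub> x \<oplus>\<^bsub>M\<^esub> \<zero>\<^bsub>R\<^esub> \<odot>\<^bsub>M\<^esub> x = \<zero>\<^bsub>R\<^esub> \<odot>\<^bsub>M\<^esub> x"
      using smult_l_distr[OF R.zero_closed R.zero_closed that] by simp
    then show ?thesis using smult_closed[OF R.zero_closed that] by simp
  qed
qed

section \<open>Left ideals containing the kernel, annihilators and orbits\<close>

context env
begin

text \<open>These are the preimages of the left ideals of \<open>U\<close>. Closure under negation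
  comes from multiplication by the constant -1.\<close>

definition lideal :: "('k, 'a) free set \<Rightarrow> bool" where
  "lideal I \<longleftrightarrow> K \<subseteq> I \<and> I \<subseteq> carrier F \<and> (\<forall>f\<in>I. \<forall>g\<in>I. f + g \<in> I) \<and>
    (\<forall>f\<in>carrier F. \<forall>g\<in>I. f * g \<in> I)"

context
  fixes I assumes I: "lideal I"
begin

lemma lideal_K: "f \<in> K \<Longrightarrow> f \<in> I" using I by (auto simp: lideal_def)
lemma lideal_closed: "f \<in> I \<Longrightarrow> f \<in> carrier F" using I by (auto simp: lideal_def)
lemma lideal_add: "f \<in> I \<Longrightarrow> g \<in> I \<Longrightarrow> f + g \<in> I" using I by (auto simp: lideal_def)
lemma lideal_mult: "f \<in> carrier F \<Longrightarrow> g \<in> I \<Longrightarrow> f * g \<in> I" using I by (auto simp: lideal_def)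
lemma lideal_zero: "0 \<in> I" using lideal_K K_zero by auto

lemma lideal_uminus: "f \<in> I \<Longrightarrow> - f \<in> I"
  using lideal_mult[of "- 1" f] by auto

lemma lideal_diff: "f \<in> I \<Longrightarrow> g \<in> I \<Longrightarrow> f - g \<in> I"
  using lideal_add[of f "- g"] lideal_uminus by auto

lemma lideal_const:
  assumes "const c * f \<in> I" "f \<in> carrier F" "f \<notin> I"
  shows "c = 0"
proof (rule ccontr)
  assume "c \<noteq> 0"
  then have "const (inverse c) * (const c * f) = f"
    by (simp add: mult.assoc[symmetric] flip: const_mult)
  then show False using lideal_mult[OF free_alg_closed(3) assms(1), of "inverse c"] assms(3) by simp
qed

lemma lideal_one: "1 \<in> I \<Longrightarrow> I = carrier F"
  using lideal_mult[of _ 1] lideal_closed by auto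

end

definition ann :: "(('k, 'a) red, 'm) module \<Rightarrow> 'm \<Rightarrow> ('k, 'a) free set" where
  "ann M v = {f \<in> carrier F. \<pi> f \<odot>\<^bsub>M\<^esub> v = \<zero>\<^bsub>M\<^esub>}"

definition orbit :: "(('k, 'a) red, 'm) module \<Rightarrow> 'm \<Rightarrow> 'm set" where
  "orbit M v = {\<pi> f \<odot>\<^bsub>M\<^esub> v | f. f \<in> carrier F}"

context
  fixes M :: "(('k, 'a) red, 'm) module"
  assumes M: "left_module U M"
begin

interpretation M: left_module U M by (rule M)

lemma act_closed [simp]: "f \<in> carrier F \<Longrightarrow> v \<in> carrier M \<Longrightarrow> \<pi> f \<odot>\<^bsub>M\<^esub> v \<in> carrier M"
  by (simp add: M.smult_closed)

lemma act_add:
  "f \<in> carrier F \<Longrightarrow> g \<in> carrier F \<Longrightarrow> v \<in> carrier M \<Longrightarrow>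
    \<pi> (f + g) \<odot>\<^bsub>M\<^esub> v = \<pi> f \<odot>\<^bsub>M\<^esub> v \<oplus>\<^bsub>M\<^esub> \<pi> g \<odot>\<^bsub>M\<^esub> v"
  by (simp add: red_proj_add M.smult_l_distr)

lemma act_mult:
  "f \<in> carrier F \<Longrightarrow> g \<in> carrier F \<Longrightarrow> v \<in> carrier M \<Longrightarrow>
    \<pi> (f * g) \<odot>\<^bsub>M\<^esub> v = \<pi> f \<odot>\<^bsub>M\<^esub> (\<pi> g \<odot>\<^bsub>M\<^esub> v)"
  by (simp add: red_proj_mult M.smult_assoc)

lemma act_one: "v \<in> carrier M \<Longrightarrow> \<pi> 1 \<odot>\<^bsub>M\<^esub> v = v"
  by (simp add: red_proj_one M.smult_one)

lemma act_zero: "v \<in> carrier M \<Longrightarrow> \<pi> 0 \<odot>\<^bsub>M\<^esub> v = \<zero>\<^bsub>M\<^esub>"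
  by (simp add: red_proj_zero left_module_smult_zeros[OF M])

lemma lideal_ann:
  assumes v: "v \<in> carrier M"
  shows "lideal (ann M v)"
  using v K_closed unfolding lideal_def ann_def
  by (auto simp: act_add act_mult K_def left_module_smult_zeros[OF M])

lemma act_eq_iff:
  assumes "f \<in> carrier F" "g \<in> carrier F" "v \<in> carrier M"
  shows "\<pi> f \<odot>\<^bsub>M\<^esub> v = \<pi> g \<odot>\<^bsub>M\<^esub> v \<longleftrightarrow> f - g \<in> ann M v"
proof -
  have eq: "\<pi> f \<odot>\<^bsub>M\<^esub> v = \<pi> (f - g) \<odot>\<^bsub>M\<^esub> v \<oplus>\<^bsub>M\<^esub> \<pi> g \<odot>\<^bsub>M\<^esub> v"
    using assms act_add[of "f - g" g v] by auto
  show ?thesis using assms unfolding eq by (auto simp: ann_def)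
qed

lemma one_in_ann_iff: "v \<in> carrier M \<Longrightarrow> 1 \<in> ann M v \<longleftrightarrow> v = \<zero>\<^bsub>M\<^esub>"
  by (auto simp: ann_def act_one)

lemma submodule_orbit:
  assumes v: "v \<in> carrier M"
  shows "submodule (orbit M v) U M"
proof (rule submodule.intro)
  show "subgroup (orbit M v) (add_monoid M)"
  proof (rule M.M.add.subgroupI)
    show "orbit M v \<subseteq> carrier M" using v by (auto simp: orbit_def)
    show "orbit M v \<noteq> {}" by (auto simp: orbit_def)
    show "\<ominus>\<^bsub>M\<^esub> a \<in> orbit M v" if "a \<in> orbit M v" for a
    proof -
      obtain f where f: "f \<in> carrier F" "a = \<pi> f \<odot>\<^bsub>M\<^esub> v" using \<open>a \<in> orbit M v\<close> by (auto simp: orbit_def)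
      have "\<pi> (- f) \<odot>\<^bsub>M\<^esub> v \<oplus>\<^bsub>M\<^esub> a = \<zero>\<^bsub>M\<^esub>"
        using f v act_add[of "- f" f v] by (simp add: act_zero)
      then have "\<ominus>\<^bsub>M\<^esub> a = \<pi> (- f) \<odot>\<^bsub>M\<^esub> v"
        using f v by (intro M.M.minus_equality) auto
      then show ?thesis using f by (auto simp: orbit_def)
    qed
    show "a \<oplus>\<^bsub>M\<^esub> b \<in> orbit M v" if ab: "a \<in> orbit M v" "b \<in> orbit M v" for a b
    proof -
      obtain f g where "f \<in> carrier F" "a = \<pi> f \<odot>\<^bsub>M\<^esub> v" "g \<in> carrier F" "b = \<pi> g \<odot>\<^bsub>M\<^esub> v"
        using ab unfolding orbit_def by blast
      then show ?thesis using v by (auto simp: orbit_def act_add[symmetric] intro!: exI[of _ "f + g"])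
    qed
  qed
  show "submodule_axioms (orbit M v) U M"
  proof
    fix u x assume ux: "u \<in> carrier U" "x \<in> orbit M v"
    obtain f where "f \<in> carrier F" "u = \<pi> f"
      using red_proj_surj[OF ux(1)] by blast
    moreover obtain g where "g \<in> carrier F" "x = \<pi> g \<odot>\<^bsub>M\<^esub> v"
      using ux(2) unfolding orbit_def by blast
    ultimately show "u \<odot>\<^bsub>M\<^esub> x \<in> orbit M v"
      using v by (auto simp: orbit_def act_mult[symmetric] intro!: exI[of _ "f * g"])
  qed
qed

lemma mem_orbit: "v \<in> carrier M \<Longrightarrow> v \<in> orbit M v"
  using act_one unfolding orbit_def by force

end

lemma simple_orbit:
  assumes M: "simple_module U M" and v: "v \<in> carrier M" "v \<noteq> \<zero>\<^bsub>M\<^esub>"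
  shows "orbit M v = carrier M"
  using assms submodule_orbit[of M v] mem_orbit[of M v] unfolding simple_module_def by blast

text \<open>Both modules are the quotient of the free algebra by the common annihilator, so applying
  the same f to either generator gives a correspondence that is well defined and injective.\<close>

lemma cyclic_module_iso:
  assumes M: "left_module U M" and N: "left_module U N"
    and v: "v \<in> carrier M" "orbit M v = carrier M" and w: "w \<in> carrier N" "orbit N w = carrier N"
    and eq: "ann M v = ann N w"
  shows "module_iso U M N"
proof -
  define r where "r m = (SOME f. f \<in> carrier F \<and> \<pi> f \<odot>\<^bsub>M\<^esub> v = m)" for m
  define h where "h m = \<pi> (r m) \<odot>\<^bsub>N\<^esub> w" for m
  have h: "h (\<pi> f \<odot>\<^bsub>M\<^esub> v) = \<pi> f \<odot>\<^bsub>N\<^esub> w" if "f \<in> carrier F" for f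
  proof -
    have "r (\<pi> f \<odot>\<^bsub>M\<^esub> v) \<in> carrier F \<and> \<pi> (r (\<pi> f \<odot>\<^bsub>M\<^esub> v)) \<odot>\<^bsub>M\<^esub> v = \<pi> f \<odot>\<^bsub>M\<^esub> v"
      unfolding r_def by (rule someI[of _ f]) (use that in auto)
    then show ?thesis
      unfolding h_def using that v w act_eq_iff[OF M, of "r (\<pi> f \<odot>\<^bsub>M\<^esub> v)" f v]
        act_eq_iff[OF N, of "r (\<pi> f \<odot>\<^bsub>M\<^esub> v)" f w] by (simp add: eq)
  qed
  have ex: "\<exists>f\<in>carrier F. m = \<pi> f \<odot>\<^bsub>M\<^esub> v" if "m \<in> carrier M" for m
    using that v(2) by (auto simp: orbit_def)
  have "bij_betw h (carrier M) (carrier N)"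
    unfolding bij_betw_def
  proof
    show "inj_on h (carrier M)"
    proof
      fix x y assume xy: "x \<in> carrier M" "y \<in> carrier M" "h x = h y"
      then obtain f g where "f \<in> carrier F" "x = \<pi> f \<odot>\<^bsub>M\<^esub> v" "g \<in> carrier F" "y = \<pi> g \<odot>\<^bsub>M\<^esub> v"
        using ex[OF xy(1)] ex[OF xy(2)] by blast
      then show "x = y" using xy(3) v w by (simp add: h act_eq_iff[OF M] act_eq_iff[OF N] eq)
    qed
    have "h ` orbit M v = orbit N w"
      unfolding orbit_def by (force simp: h image_iff)
    then show "h ` carrier M = carrier N" using v w by simp
  qed
  moreover have "h (x \<oplus>\<^bsub>M\<^esub> y) = h x \<oplus>\<^bsub>N\<^esub> h y" if xy: "x \<in> carrier M" "y \<in> carrier M" for x y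
  proof -
    obtain f g where "f \<in> carrier F" "x = \<pi> f \<odot>\<^bsub>M\<^esub> v" "g \<in> carrier F" "y = \<pi> g \<odot>\<^bsub>M\<^esub> v"
      using ex[OF xy(1)] ex[OF xy(2)] by blast
    then show ?thesis using h[of "f + g"] v w by (simp add: h act_add[OF M] act_add[OF N] free_alg_closed)
  qed
  moreover have "h (u \<odot>\<^bsub>M\<^esub> x) = u \<odot>\<^bsub>N\<^esub> h x" if ux: "u \<in> carrier U" "x \<in> carrier M" for u x
  proof -
    obtain f g where "f \<in> carrier F" "x = \<pi> f \<odot>\<^bsub>M\<^esub> v" "g \<in> carrier F" "u = \<pi> g"
      using ex[OF ux(2)] red_proj_surj[OF ux(1)] by blast
    then show ?thesis using h[of "g * f"] v w by (simp add: h act_mult[OF M] act_mult[OF N] free_alg_closed)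
  qed
  ultimately show ?thesis using M N unfolding module_iso_def by blast
qed

text \<open>A coset is recorded through its image in \<open>U\<close>, so the quotient module lives
  on sets of elements of \<open>U\<close>. This is the type at which the existence of a simple
  module is stated.\<close>

definition lcoset :: "('k, 'a) free set \<Rightarrow> ('k, 'a) free \<Rightarrow> ('k, 'a) red set" where
  "lcoset I f = {\<pi> g | g. g \<in> carrier F \<and> g - f \<in> I}"

definition lrep :: "('k, 'a) free set \<Rightarrow> ('k, 'a) red set \<Rightarrow> ('k, 'a) free" where
  "lrep I A = (SOME f. f \<in> carrier F \<and> lcoset I f = A)"

definition red_rep :: "('k, 'a) red \<Rightarrow> ('k, 'a) free" where
  "red_rep u = (SOME f. f \<in> carrier F \<and> \<pi> f = u)"

definition quot_module :: "('k, 'a) free set \<Rightarrow> (('k, 'a) red, ('k, 'a) red set) module" where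
  "quot_module I = \<lparr>carrier = lcoset I ` carrier F, monoid.mult = undefined, one = undefined,
     ring.zero = lcoset I 0, add = (\<lambda>A B. lcoset I (lrep I A + lrep I B)),
     module.smult = (\<lambda>u A. lcoset I (red_rep u * lrep I A))\<rparr>"

lemma red_rep: "u \<in> carrier U \<Longrightarrow> red_rep u \<in> carrier F \<and> \<pi> (red_rep u) = u"
  unfolding red_rep_def by (rule someI_ex) (use red_proj_surj in blast)

context
  fixes I assumes I: "lideal I"
begin

lemma lcoset_eq_iff:
  assumes f: "f \<in> carrier F" and g: "g \<in> carrier F"
  shows "lcoset I f = lcoset I g \<longleftrightarrow> f - g \<in> I"
proof
  assume eq: "lcoset I f = lcoset I g"
  have "\<pi> f \<in> lcoset I f" using f lideal_zero[OF I] by (auto simp: lcoset_def)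
  then obtain h where h: "h \<in> carrier F" "h - g \<in> I" "\<pi> f = \<pi> h" unfolding eq by (auto simp: lcoset_def)
  then have "f - h \<in> I" using f lideal_K[OF I] by (simp add: red_proj_eq_iff)
  from lideal_add[OF I this h(2)] show "f - g \<in> I" by simp
next
  assume d: "f - g \<in> I"
  have "h - f \<in> I \<longleftrightarrow> h - g \<in> I" for h
    using lideal_add[OF I _ d, of "h - f"] lideal_diff[OF I _ d, of "h - g"] by auto
  then show "lcoset I f = lcoset I g" by (simp add: lcoset_def)
qed

lemma lrep_lcoset:
  assumes f: "f \<in> carrier F"
  shows "lrep I (lcoset I f) \<in> carrier F" "lrep I (lcoset I f) - f \<in> I"
proof -
  have "lrep I (lcoset I f) \<in> carrier F \<and> lcoset I (lrep I (lcoset I f)) = lcoset I f"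
    unfolding lrep_def by (rule someI[of _ f]) (use f in auto)
  then show "lrep I (lcoset I f) \<in> carrier F" "lrep I (lcoset I f) - f \<in> I"
    using f lcoset_eq_iff by auto
qed

lemma quot_module_add:
  assumes "f \<in> carrier F" "g \<in> carrier F"
  shows "lcoset I f \<oplus>\<^bsub>quot_module I\<^esub> lcoset I g = lcoset I (f + g)"
proof -
  have "(lrep I (lcoset I f) + lrep I (lcoset I g)) - (f + g)
      = (lrep I (lcoset I f) - f) + (lrep I (lcoset I g) - g)" by simp
  also have "\<dots> \<in> I" by (intro lideal_add[OF I] lrep_lcoset assms)
  finally show ?thesis
    using assms lrep_lcoset by (simp add: quot_module_def lcoset_eq_iff free_alg_closed)
qed

lemma quot_module_smult:
  assumes f: "f \<in> carrier F" and g: "g \<in> carrier F"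
  shows "\<pi> f \<odot>\<^bsub>quot_module I\<^esub> lcoset I g = lcoset I (f * g)"
proof -
  have r: "red_rep (\<pi> f) \<in> carrier F" "red_rep (\<pi> f) - f \<in> K"
    using red_rep[of "\<pi> f"] f red_proj_eq_iff[of "red_rep (\<pi> f)" f] by auto
  have "red_rep (\<pi> f) * lrep I (lcoset I g) - f * g
      = red_rep (\<pi> f) * (lrep I (lcoset I g) - g) + (red_rep (\<pi> f) - f) * g"
    by (simp add: algebra_simps)
  also have "\<dots> \<in> I"
    by (intro lideal_add[OF I] lideal_mult[OF I] lideal_K[OF I] K_right lrep_lcoset r f g)
  finally show ?thesis
    using f g r lrep_lcoset by (simp add: quot_module_def lcoset_eq_iff free_alg_closed)
qed

lemma quot_module_carrier: "carrier (quot_module I) = lcoset I ` carrier F"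
  by (simp add: quot_module_def)

lemma quot_module_zero: "\<zero>\<^bsub>quot_module I\<^esub> = lcoset I 0"
  by (simp add: quot_module_def)

lemma left_module_quot: "left_module U (quot_module I)"
proof (intro left_module.intro left_module_axioms.intro ring_U)
  show "abelian_group (quot_module I)"
  proof (rule abelian_groupI)
    fix x assume "x \<in> carrier (quot_module I)"
    then obtain f where "f \<in> carrier F" "x = lcoset I f" by (auto simp: quot_module_carrier)
    then show "\<exists>y\<in>carrier (quot_module I). y \<oplus>\<^bsub>quot_module I\<^esub> x = \<zero>\<^bsub>quot_module I\<^esub>"
      by (auto simp: quot_module_carrier quot_module_add quot_module_zero free_alg_closed
          intro!: bexI[of _ "- f"])
  qed (auto simp: quot_module_carrier quot_module_add quot_module_zero free_alg_closed ac_simps)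
next
  fix a b x y assume abxy: "a \<in> carrier U" "b \<in> carrier U" "x \<in> carrier (quot_module I)" "y \<in> carrier (quot_module I)"
  obtain f g where "f \<in> carrier F" "a = \<pi> f" "g \<in> carrier F" "b = \<pi> g"
    using red_proj_surj[OF abxy(1)] red_proj_surj[OF abxy(2)] by blast
  moreover obtain h k where "h \<in> carrier F" "x = lcoset I h" "k \<in> carrier F" "y = lcoset I k"
    using abxy(3,4) unfolding quot_module_carrier by blast
  ultimately have fghk: "f \<in> carrier F" "a = \<pi> f" "g \<in> carrier F" "b = \<pi> g"
    "h \<in> carrier F" "x = lcoset I h" "k \<in> carrier F" "y = lcoset I k" by blast+
  show "a \<odot>\<^bsub>quot_module I\<^esub> x \<in> carrier (quot_module I)"
    using fghk by (simp add: quot_module_smult quot_module_carrier free_alg_closed)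
  show "(a \<oplus>\<^bsub>U\<^esub> b) \<odot>\<^bsub>quot_module I\<^esub> x
      = a \<odot>\<^bsub>quot_module I\<^esub> x \<oplus>\<^bsub>quot_module I\<^esub> b \<odot>\<^bsub>quot_module I\<^esub> x"
    using fghk by (simp add: quot_module_smult quot_module_add red_proj_add[symmetric] free_alg_closed
        distrib_right del: red.hom_add)
  show "a \<odot>\<^bsub>quot_module I\<^esub> (x \<oplus>\<^bsub>quot_module I\<^esub> y)
      = a \<odot>\<^bsub>quot_module I\<^esub> x \<oplus>\<^bsub>quot_module I\<^esub> a \<odot>\<^bsub>quot_module I\<^esub> y"
    using fghk by (simp add: quot_module_smult quot_module_add free_alg_closed distrib_left)
  show "(a \<otimes>\<^bsub>U\<^esub> b) \<odot>\<^bsub>quot_module I\<^esub> x = a \<odot>\<^bsub>quot_module I\<^esub> (b \<odot>\<^bsub>quot_module I\<^esub> x)"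
    using fghk by (simp add: quot_module_smult red_proj_mult[symmetric] free_alg_closed mult.assoc
        del: red.hom_mult)
next
  fix x assume "x \<in> carrier (quot_module I)"
  then obtain h where "h \<in> carrier F" "x = lcoset I h" unfolding quot_module_carrier by blast
  then show "\<one>\<^bsub>U\<^esub> \<odot>\<^bsub>quot_module I\<^esub> x = x"
    by (simp add: quot_module_smult red_proj_one[symmetric] free_alg_closed del: red.hom_one)
qed

text \<open>Submodules of the quotient pull back to left ideals above I, and maximality of I leaves
  only the two trivial ones.\<close>

lemma simple_quot_module:
  assumes one: "1 \<notin> I"
    and max: "\<And>J. lideal J \<Longrightarrow> I \<subseteq> J \<Longrightarrow> 1 \<notin> J \<Longrightarrow> J = I"
  shows "simple_module U (quot_module I)"
  unfolding simple_module_def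
proof (intro conjI allI impI left_module_quot)
  have "lcoset I 1 \<noteq> lcoset I 0" using one by (subst lcoset_eq_iff) auto
  then show "carrier (quot_module I) \<noteq> {\<zero>\<^bsub>quot_module I\<^esub>}"
    by (auto simp: quot_module_carrier quot_module_zero)
next
  fix H assume H: "submodule H U (quot_module I)"
  interpret H: submodule H U "quot_module I" by (rule H)
  have sub: "H \<subseteq> lcoset I ` carrier F" using H.subset by (simp add: quot_module_carrier)
  define J where "J = {f \<in> carrier F. lcoset I f \<in> H}"
  have H_eq: "H = lcoset I ` J" using sub by (auto simp: J_def)
  have zero: "lcoset I 0 \<in> H" using H.one_closed by (simp add: quot_module_zero)
  have IJ: "I \<subseteq> J"
  proof
    fix f assume "f \<in> I"
    then have "lcoset I f = lcoset I 0" "f \<in> carrier F"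
      using lideal_closed[OF I] by (simp_all add: lcoset_eq_iff)
    then show "f \<in> J" using zero by (simp add: J_def)
  qed
  have "lideal J"
    unfolding lideal_def
  proof (intro conjI ballI)
    show "K \<subseteq> J" using IJ lideal_K[OF I] by auto
    show "J \<subseteq> carrier F" by (auto simp: J_def)
    show "f + g \<in> J" if "f \<in> J" "g \<in> J" for f g
      using that H.m_closed[of "lcoset I f" "lcoset I g"] by (auto simp: J_def quot_module_add)
    show "f * g \<in> J" if "f \<in> carrier F" "g \<in> J" for f g
      using that H.smult_closed[of "\<pi> f" "lcoset I g"] by (auto simp: J_def quot_module_smult)
  qed
  show "H = {\<zero>\<^bsub>quot_module I\<^esub>} \<or> H = carrier (quot_module I)"
  proof (cases "1 \<in> J")
    case True
    then have "J = carrier F" using \<open>lideal J\<close> lideal_one by blast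
    then show ?thesis using H_eq by (simp add: quot_module_carrier)
  next
    case False
    then have "J = I" using max[OF \<open>lideal J\<close> IJ] by simp
    have "lcoset I f = lcoset I 0" if "f \<in> I" for f
      using lideal_closed[OF I that] that by (simp add: lcoset_eq_iff)
    then have "lcoset I ` I = {lcoset I 0}" using lideal_zero[OF I] by blast
    then show ?thesis using H_eq \<open>J = I\<close> by (simp add: quot_module_zero)
  qed
qed

end

lemma lideal_K_self: "lideal K"
  using K_closed K_add K_left by (auto simp: lideal_def)

text \<open>Zorn's lemma for the left ideals that avoid 1; \<open>K\<close> is one of them.\<close>

lemma simple_module_exists:
  assumes one: "1 \<notin> K"
  shows "\<exists>M :: (('k, 'a) red, ('k, 'a) red set) module. simple_module U M"
proof -
  let ?A = "{J. lideal J \<and> 1 \<notin> J}"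
  have "\<exists>I\<in>?A. \<forall>X\<in>?A. I \<subseteq> X \<longrightarrow> X = I"
  proof (rule subset_Zorn_nonempty)
    show "?A \<noteq> {}" using lideal_K_self one by auto
    fix C assume C: "C \<noteq> {}" "subset.chain ?A C"
    have mem: "lideal J" "1 \<notin> J" if "J \<in> C" for J using C that by (auto simp: subset.chain_def)
    obtain J0 where J0: "J0 \<in> C" using C by auto
    have "lideal (\<Union>C)"
      unfolding lideal_def
    proof (intro conjI ballI)
      show "K \<subseteq> \<Union>C" using J0 mem lideal_K by blast
      show "\<Union>C \<subseteq> carrier F" using mem lideal_closed by blast
      show "f + g \<in> \<Union>C" if fg: "f \<in> \<Union>C" "g \<in> \<Union>C" for f g
      proof -
        obtain A B where AB: "A \<in> C" "f \<in> A" "B \<in> C" "g \<in> B" using fg by auto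
        then have "A \<subseteq> B \<or> B \<subseteq> A" using C by (auto simp: subset.chain_def)
        then show ?thesis using AB mem lideal_add by blast
      qed
      show "f * g \<in> \<Union>C" if "f \<in> carrier F" "g \<in> \<Union>C" for f g
        using that mem lideal_mult by blast
    qed
    then show "\<Union>C \<in> ?A" using mem by auto
  qed
  then obtain I where "lideal I" "1 \<notin> I" "\<And>X. lideal X \<Longrightarrow> 1 \<notin> X \<Longrightarrow> I \<subseteq> X \<Longrightarrow> X = I" by auto
  then show ?thesis using simple_quot_module[of I] by blast
qed

end

section \<open>Eigenvectors\<close>

definition free_poly :: "('k::field, 'a) free \<Rightarrow> 'k poly \<Rightarrow> ('k, 'a) free" where
  "free_poly Y q = fold_coeffs (\<lambda>a f. const a + Y * f) q 0"

lemma free_poly_0 [simp]: "free_poly Y 0 = 0"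
  by (simp add: free_poly_def)

lemma free_poly_pCons [simp]: "free_poly Y (pCons a q) = const a + Y * free_poly Y q"
  by (cases "q = 0"; cases "a = 0") (simp_all add: free_poly_def)

lemma free_poly_add: "free_poly Y (p + q) = free_poly Y p + free_poly Y q"
  by (induction p q rule: poly_induct2) (simp_all add: const_add distrib_left)

lemma free_poly_smult: "free_poly Y (Polynomial.smult c q) = const c * free_poly Y q"
proof (induction q)
  case (pCons a q)
  have "Y * (const c * free_poly Y q) = const c * (Y * free_poly Y q)"
    by (simp add: mult.assoc[symmetric] const_central[of c Y])
  then show ?case using pCons by (simp add: const_mult distrib_left)
qed simp

lemma free_poly_monom: "free_poly Y (monom 1 n) = Y ^ n"
  by (induction n) (simp_all add: monom_0 monom_Suc)

lemma free_poly_linear_mult: "free_poly Y ([:- r, 1:] * q) = (Y - const r) * free_poly Y q"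
proof -
  have "[:- r, 1:] * q = Polynomial.smult (- r) q + pCons 0 q" by simp
  then show ?thesis by (simp only: free_poly_add free_poly_smult free_poly_pCons) (simp add: const_uminus algebra_simps)
qed

locale env_closed = env L \<chi>
  for L :: "('k::alg_closed_field, 'a::ab_group_add) rlie" and \<chi> :: "'a \<Rightarrow> 'k"
begin

text \<open>Linear factors are removed from q one at a time; the first factor whose removal takes
  q(Y) g out of I supplies the eigenvalue. The Y-stable subspace T records eigenvalue conditions
  already achieved for other elements, so repeated use yields joint eigenvectors.\<close>

lemma eigenvector:
  assumes I: "lideal I" and Y: "Y \<in> carrier F" and T: "T \<subseteq> carrier F"
    and add: "\<And>f g. f \<in> T \<Longrightarrow> g \<in> T \<Longrightarrow> f + g \<in> T"
    and const: "\<And>c f. f \<in> T \<Longrightarrow> const c * f \<in> T"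
    and mult: "\<And>f. f \<in> T \<Longrightarrow> Y * f \<in> T"
    and g: "g \<in> T" "g \<notin> I" and q: "q \<noteq> 0" "free_poly Y q * g \<in> I"
  shows "\<exists>h\<in>T. \<exists>r. h \<notin> I \<and> (Y - const r) * h \<in> I"
  using q
proof (induction "degree q" arbitrary: q rule: less_induct)
  case less
  show ?case
  proof (cases "degree q = 0")
    case True
    then obtain c where c: "q = [:c:]" using degree_eq_zeroE by blast
    then have "c = 0" using lideal_const[OF I, of c g] less.prems g T by auto
    then show ?thesis using c less.prems by simp
  next
    case False
    then obtain r where "poly q r = 0" using alg_closed_imp_poly_has_root by blast
    then obtain q' where q': "q = [:- r, 1:] * q'" by (auto simp: poly_eq_0_iff_dvd dvd_def)
    have q'0: "q' \<noteq> 0" using less.prems q' by auto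
    then have deg: "degree q' < degree q" unfolding q' by (subst degree_mult_eq) auto
    show ?thesis
    proof (cases "free_poly Y q' * g \<in> I")
      case True
      then show ?thesis using less.hyps[OF deg q'0] by simp
    next
      case False
      have "free_poly Y p * g \<in> T" for p
      proof (induction p)
        case 0
        show ?case using const[OF g(1), of 0] by simp
      next
        case (pCons a p)
        then show ?case using add[OF const[OF g(1), of a] mult] by (simp add: distrib_right mult.assoc)
      qed
      moreover have "(Y - const r) * (free_poly Y q' * g) \<in> I"
        using less.prems by (simp add: q' free_poly_linear_mult mult.assoc del: mult_pCons_left)
      ultimately show ?thesis using False by blast
    qed
  qed
qed

text \<open>The form Y^n = a + b Y covers both kinds of p-relation: b = 0 when the p-th power acts
  on T by a scalar, and b = 1 for the toral element e_0.\<close>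

lemma eigenvector_p:
  assumes I: "lideal I" and Y: "Y \<in> carrier F" and T: "T \<subseteq> carrier F"
    and add: "\<And>f g. f \<in> T \<Longrightarrow> g \<in> T \<Longrightarrow> f + g \<in> T"
    and const: "\<And>c f. f \<in> T \<Longrightarrow> const c * f \<in> T"
    and mult: "\<And>f. f \<in> T \<Longrightarrow> Y * f \<in> T"
    and g: "g \<in> T" "g \<notin> I" and n: "n > 1"
    and rel: "\<And>h. h \<in> T \<Longrightarrow> (Y ^ n - const a - const b * Y) * h \<in> I"
  shows "\<exists>h\<in>T. \<exists>r. h \<notin> I \<and> (Y - const r) * h \<in> I \<and> r ^ n = a + b * r"
proof -
  define q where "q = monom 1 n - [:a, b:]"
  have "coeff q n = 1" using n by (auto simp: q_def coeff_pCons split: nat.splits)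
  then have "q \<noteq> 0" by auto
  have "free_poly Y q + free_poly Y [:a, b:] = Y ^ n"
    unfolding free_poly_add[symmetric] by (simp add: q_def free_poly_monom)
  then have "free_poly Y q = Y ^ n - const a - const b * Y"
    by (simp add: algebra_simps const_central)
  then obtain h r where h: "h \<in> T" "h \<notin> I" "(Y - const r) * h \<in> I"
    using eigenvector[OF I Y T add const mult g \<open>q \<noteq> 0\<close>] rel[OF g(1)] by auto
  have pow: "(Y ^ m - const (r ^ m)) * h \<in> I" for m
  proof (induction m)
    case 0
    then show ?case using lideal_zero[OF I] by simp
  next
    case (Suc m)
    have comm: "const c * (f * h) = f * (const c * h)" for c f
      by (simp add: mult.assoc[symmetric] const_central[of c f])
    have "(Y ^ Suc m - const (r ^ Suc m)) * h
        = Y * ((Y ^ m - const (r ^ m)) * h) + const (r ^ m) * ((Y - const r) * h)"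
      by (simp add: algebra_simps const_mult comm[of "r ^ m"])
    then show ?case using lideal_add[OF I] lideal_mult[OF I] Suc h Y by simp
  qed
  have "const (r ^ n - a - b * r) * h = (Y ^ n - const a - const b * Y) * h
     - (Y ^ n - const (r ^ n)) * h + const b * ((Y - const r) * h)"
    by (simp add: algebra_simps const_mult const_diff const_add)
  also have "\<dots> \<in> I"
    by (intro lideal_add[OF I] lideal_diff[OF I] lideal_mult[OF I] rel pow h) auto
  finally have "r ^ n - a - b * r = 0" using lideal_const[OF I] h T by blast
  then have "r ^ n = a + b * r" by (simp add: algebra_simps)
  then show ?thesis using h by blast
qed

end

section \<open>Jacobson's formula in associative rings\<close>

definition ad :: "'r::ring_1 \<Rightarrow> 'r \<Rightarrow> 'r" where
  "ad a b = a * b - b * a"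

text \<open>Left and right multiplication by a commute, so the binomial theorem applies to their
  difference.\<close>

lemma ad_funpow:
  "(ad a ^^ n) b = (\<Sum>k\<le>n. (-1) ^ k * of_nat (n choose k) * (a ^ (n - k) * b * a ^ k))"
proof (induction n)
  case (Suc n)
  define c :: "nat \<Rightarrow> nat \<Rightarrow> 'a" where "c m k = (-1) ^ k * of_nat (m choose k)" for m k
  define W where "W k = a ^ (Suc n - k) * b * a ^ k" for k
  have c_comm: "c m k * r = r * c m k" for m k r
  proof -
    have "(-1) ^ k * r = r * (-1) ^ k" by (cases "even k") simp_all
    then show ?thesis unfolding c_def by (metis mult.assoc mult_of_nat_commute)
  qed
  have "(ad a ^^ Suc n) b = ad a (\<Sum>k\<le>n. c n k * (a ^ (n - k) * b * a ^ k))"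
    using Suc by (simp add: c_def)
  also have "\<dots> = (\<Sum>k\<le>n. c n k * W k) - (\<Sum>k\<le>n. c n k * W (Suc k))"
  proof -
    have "a * (c n k * (a ^ (n - k) * b * a ^ k)) = c n k * W k" if "k \<le> n" for k
      using that by (simp add: W_def Suc_diff_le mult.assoc[symmetric] c_comm[of n k a])
    moreover have "c n k * (a ^ (n - k) * b * a ^ k) * a = c n k * W (Suc k)" for k
      by (simp add: W_def mult.assoc power_commutes)
    ultimately show ?thesis by (simp add: ad_def sum_distrib_left sum_distrib_right)
  qed
  also have "(\<Sum>k\<le>n. c n k * W k) = (\<Sum>k\<le>Suc n. c n k * W k)"
    by (simp add: c_def binomial_eq_0)
  also have "\<dots> = c n 0 * W 0 + (\<Sum>k\<le>n. c n (Suc k) * W (Suc k))"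
    by (rule sum.atMost_Suc_shift)
  also have "\<dots> - (\<Sum>k\<le>n. c n k * W (Suc k)) = c (Suc n) 0 * W 0 + (\<Sum>k\<le>n. c (Suc n) (Suc k) * W (Suc k))"
  proof -
    have "c (Suc n) (Suc k) = c n (Suc k) - c n k" for k
      by (simp add: c_def algebra_simps)
    then show ?thesis by (simp add: c_def left_diff_distrib sum_subtractf)
  qed
  also have "\<dots> = (\<Sum>k\<le>Suc n. c (Suc n) k * W k)"
    by (rule sum.atMost_Suc_shift[symmetric])
  finally show ?case by (simp only: c_def W_def)
qed simp

lemma fps_deriv_noncomm_power:
  fixes Z :: "'r::ring_1 fps"
  shows "fps_deriv (Z ^ n) = (\<Sum>k<n. Z ^ (n - Suc k) * fps_deriv Z * Z ^ k)"
proof (induction n)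
  case (Suc n)
  have "Z * (\<Sum>k<n. Z ^ (n - Suc k) * fps_deriv Z * Z ^ k)
      = (\<Sum>k<n. Z ^ (n - k) * fps_deriv Z * Z ^ k)"
    unfolding sum_distrib_left
    by (rule sum.cong) (simp_all add: mult.assoc[symmetric] Suc_diff_Suc flip: power_Suc)
  then show ?case using Suc by simp
qed simp

locale ring_char_p =
  fixes p :: nat and R :: "'r::ring_1 itself"
  assumes p_prime: "prime p" and p_odd: "odd p" and of_nat_p: "of_nat p = (0 :: 'r)"
begin

lemma of_nat_dvd: "p dvd n \<Longrightarrow> of_nat n = (0 :: 'r)"
  using of_nat_p by auto

text \<open>The inner binomial coefficients are divisible by p, and the oddness of p gives the last
  term its minus sign.\<close>

lemma ad_power_p: "(ad a ^^ p) b = ad (a ^ p) (b :: 'r)"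
proof -
  have p: "p > 1" using p_prime prime_gt_1_nat by blast
  have "(ad a ^^ p) b = (\<Sum>k\<in>{0, p}. (-1) ^ k * of_nat (p choose k) * (a ^ (p - k) * b * a ^ k))"
    unfolding ad_funpow
  proof (rule sum.mono_neutral_right)
    show "\<forall>k\<in>{..p} - {0, p}. (-1) ^ k * of_nat (p choose k) * (a ^ (p - k) * b * a ^ k) = 0"
    proof
      fix k assume "k \<in> {..p} - {0, p}"
      then have "p dvd (p choose k)" using p_prime by (intro dvd_choose_prime) auto
      then show "(-1) ^ k * of_nat (p choose k) * (a ^ (p - k) * b * a ^ k) = 0"
        by (simp add: of_nat_dvd)
    qed
  qed auto
  also have "\<dots> = ad (a ^ p) b" using p p_odd by (simp add: ad_def)
  finally show ?thesis .
qed

text \<open>Consecutive binomial coefficients of p - 1 add up to one of p, which is zero modulo p;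
  so they alternate in sign, starting from 1.\<close>

lemma choose_pred_p: "k < p \<Longrightarrow> (-1) ^ k * of_nat ((p - 1) choose k) = (1 :: 'r)"
proof (induction k)
  case (Suc k)
  have "p dvd (p choose Suc k)" using p_prime Suc.prems by (intro dvd_choose_prime) auto
  moreover have "p choose Suc k = ((p - 1) choose k) + ((p - 1) choose Suc k)"
    using Suc.prems by (cases p) auto
  ultimately have "of_nat ((p - 1) choose k) + of_nat ((p - 1) choose Suc k) = (0 :: 'r)"
    using of_nat_dvd by (metis of_nat_add)
  then have "of_nat ((p - 1) choose Suc k) = - (of_nat ((p - 1) choose k) :: 'r)"
    by (simp add: eq_neg_iff_add_eq_0 add.commute)
  then show ?case using Suc by simp
qed simp

lemma ad_power_pred_p: "(ad a ^^ (p - 1)) b = (\<Sum>k<p. a ^ (p - Suc k) * b * a ^ k :: 'r)"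
proof -
  have "{..p - 1} = {..<p}" using prime_gt_0_nat[OF p_prime] by auto
  then show ?thesis unfolding ad_funpow by (intro sum.cong) (simp_all add: choose_pred_p[unfolded One_nat_def])
qed

end

text \<open>The coefficient of T^j in ad(xT + y)^n applied to x. It is the associative counterpart
  of the sum in \<open>jacobson_s\<close>.\<close>

definition ad_words :: "'r::ring_1 \<Rightarrow> 'r \<Rightarrow> nat \<Rightarrow> nat \<Rightarrow> 'r" where
  "ad_words x y n j = (\<Sum>bs | length bs = n \<and> count_list bs True = j.
     foldr (\<lambda>b. ad (if b then x else y)) bs x)"

lemma finite_words: "finite {bs :: bool list. length bs = n \<and> P bs}"
  by (rule finite_subset[OF _ finite_lists_length_eq[of "UNIV :: bool set" n]]) auto

lemma ad_sum: "ad a (sum f A) = (\<Sum>i\<in>A. ad a (f i))"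
  by (simp add: ad_def sum_distrib_left sum_distrib_right sum_subtractf)

lemma ad_words_0: "ad_words x y 0 j = (if j = 0 then x else 0)"
proof -
  have "{bs. length bs = 0 \<and> count_list bs True = j} = (if j = 0 then {[]} else {})" by auto
  then show ?thesis by (simp add: ad_words_def)
qed

lemma ad_words_Suc:
  "ad_words x y (Suc n) j = ad y (ad_words x y n j) + (if j = 0 then 0 else ad x (ad_words x y n (j - 1)))"
proof -
  let ?W = "\<lambda>n j. {bs. length bs = n \<and> count_list bs True = j}"
  let ?T = "if j = 0 then {} else Cons True ` ?W n (j - 1)"
  have *: "?W (Suc n) j = Cons False ` ?W n j \<union> ?T"
  proof (rule Set.set_eqI)
    fix bs show "bs \<in> ?W (Suc n) j \<longleftrightarrow> bs \<in> Cons False ` ?W n j \<union> ?T"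
      by (cases bs) (auto simp: image_iff)
  qed
  have "ad_words x y (Suc n) j = (\<Sum>bs\<in>Cons False ` ?W n j. foldr (\<lambda>b. ad (if b then x else y)) bs x)
      + (\<Sum>bs\<in>?T. foldr (\<lambda>b. ad (if b then x else y)) bs x)"
    unfolding ad_words_def * by (rule sum.union_disjoint) (auto simp: finite_words)
  also have "(\<Sum>bs\<in>Cons False ` ?W n j. foldr (\<lambda>b. ad (if b then x else y)) bs x) = ad y (ad_words x y n j)"
    by (subst sum.reindex) (auto simp: ad_words_def ad_sum)
  also have "(\<Sum>bs\<in>?T. foldr (\<lambda>b. ad (if b then x else y)) bs x)
      = (if j = 0 then 0 else ad x (ad_words x y n (j - 1)))"
    by (cases "j = 0") (auto simp: ad_words_def ad_sum sum.reindex)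
  finally show ?thesis .
qed

context
  fixes x y :: "'r::ring_1" and Z :: "'r fps"
  defines "Z \<equiv> fps_const y + fps_const x * fps_X"
begin

lemma Z_mult_nth: "fps_nth (Z * A) j = y * fps_nth A j + (if j = 0 then 0 else x * fps_nth A (j - 1))"
  by (simp add: Z_def distrib_right mult.assoc)

lemma mult_Z_nth: "fps_nth (A * Z) j = fps_nth A j * y + (if j = 0 then 0 else fps_nth A (j - 1) * x)"
  by (simp add: Z_def distrib_left mult.assoc[symmetric])

lemma ad_words_fps: "fps_nth ((ad Z ^^ n) (fps_const x)) j = ad_words x y n j"
proof (induction n arbitrary: j)
  case 0
  show ?case by (simp add: ad_words_0)
next
  case (Suc n)
  then show ?case by (simp add: ad_words_Suc ad_def[of Z] Z_mult_nth mult_Z_nth) (simp add: ad_def)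
qed

lemma Z_power_nth_gt: "j > n \<Longrightarrow> fps_nth (Z ^ n) j = 0"
  by (induction n arbitrary: j) (simp_all add: Z_mult_nth)

lemma Z_power_nth_0: "fps_nth (Z ^ n) 0 = y ^ n"
  by (induction n) (simp_all add: Z_def)

lemma Z_power_nth_self: "fps_nth (Z ^ n) n = x ^ n"
  by (induction n) (simp_all add: Z_mult_nth Z_power_nth_gt)

text \<open>This is the value of the polynomial Z^n at T = 1. A power series cannot be evaluated
  there, so the coefficients up to n are added; the later ones vanish.\<close>

lemma add_power_sum: "(x + y) ^ n = (\<Sum>j\<le>n. fps_nth (Z ^ n) j)"
proof (induction n)
  case (Suc n)
  have "(\<Sum>j\<le>Suc n. fps_nth (Z ^ Suc n) j)
     = (\<Sum>j\<le>Suc n. y * fps_nth (Z ^ n) j) + (\<Sum>j\<le>Suc n. if j = 0 then 0 else x * fps_nth (Z ^ n) (j - 1))"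
    by (simp only: power_Suc Z_mult_nth sum.distrib)
  also have "(\<Sum>j\<le>Suc n. if j = 0 then 0 else x * fps_nth (Z ^ n) (j - 1)) = (\<Sum>j\<le>n. x * fps_nth (Z ^ n) j)"
    by (subst sum.atMost_Suc_shift) simp
  also have "(\<Sum>j\<le>Suc n. y * fps_nth (Z ^ n) j) = (\<Sum>j\<le>n. y * fps_nth (Z ^ n) j)"
    by (simp add: Z_power_nth_gt)
  finally show ?case using Suc by (simp add: sum_distrib_left distrib_right sum.distrib add.commute)
qed simp

lemma fps_deriv_Z: "fps_deriv Z = fps_const x"
  by (simp add: Z_def)

end

context ring_char_p
begin

text \<open>
  The coefficients of \<open>(xT + y)\<^sup>p\<close> in \<open>T\<close> are read off from its derivative
  \<open>\<Sum>\<^sub>k Z\<^bsup>p-1-k\<^esup> x Z\<^sup>k = ad(Z)\<^bsup>p-1\<^esup>(x)\<close> with \<open>Z = xT + y\<close>.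
\<close>

lemma jacobson:
  fixes x y :: 'r
  assumes c: "\<And>i. i \<in> {1..p - 1} \<Longrightarrow> of_nat i * c i = 1"
  shows "(x + y) ^ p = x ^ p + y ^ p + (\<Sum>i = 1..p - 1. c i * ad_words x y (p - 1) (i - 1))"
proof -
  have p1: "p > 1" using p_prime prime_gt_1_nat by blast
  define Z where "Z = fps_const y + fps_const x * fps_X"
  interpret fps: ring_char_p p "TYPE('r fps)"
    by unfold_locales (use p_prime p_odd of_nat_p in \<open>simp_all flip: fps_of_nat\<close>)
  have "fps_deriv (Z ^ p) = (ad Z ^^ (p - 1)) (fps_const x)"
    by (simp only: fps_deriv_noncomm_power fps.ad_power_pred_p fps_deriv_Z[where x = x and y = y, folded Z_def])
  then have coeff: "of_nat (Suc j) * fps_nth (Z ^ p) (Suc j) = ad_words x y (p - 1) j" for j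
    using ad_words_fps[where x = x and y = y, folded Z_def] by (metis Suc_eq_plus1 fps_deriv_nth)
  have coeff_eq: "fps_nth (Z ^ p) i = c i * ad_words x y (p - 1) (i - 1)" if "i \<in> {1..p - 1}" for i
  proof -
    have "c i * ad_words x y (p - 1) (i - 1) = c i * (of_nat i * fps_nth (Z ^ p) i)"
      using coeff[of "i - 1"] that by simp
    also have "\<dots> = fps_nth (Z ^ p) i"
      using c[OF that] by (simp add: mult.assoc[symmetric] mult_of_nat_commute[symmetric])
    finally show ?thesis by simp
  qed
  have "{..p} = insert 0 (insert p {1..p - 1})" using p1 by auto
  then have "(\<Sum>j\<le>p. fps_nth (Z ^ p) j) = y ^ p + (x ^ p + (\<Sum>j = 1..p - 1. fps_nth (Z ^ p) j))"
    using p1 Z_power_nth_0[where x = x and y = y, folded Z_def] Z_power_nth_self[where x = x and y = y, folded Z_def] by simp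
  also have "\<dots> = y ^ p + (x ^ p + (\<Sum>i = 1..p - 1. c i * ad_words x y (p - 1) (i - 1)))"
    using coeff_eq by simp
  finally show ?thesis using add_power_sum[where x = x and y = y and n = p, folded Z_def] by (simp add: algebra_simps)
qed

end

section \<open>The truncated current algebra\<close>

locale witt =
  fixes l :: nat
    and pm :: "'k::alg_closed_field witt \<Rightarrow> 'k witt"
    and \<chi> :: "'k witt \<Rightarrow> 'k"
  assumes p_gt: "CHAR('k) > 3"
    and l_ge: "l \<ge> 1"
    and restricted: "restricted_lie_algebra (witt_alg l pm)"
    and pm_e: "\<And>i k. -1 \<le> i \<Longrightarrow> i \<le> int CHAR('k) - 2 \<Longrightarrow> k \<le> l \<Longrightarrow>
      pm (witt_e l i k) = (if i = 0 then witt_e l i (k * CHAR('k)) else 0)"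
    and linear: "linear_form (witt_alg l pm) \<chi>"
    and height: "height l \<chi> = 1"
    and \<chi>_top: "\<chi> (witt_e l (-1) l) \<noteq> 0"
    and \<chi>_zero: "\<chi> (witt_e l 0 l) = 0"
begin

abbreviation "L \<equiv> witt_alg l pm"
abbreviation "L0 \<equiv> witt_alg0 l pm"
abbreviation e :: "int \<Rightarrow> nat \<Rightarrow> 'k witt" where "e \<equiv> witt_e l"
abbreviation Wf :: "int \<Rightarrow> 'k witt set" where "Wf \<equiv> witt_filt l"
abbreviation Ws :: "'k witt set" where "Ws \<equiv> witt_space l"
abbreviation br :: "'k witt \<Rightarrow> 'k witt \<Rightarrow> 'k witt" where "br \<equiv> witt_brk l"
abbreviation sc :: "'k \<Rightarrow> 'k witt \<Rightarrow> 'k witt" where "sc \<equiv> witt_scl"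

definition valid :: "int \<Rightarrow> nat \<Rightarrow> bool" where
  "valid i k \<longleftrightarrow> -1 \<le> i \<and> i \<le> int CHAR('k) - 2 \<and> k \<le> l"

interpretation W: restricted_lie_algebra L by (rule restricted)

lemma L_simps [simp]: "space L = Ws" "scl L = sc" "brk L = br" "pmap L = pm"
  by (simp_all add: witt_alg_def)

lemma L0_simps [simp]: "space L0 = Wf 0" "scl L0 = sc" "brk L0 = br" "pmap L0 = pm"
  by (simp_all add: witt_alg0_def witt_alg_def)

lemma prime_p: "prime CHAR('k)"
  using p_gt by (intro prime_CHAR_semidom) simp

lemma odd_p: "odd CHAR('k)"
  using prime_p p_gt prime_odd_nat by auto

lemma frobenius_add: "(a + b :: 'k) ^ CHAR('k) = a ^ CHAR('k) + b ^ CHAR('k)"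
  by (rule freshmans_dream[OF prime_p refl])

lemma frobenius_inj: "(a :: 'k) ^ CHAR('k) = b ^ CHAR('k) \<Longrightarrow> a = b"
  using frobenius_add[of "a - b" b] by simp

lemma p_root: "\<exists>r :: 'k. r ^ CHAR('k) = a"
  using nth_root_exists[of "CHAR('k)" a] p_gt by auto

lemma e_invalid: "\<not> valid i k \<Longrightarrow> e i k = 0"
  by (auto simp: witt_e_def valid_def)

lemma e_valid: "valid i k \<Longrightarrow> e i k = Poly_Mapping.single (i, k) 1"
  by (simp add: witt_e_def valid_def)

lemma witt_scl_single: "sc c (Poly_Mapping.single v d) = Poly_Mapping.single v (c * d)"
  by (simp add: witt_scl_def map_single)

lemma lookup_witt_scl: "Poly_Mapping.lookup (sc c x) v = c * Poly_Mapping.lookup x v"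
  by (simp add: witt_scl_def Poly_Mapping.map.rep_eq when_def)

lemma witt_scl_zero: "sc c 0 = 0" and witt_zero_scl: "sc 0 x = 0"
  by (auto intro!: poly_mapping_eqI simp: lookup_witt_scl)

lemma filt_space: "Wf (-1) = (Ws :: 'k witt set)"
  by (auto simp: witt_filt_def witt_space_def)

lemma filt_subset: "Wf j \<subseteq> (Ws :: 'k witt set)"
  by (auto simp: witt_filt_def)

lemma e_filt: "j \<le> i \<Longrightarrow> e i k \<in> Wf j"
  by (auto simp: witt_filt_def witt_space_def witt_e_def)

lemma e_space: "e i k \<in> Ws"
  using e_filt[of i i k] filt_subset by blast

lemma filt_zero: "0 \<in> Wf j"
  by (auto simp: witt_filt_def witt_space_def)

lemma filt_add: "x \<in> Wf j \<Longrightarrow> y \<in> Wf j \<Longrightarrow> (x + y :: 'k witt) \<in> Wf j"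
  unfolding witt_filt_def witt_space_def using keys_add[of x y] by auto

lemma filt_scl: "x \<in> Wf j \<Longrightarrow> sc c x \<in> Wf j"
  unfolding witt_filt_def witt_space_def by (auto simp: in_keys_iff lookup_witt_scl subset_iff)

lemma filt_sum: "(\<And>i. i \<in> A \<Longrightarrow> f i \<in> Wf j) \<Longrightarrow> sum f A \<in> (Wf j :: 'k witt set)"
  by (induction A rule: infinite_finite_induct) (auto intro: filt_add filt_zero)

lemma filt_induct [consumes 1, case_names zero add basis]:
  assumes "x \<in> Wf j"
    and "P 0"
    and add: "\<And>x y. x \<in> Wf j \<Longrightarrow> y \<in> Wf j \<Longrightarrow> P x \<Longrightarrow> P y \<Longrightarrow> P (x + y)"
    and basis: "\<And>i k c. valid i k \<Longrightarrow> j \<le> i \<Longrightarrow> P (sc c (e i k))"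
  shows "P x"
proof -
  have "x \<in> Wf j \<and> P x"
  proof (induction x rule: poly_mapping_induct_sum)
    case zero
    show ?case using assms(2) filt_zero by blast
  next
    case (add f g)
    then show ?case using assms(3) filt_add by blast
  next
    case (single w c)
    obtain i k where w: "w = (i, k)" by (cases w)
    then have ik: "valid i k" "j \<le> i" using single assms(1) by (auto simp: valid_def witt_filt_def witt_space_def)
    then have "Poly_Mapping.single w c = sc c (e i k)"
      by (simp add: w e_valid witt_scl_single)
    then show ?case using basis[OF ik] filt_scl[OF e_filt[OF ik(2)]] by metis
  qed
  then show ?thesis ..
qed

lemma brk_e:
  assumes "valid i k" "valid j m"
  shows "br (e i k) (e j m) = sc (of_int (j - i)) (e (i + j) (k + m))"
  using assms by (simp add: witt_brk_def e_valid[OF assms(1)] e_valid[OF assms(2)])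

lemma brk_zero_left: "br 0 y = 0" and brk_zero_right: "br x 0 = 0"
  by (simp_all add: witt_brk_def)

lemma brk_add_left: "x \<in> Ws \<Longrightarrow> y \<in> Ws \<Longrightarrow> z \<in> Ws \<Longrightarrow>
    br (x + y) z = br x z + br y z"
  using W.brk_add_left[of x y z] by simp

lemma brk_add_right: "x \<in> Ws \<Longrightarrow> y \<in> Ws \<Longrightarrow> z \<in> Ws \<Longrightarrow>
    br x (y + z) = br x y + br x z"
  using W.brk_add_right[of x y z] by simp

lemma brk_scl_left: "x \<in> Ws \<Longrightarrow> y \<in> Ws \<Longrightarrow>
    br (sc c x) y = sc c (br x y)"
  using W.brk_scl_left[of x y c] by simp

lemma brk_scl_right: "x \<in> Ws \<Longrightarrow> y \<in> Ws \<Longrightarrow>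
    br x (sc c y) = sc c (br x y)"
  using W.brk_scl_right[of x y c] by simp

lemma bilinear_induct:
  assumes x: "x \<in> Wf i" and y: "y \<in> Wf j"
    and zero: "P 0" and add: "\<And>u v. P u \<Longrightarrow> P v \<Longrightarrow> P (u + v)" and scl: "\<And>c u. P u \<Longrightarrow> P (sc c u)"
    and basis: "\<And>i' k j' m. valid i' k \<Longrightarrow> i \<le> i' \<Longrightarrow> valid j' m \<Longrightarrow> j \<le> j' \<Longrightarrow> P (br (e i' k) (e j' m))"
  shows "P (br x y)"
  using x
proof (induction rule: filt_induct)
  case (basis i' k c)
  have "P (br (e i' k) y)"
    using y
  proof (induction rule: filt_induct)
    case (basis j' m d)
    then show ?case using assms(6)[OF \<open>valid i' k\<close> \<open>i \<le> i'\<close>] by (simp add: brk_scl_right e_space scl)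
  qed (use filt_subset in \<open>auto simp: brk_zero_right zero brk_add_right e_space add subset_iff\<close>)
  then show ?case using y filt_subset by (auto simp: brk_scl_left e_space scl subset_iff)
qed (use y filt_subset in \<open>auto simp: brk_zero_left zero brk_add_left add subset_iff\<close>)

lemma filt_brk: "x \<in> Wf i \<Longrightarrow> y \<in> Wf j \<Longrightarrow> br x y \<in> Wf (i + j)"
  by (erule bilinear_induct[of _ i _ j]) (auto simp: brk_e intro!: filt_zero filt_add filt_scl e_filt)

lemma pm_zero: "pm 0 = 0"
proof -
  have "sc (0 ^ CHAR('k)) (pm 0) = 0" using p_gt by (simp add: witt_zero_scl zero_power)
  then show ?thesis using W.pmap_scl[of 0 0] filt_zero[of "-1"] by (simp add: filt_space witt_zero_scl)
qed

lemma pm_scl: "x \<in> Ws \<Longrightarrow> pm (sc c x) = sc (c ^ CHAR('k)) (pm x)"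
  using W.pmap_scl[of x c] by simp

lemma pm_add: "x \<in> Ws \<Longrightarrow> y \<in> Ws \<Longrightarrow>
    pm (x + y) = pm x + pm y + (\<Sum>i = 1..CHAR('k) - 1. jacobson_s L i x y)"
  using W.pmap_add[of x y] by simp

lemma pm_space: "x \<in> Ws \<Longrightarrow> pm x \<in> Ws"
  using W.pmap_closed[of x] by simp

lemma pm_brk: "x \<in> Ws \<Longrightarrow> y \<in> Ws \<Longrightarrow>
    br (pm x) y = (br x ^^ CHAR('k)) y"
  using W.pmap_brk[of x y] by simp

text \<open>Every iterated bracket in Jacobson's formula has an outermost bracket since \<open>p > 1\<close>.\<close>

lemma jacobson_s_induct:
  assumes x: "x \<in> Wf 0" and y: "y \<in> Wf 0"
    and zero: "P 0" and add: "\<And>u v. P u \<Longrightarrow> P v \<Longrightarrow> P (u + v)" and scl: "\<And>c u. P u \<Longrightarrow> P (sc c u)"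
    and brk: "\<And>u v. u \<in> Wf 0 \<Longrightarrow> v \<in> Wf 0 \<Longrightarrow> P (br u v)"
  shows "P (jacobson_s L i x y)"
proof -
  have sum: "P (sum f A)" if "\<And>a. a \<in> A \<Longrightarrow> P (f a)" for f and A :: "bool list set"
    using that by (induction A rule: infinite_finite_induct) (auto intro: add zero)
  have closed: "foldr (\<lambda>b. br (if b then x else y)) bs x \<in> Wf 0" for bs
    by (induction bs) (use x y filt_brk[of _ 0 _ 0] in auto)
  have "P (foldr (\<lambda>b. br (if b then x else y)) bs x)" if "length bs = CHAR('k) - 1" for bs
  proof (cases bs)
    case Nil
    then show ?thesis using that p_gt by simp
  next
    case (Cons b bs')
    then show ?thesis using brk closed x y by simp
  qed
  then show ?thesis unfolding jacobson_s_def by (auto intro!: scl sum)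
qed

text \<open>The p-map is additive up to Jacobson terms, which are built from brackets inside
  \<open>Wf 0\<close>, and its values on basis elements are prescribed.\<close>

lemma pm_filt0:
  assumes "x \<in> Wf 0"
  shows "pm x \<in> Wf 0"
  using assms
proof (induction rule: filt_induct)
  case zero
  then show ?case by (simp add: pm_zero filt_zero)
next
  case (add x y)
  have "jacobson_s L i x y \<in> Wf 0" for i
    by (rule jacobson_s_induct[OF add(1,2)])
      (auto intro: filt_zero filt_add filt_scl filt_brk[of _ 0 _ 0, simplified])
  then show ?case
    using add filt_subset by (auto simp: pm_add subset_iff intro!: filt_add filt_sum)
next
  case (basis i k c)
  then show ?case
    by (auto simp: pm_scl e_space pm_e valid_def intro!: filt_scl e_filt filt_zero)
qed

sublocale env_closed L \<chi>
proof unfold_locales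
  show "x + y \<in> space L" if "x \<in> space L" "y \<in> space L" for x y
    using that filt_add[of x "-1" y] by (simp add: filt_space)
  show "scl L c x \<in> space L" if "x \<in> space L" for c x
    using that filt_scl[of x "-1"] by (simp add: filt_space)
qed (use W.brk_closed pm_space in auto)

sublocale B: env_closed L0 \<chi>
  by unfold_locales (use filt_add filt_scl filt_brk[of _ 0 _ 0] pm_filt0 in auto)

section \<open>The linear form and the scalars attached to it\<close>

lemma \<chi>_add: "x \<in> Ws \<Longrightarrow> y \<in> Ws \<Longrightarrow> \<chi> (x + y) = \<chi> x + \<chi> y"
  using linear by (auto simp: linear_form_def)

lemma \<chi>_scl: "x \<in> Ws \<Longrightarrow> \<chi> (sc c x) = c * \<chi> x"
  using linear by (auto simp: linear_form_def)

lemma \<chi>_0: "\<chi> 0 = 0"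
  using \<chi>_scl[of 0 0] filt_zero[of "-1"] by (simp add: filt_space witt_scl_zero)

text \<open>The integers are not well-ordered, so the minimum in \<open>height\<close> is located on
  the naturals after the shift i = n - 1. The set of candidates is nonempty because no basis element
  has degree p or more.\<close>

lemma \<chi>_filt1:
  assumes "x \<in> Wf 1"
  shows "\<chi> x = 0"
proof -
  define Q where "Q i \<longleftrightarrow> -1 \<le> i \<and> (\<forall>x\<in>Wf i. \<chi> x = 0)" for i :: int
  have "Wf (int CHAR('k)) = {0 :: 'k witt}"
  proof -
    have "x = 0" if "x \<in> Wf (int CHAR('k))" for x :: "'k witt"
    proof -
      have "Poly_Mapping.keys x = {}" using that by (fastforce simp: witt_filt_def witt_space_def)
      then show ?thesis by simp
    qed
    then show ?thesis using filt_zero by blast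
  qed
  then have "Q (int CHAR('k))" by (simp add: Q_def \<chi>_0)
  then have ex: "\<exists>n. Q (int n - 1)" by (intro exI[of _ "Suc CHAR('k)"]) simp
  define n where "n = (LEAST n. Q (int n - 1))"
  have n: "Q (int n - 1)" unfolding n_def by (rule LeastI_ex[OF ex])
  have "(LEAST i. Q i) = int n - 1"
  proof (rule Least_equality[where P = Q, OF n])
    fix j assume j: "Q j"
    then have "-1 \<le> j" by (simp add: Q_def)
    then have "int (nat (j + 1)) - 1 = j" by simp
    then have "n \<le> nat (j + 1)" unfolding n_def using j by (intro Least_le) simp
    then show "int n - 1 \<le> j" using \<open>-1 \<le> j\<close> by linarith
  qed
  then have "Q 1" using n height by (simp add: height_def Q_def)
  then show ?thesis using assms by (simp add: Q_def)
qed

text \<open>The equation for \<chi>_i involves \<chi>_{ip}, whose index is larger, so the sequence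
  is built downward from l. The number d counts the indices already treated, and each step extracts
  one p-th root.\<close>

lemma chi_seq_exists:
  "\<exists>c. c 0 = (0::'k) \<and> (\<forall>m>l. c m = 0) \<and> (\<forall>i\<in>{1..l}. c i ^ CHAR('k) - c (i * CHAR('k)) = \<chi> (e 0 i) ^ CHAR('k))"
proof -
  have "\<exists>c. c 0 = (0::'k) \<and> (\<forall>m>l. c m = 0) \<and> (\<forall>i\<in>{1..l}. l < i + d \<longrightarrow> c i ^ CHAR('k) - c (i * CHAR('k)) = \<chi> (e 0 i) ^ CHAR('k))"
    if "d \<le> l" for d
    using that
  proof (induction d)
    case 0
    show ?case by (intro exI[of _ "\<lambda>_. 0"]) auto
  next
    case (Suc d)
    then obtain c where c: "c 0 = (0::'k)" "\<And>m. m > l \<Longrightarrow> c m = 0"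
      "\<And>i. i \<in> {1..l} \<Longrightarrow> l < i + d \<Longrightarrow> c i ^ CHAR('k) - c (i * CHAR('k)) = \<chi> (e 0 i) ^ CHAR('k)" by auto
    define j where "j = l - d"
    obtain r where r: "r ^ CHAR('k) = c (j * CHAR('k)) + \<chi> (e 0 j) ^ CHAR('k)" using p_root by blast
    have "j * CHAR('k) \<noteq> j" using Suc.prems p_gt by (simp add: j_def)
    moreover have "i * CHAR('k) \<noteq> j" if "i > j" for i
    proof -
      have "i * 1 \<le> i * CHAR('k)" using p_gt by (intro mult_le_mono) auto
      then show ?thesis using that by (simp only: mult_1_right)
    qed
    ultimately have "(c(j := r)) i ^ CHAR('k) - (c(j := r)) (i * CHAR('k)) = \<chi> (e 0 i) ^ CHAR('k)"
      if "i \<in> {1..l}" "l < i + Suc d" for i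
      using that c(3)[of i] r Suc.prems by (cases "i = j") (auto simp: j_def)
    then show ?case using c(1,2) Suc.prems by (intro exI[of _ "c(j := r)"]) (auto simp: j_def)
  qed
  from this[of l] show ?thesis by auto
qed

text \<open>The same downward recursion: \<chi>_{ip} is determined before \<chi>_i, and p-th roots
  are unique in characteristic p.\<close>

lemma chi_seq_unique:
  fixes c d :: "nat \<Rightarrow> 'k"
  assumes c: "c 0 = 0" "\<forall>m>l. c m = 0" "\<forall>i\<in>{1..l}. c i ^ CHAR('k) - c (i * CHAR('k)) = \<chi> (e 0 i) ^ CHAR('k)"
    and d: "d 0 = 0" "\<forall>m>l. d m = 0" "\<forall>i\<in>{1..l}. d i ^ CHAR('k) - d (i * CHAR('k)) = \<chi> (e 0 i) ^ CHAR('k)"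
  shows "c = d"
proof
  fix i show "c i = d i"
  proof (induction "Suc l - i" arbitrary: i rule: less_induct)
    case less
    show ?case
    proof (cases "i = 0 \<or> i > l")
      case False
      then have "i * 1 < i * CHAR('k)" using p_gt by (intro mult_strict_left_mono) auto
      then have "i < i * CHAR('k)" by (simp only: mult_1_right)
      then have "Suc l - i * CHAR('k) < Suc l - i" using False by linarith
      then have "c (i * CHAR('k)) = d (i * CHAR('k))" using less[of "i * CHAR('k)"] False by simp
      moreover have "c i ^ CHAR('k) - c (i * CHAR('k)) = d i ^ CHAR('k) - d (i * CHAR('k))" using c d False by simp
      ultimately have "c i ^ CHAR('k) = d i ^ CHAR('k)" by simp
      then show ?thesis by (rule frobenius_inj)
    qed (use c d in auto)
  qed
qed

abbreviation "c0 \<equiv> chi_seq l \<chi>"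

lemma chi_seq:
  shows "c0 0 = 0" "m > l \<Longrightarrow> c0 m = 0" "i \<in> {1..l} \<Longrightarrow> c0 i ^ CHAR('k) = c0 (i * CHAR('k)) + \<chi> (e 0 i) ^ CHAR('k)"
proof -
  let ?Q = "\<lambda>c. c 0 = (0::'k) \<and> (\<forall>m>l. c m = 0) \<and> (\<forall>i\<in>{1..l}. c i ^ CHAR('k) - c (i * CHAR('k)) = \<chi> (e 0 i) ^ CHAR('k))"
  have "\<exists>!c. ?Q c" using chi_seq_exists chi_seq_unique by blast
  then have "?Q c0" unfolding chi_seq_def by (rule theI')
  then show "c0 0 = 0" "m > l \<Longrightarrow> c0 m = 0" "i \<in> {1..l} \<Longrightarrow> c0 i ^ CHAR('k) = c0 (i * CHAR('k)) + \<chi> (e 0 i) ^ CHAR('k)"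
    by (auto simp: algebra_simps)
qed

text \<open>The index lp exceeds l, so the equation at l reads \<chi>_l^p = \<chi>(e_0t^l)^p. This
  is where the hypothesis \<chi>(e_0t^l) = 0 enters.\<close>

lemma chi_seq_top: "c0 l = 0"
proof -
  have "l * 1 < l * CHAR('k)" using p_gt l_ge by (intro mult_strict_left_mono) auto
  then have "c0 l ^ CHAR('k) = 0" using chi_seq(3)[of l] chi_seq(2)[of "l * CHAR('k)"] l_ge \<chi>_zero p_gt by simp
  then show ?thesis by simp
qed

section \<open>The characters of the nonnegative part\<close>

abbreviation "\<phi> \<equiv> weight_form l \<chi>"

definition wt :: "'k \<Rightarrow> nat \<Rightarrow> 'k" where
  "wt a k = (if k = 0 then a else c0 k)"

lemma \<phi>_add: "\<phi> a (x + y) = \<phi> a x + \<phi> a y"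
  by (simp add: weight_form_def lookup_add algebra_simps sum.distrib)

lemma \<phi>_scl: "\<phi> a (sc c x) = c * \<phi> a x"
  by (simp add: weight_form_def lookup_witt_scl algebra_simps sum_distrib_left)

lemma \<phi>_0: "\<phi> a 0 = 0"
  by (simp add: weight_form_def)

lemma \<phi>_e: "\<phi> a (e i k) = (if i = 0 then wt a k else 0)"
proof (cases "valid i k")
  case True
  have "(\<Sum>n = 1..l. c0 n * Poly_Mapping.lookup (e i k) (0, n))
      = (\<Sum>n = 1..l. if n = k then c0 n * Poly_Mapping.lookup (e i k) (0, k) else 0)"
    using True by (intro sum.cong) (auto simp: e_valid lookup_single when_def)
  also have "\<dots> = (if k \<in> {1..l} then c0 k * Poly_Mapping.lookup (e i k) (0, k) else 0)"
    by (simp add: sum.delta)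
  finally show ?thesis
    using True by (auto simp: weight_form_def e_valid lookup_single when_def wt_def valid_def)
next
  case False
  then have "i = 0 \<Longrightarrow> k > l" using p_gt by (auto simp: valid_def)
  then show ?thesis using False chi_seq(2)[of k] by (auto simp: e_invalid \<phi>_0 wt_def)
qed

text \<open>In degrees i, j >= 0 a bracket reaches degree 0 only for i = j = 0, where its
  coefficient j - i vanishes.\<close>

lemma \<phi>_brk:
  assumes "x \<in> Wf 0" "y \<in> Wf 0"
  shows "\<phi> a (br x y) = 0"
  using assms
  by (rule bilinear_induct[where P = "\<lambda>u. \<phi> a u = 0"])
    (auto simp: \<phi>_0 \<phi>_add \<phi>_scl brk_e \<phi>_e add_nonneg_eq_0_iff)

text \<open>Both sides are additive, since \<phi> kills the Jacobson terms. On e_0t^k the relation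
  is the defining equation of the weight or of \<chi>_k; in positive degree every term vanishes
  because the height is 1.\<close>

lemma \<phi>_p:
  assumes a: "a \<in> weights l \<chi>" and x: "x \<in> Wf 0"
  shows "\<phi> a x ^ CHAR('k) = \<phi> a (pm x) + \<chi> x ^ CHAR('k)"
  using x
proof (induction rule: filt_induct)
  case zero
  then show ?case using p_gt by (simp add: pm_zero \<phi>_0 \<chi>_0)
next
  case (add x y)
  have sp: "x \<in> Ws" "y \<in> Ws" using add filt_subset by auto
  have jac: "\<phi> a (jacobson_s L i x y) = 0" for i
    by (rule jacobson_s_induct[OF add(1,2)]) (auto simp: \<phi>_0 \<phi>_add \<phi>_scl \<phi>_brk)
  have "\<phi> a (\<Sum>i\<in>A. jacobson_s L i x y) = 0" for A
    by (induction A rule: infinite_finite_induct) (auto simp: \<phi>_0 \<phi>_add jac)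
  then show ?case using add sp by (simp add: pm_add \<phi>_add \<chi>_add frobenius_add)
next
  case (basis i k c)
  have "\<phi> a (e i k) ^ CHAR('k) = \<phi> a (pm (e i k)) + \<chi> (e i k) ^ CHAR('k)"
  proof (cases "i = 0")
    case True
    have "wt a k ^ CHAR('k) = wt a (k * CHAR('k)) + \<chi> (e 0 k) ^ CHAR('k)"
    proof (cases "k = 0")
      case True
      then show ?thesis using a by (simp add: wt_def weights_def algebra_simps)
    next
      case False
      then show ?thesis using chi_seq(3)[of k] basis p_gt by (simp add: wt_def valid_def)
    qed
    then show ?thesis using True basis by (simp add: \<phi>_e pm_e valid_def)
  next
    case False
    then have "e i k \<in> Wf 1" using basis by (intro e_filt) simp
    then show ?thesis using False basis \<chi>_filt1 p_gt by (simp add: \<phi>_e pm_e valid_def \<phi>_0)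
  qed
  then show ?case by (simp add: \<phi>_scl \<chi>_scl pm_scl e_space power_mult_distrib distrib_left)
qed

end

section \<open>Induced modules\<close>

locale induced = S: ring S
  for S :: "'s ring" and R :: "'r ring" and \<theta> :: "'r \<Rightarrow> 's" and N :: "('r, 'n) module" +
  assumes \<theta>_closed: "r \<in> carrier R \<Longrightarrow> \<theta> r \<in> carrier S"
    and N_add: "n \<in> carrier N \<Longrightarrow> n' \<in> carrier N \<Longrightarrow> n \<oplus>\<^bsub>N\<^esub> n' \<in> carrier N"
    and N_smult: "r \<in> carrier R \<Longrightarrow> n \<in> carrier N \<Longrightarrow> r \<odot>\<^bsub>N\<^esub> n \<in> carrier N"
begin

definition "G = free_Abelian_group (carrier S \<times> carrier N)"
definition "H = generate G (tensor_rels S R \<theta> N)"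
definition "tens s n = H #>\<^bsub>G\<^esub> frag_of (s, n)"
definition "lmul s = frag_extend (\<lambda>(s', n). frag_of (s \<otimes>\<^bsub>S\<^esub> s', n))"
abbreviation "Ind \<equiv> induced_module S R \<theta> N"

interpretation G: comm_group G
  unfolding G_def by (rule abelian_free_Abelian_group)

lemma G_simps [simp]:
  "f \<in> carrier G \<longleftrightarrow> Poly_Mapping.keys f \<subseteq> carrier S \<times> carrier N" "\<one>\<^bsub>G\<^esub> = 0" "f \<otimes>\<^bsub>G\<^esub> g = f + g"
  by (simp_all add: G_def)

lemma G_inv: "f \<in> carrier G \<Longrightarrow> inv\<^bsub>G\<^esub> f = - f"
  by (simp add: G_def)

lemma G_closed:
  "0 \<in> carrier G" "f \<in> carrier G \<Longrightarrow> g \<in> carrier G \<Longrightarrow> f + g \<in> carrier G"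
  "f \<in> carrier G \<Longrightarrow> g \<in> carrier G \<Longrightarrow> f - g \<in> carrier G"
  "s \<in> carrier S \<Longrightarrow> n \<in> carrier N \<Longrightarrow> frag_of (s, n) \<in> carrier G"
  using keys_add[of f g] keys_diff[of f g] by auto

lemma rels_closed: "tensor_rels S R \<theta> N \<subseteq> carrier G"
  unfolding tensor_rels_def using \<theta>_closed N_add N_smult
  by (auto simp del: G_simps intro!: G_closed)

lemma subgroup_H: "subgroup H G"
  unfolding H_def by (rule G.generate_is_subgroup[OF rels_closed])

lemma H_closed: "f \<in> H \<Longrightarrow> f \<in> carrier G"
  using subgroup_H by (rule subgroup.mem_carrier)

lemma H_zero: "0 \<in> H"
  using subgroup.one_closed[OF subgroup_H] by simp

lemma H_add: "f \<in> H \<Longrightarrow> g \<in> H \<Longrightarrow> f + g \<in> H"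
  using subgroup.m_closed[OF subgroup_H, of f g] by simp

lemma H_uminus: "f \<in> H \<Longrightarrow> - f \<in> H"
  using subgroup.m_inv_closed[OF subgroup_H, of f] G_inv[OF H_closed] by simp

lemma H_diff: "f \<in> H \<Longrightarrow> g \<in> H \<Longrightarrow> f - g \<in> H"
  using H_add[of f "- g"] H_uminus by simp

lemma H_rels: "f \<in> tensor_rels S R \<theta> N \<Longrightarrow> f \<in> H"
  unfolding H_def by (rule generate.incl)

lemma H_induct [consumes 1, case_names rel zero diff]:
  assumes "f \<in> H" and rel: "\<And>f. f \<in> tensor_rels S R \<theta> N \<Longrightarrow> P f" and zero: "P 0"
    and diff: "\<And>f g. P f \<Longrightarrow> P g \<Longrightarrow> P (f - g)"
  shows "P f"
  using assms(1) unfolding H_def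
proof (induction rule: generate.induct)
  case (inv h)
  then have "P (0 - h)" using zero rel diff by blast
  then show ?case using inv rels_closed G_inv by (simp add: subset_iff del: G_simps)
next
  case (eng f g)
  have "P (f - (0 - g))" using eng zero diff by blast
  then show ?case by simp
qed (use rel zero in auto)

lemma coset_eq_iff:
  assumes "f \<in> carrier G" "g \<in> carrier G"
  shows "H #>\<^bsub>G\<^esub> f = H #>\<^bsub>G\<^esub> g \<longleftrightarrow> f - g \<in> H"
proof
  assume "H #>\<^bsub>G\<^esub> f = H #>\<^bsub>G\<^esub> g"
  then have "f \<in> H #>\<^bsub>G\<^esub> g" using G.rcos_self[OF assms(1) subgroup_H] by simp
  then show "f - g \<in> H" by (auto simp: r_coset_def)
next
  assume "f - g \<in> H"
  then have "f \<in> H #>\<^bsub>G\<^esub> g" by (auto simp: r_coset_def intro!: bexI[of _ "f - g"])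
  then show "H #>\<^bsub>G\<^esub> f = H #>\<^bsub>G\<^esub> g"
    using G.repr_independence[OF _ assms(2) subgroup_H] by blast
qed

lemma normal_H: "H \<lhd> G"
  by (rule G.subgroup_imp_normal[OF subgroup_H])

lemma Ind_carrier: "carrier Ind = {H #>\<^bsub>G\<^esub> f | f. f \<in> carrier G}"
  by (auto simp: induced_module_def Let_def FactGroup_def RCOSETS_def G_def[symmetric] H_def[symmetric]
      simp del: G_simps)

lemma Ind_carrierI: "f \<in> carrier G \<Longrightarrow> H #>\<^bsub>G\<^esub> f \<in> carrier Ind"
  unfolding Ind_carrier by blast

lemma Ind_carrierE:
  assumes "x \<in> carrier Ind"
  obtains f where "f \<in> carrier G" "x = H #>\<^bsub>G\<^esub> f"
  using assms unfolding Ind_carrier by blast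

lemma Ind_add:
  assumes "f \<in> carrier G" "g \<in> carrier G"
  shows "(H #>\<^bsub>G\<^esub> f) \<oplus>\<^bsub>Ind\<^esub> (H #>\<^bsub>G\<^esub> g) = H #>\<^bsub>G\<^esub> (f + g)"
  using normal.rcos_sum[OF normal_H assms]
  by (simp add: induced_module_def Let_def FactGroup_def G_def[symmetric] H_def[symmetric])

lemma Ind_zero: "\<zero>\<^bsub>Ind\<^esub> = H #>\<^bsub>G\<^esub> 0"
  using G.coset_mult_one[of H] H_closed
  by (simp add: induced_module_def Let_def FactGroup_def G_def[symmetric] H_def[symmetric] subset_iff
      del: G_simps(1))

lemma lmul_simps:
  "lmul s 0 = 0" "lmul s (f + g) = lmul s f + lmul s g" "lmul s (f - g) = lmul s f - lmul s g"
  "lmul s (frag_of (s', n)) = frag_of (s \<otimes>\<^bsub>S\<^esub> s', n)"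
  by (simp_all add: lmul_def frag_extend_add frag_extend_diff)

lemma G_induct [consumes 1, case_names zero diff of]:
  assumes "f \<in> carrier G" and "P 0"
    and "\<And>f g. f \<in> carrier G \<Longrightarrow> g \<in> carrier G \<Longrightarrow> P f \<Longrightarrow> P g \<Longrightarrow> P (f - g)"
    and "\<And>s n. s \<in> carrier S \<Longrightarrow> n \<in> carrier N \<Longrightarrow> P (frag_of (s, n))"
  shows "P f"
  by (rule free_Abelian_group_induct[of f "carrier S \<times> carrier N"]) (use assms in auto)

lemma lmul_closed:
  assumes s: "s \<in> carrier S" and f: "f \<in> carrier G"
  shows "lmul s f \<in> carrier G"
  using f by (induction rule: G_induct) (use s in \<open>auto simp: lmul_simps simp del: G_simps intro!: G_closed\<close>)

text \<open>Left multiplication sends each defining relation to one of the same kind, because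
  balancing acts on the right of the S-factor. This makes the action on the quotient well
  defined.\<close>

lemma lmul_H:
  assumes s: "s \<in> carrier S" and f: "f \<in> H"
  shows "lmul s f \<in> H"
  using f
proof (induction rule: H_induct)
  case (rel f)
  consider (1) s1 s2 n where "f = frag_of (s1 \<oplus>\<^bsub>S\<^esub> s2, n) - frag_of (s1, n) - frag_of (s2, n)"
      "s1 \<in> carrier S" "s2 \<in> carrier S" "n \<in> carrier N"
    | (2) s1 n n' where "f = frag_of (s1, n \<oplus>\<^bsub>N\<^esub> n') - frag_of (s1, n) - frag_of (s1, n')"
      "s1 \<in> carrier S" "n \<in> carrier N" "n' \<in> carrier N"
    | (3) s1 r n where "f = frag_of (s1 \<otimes>\<^bsub>S\<^esub> \<theta> r, n) - frag_of (s1, r \<odot>\<^bsub>N\<^esub> n)"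
      "s1 \<in> carrier S" "r \<in> carrier R" "n \<in> carrier N"
    using rel unfolding tensor_rels_def by blast
  then have "lmul s f \<in> tensor_rels S R \<theta> N"
  proof cases
    case 1
    then have "lmul s f = frag_of (s \<otimes>\<^bsub>S\<^esub> s1 \<oplus>\<^bsub>S\<^esub> s \<otimes>\<^bsub>S\<^esub> s2, n) - frag_of (s \<otimes>\<^bsub>S\<^esub> s1, n) - frag_of (s \<otimes>\<^bsub>S\<^esub> s2, n)"
      using s by (simp add: lmul_simps S.r_distr)
    moreover have "s \<otimes>\<^bsub>S\<^esub> s1 \<in> carrier S" "s \<otimes>\<^bsub>S\<^esub> s2 \<in> carrier S" using 1 s by auto
    ultimately show ?thesis using 1 unfolding tensor_rels_def by blast
  next
    case 2
    then have "lmul s f = frag_of (s \<otimes>\<^bsub>S\<^esub> s1, n \<oplus>\<^bsub>N\<^esub> n') - frag_of (s \<otimes>\<^bsub>S\<^esub> s1, n) - frag_of (s \<otimes>\<^bsub>S\<^esub> s1, n')"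
      by (simp add: lmul_simps)
    moreover have "s \<otimes>\<^bsub>S\<^esub> s1 \<in> carrier S" using 2 s by auto
    ultimately show ?thesis using 2 unfolding tensor_rels_def by blast
  next
    case 3
    then have "lmul s f = frag_of ((s \<otimes>\<^bsub>S\<^esub> s1) \<otimes>\<^bsub>S\<^esub> \<theta> r, n) - frag_of (s \<otimes>\<^bsub>S\<^esub> s1, r \<odot>\<^bsub>N\<^esub> n)"
      using s \<theta>_closed by (simp add: lmul_simps S.m_assoc)
    moreover have "s \<otimes>\<^bsub>S\<^esub> s1 \<in> carrier S" using 3 s by auto
    ultimately show ?thesis using 3 unfolding tensor_rels_def by blast
  qed
  then show ?case by (rule H_rels)
qed (auto simp: lmul_simps H_zero intro: H_diff)

lemma Ind_smult:
  assumes s: "s \<in> carrier S" and f: "f \<in> carrier G"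
  shows "s \<odot>\<^bsub>Ind\<^esub> (H #>\<^bsub>G\<^esub> f) = H #>\<^bsub>G\<^esub> lmul s f"
proof -
  have eq: "H #>\<^bsub>G\<^esub> lmul s g = H #>\<^bsub>G\<^esub> lmul s f" if "g \<in> H #>\<^bsub>G\<^esub> f" for g
  proof -
    have g: "g \<in> carrier G" using G.r_coset_subset_G[of H f] f that H_closed by (auto simp del: G_simps)
    have "g - f \<in> H" using that by (auto simp: r_coset_def)
    then have "lmul s g - lmul s f \<in> H" using lmul_H[OF s] by (simp add: lmul_simps[symmetric])
    then show ?thesis using s f g lmul_closed coset_eq_iff by blast
  qed
  have "f \<in> H #>\<^bsub>G\<^esub> f" by (rule G.rcos_self[OF f subgroup_H])
  then have "(\<lambda>g. H #>\<^bsub>G\<^esub> lmul s g) ` (H #>\<^bsub>G\<^esub> f) = {H #>\<^bsub>G\<^esub> lmul s f}" using eq by blast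
  then have "quot_lift (\<lambda>g. H #>\<^bsub>G\<^esub> lmul s g) (H #>\<^bsub>G\<^esub> f) = H #>\<^bsub>G\<^esub> lmul s f"
    by (simp add: quot_lift_def)
  then show ?thesis
    by (simp add: induced_module_def Let_def G_def[symmetric] H_def[symmetric] lmul_def)
qed

lemma left_module_Ind: "left_module S Ind"
proof (intro left_module.intro left_module_axioms.intro S.ring_axioms)
  show "abelian_group Ind"
  proof (rule abelian_groupI)
    fix x assume "x \<in> carrier Ind"
    then obtain f where f: "f \<in> carrier G" "x = H #>\<^bsub>G\<^esub> f" by (auto simp: Ind_carrier simp del: G_simps)
    have "- f \<in> carrier G" using G_closed(3)[OF G_closed(1) f(1)] by simp
    then show "\<exists>y\<in>carrier Ind. y \<oplus>\<^bsub>Ind\<^esub> x = \<zero>\<^bsub>Ind\<^esub>"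
      using f Ind_add[of "- f" f] by (auto simp: Ind_carrier Ind_zero simp del: G_simps)
  qed (auto elim!: Ind_carrierE simp: Ind_add Ind_zero G_closed ac_simps Ind_carrierI simp del: G_simps)
next
  fix a b x y assume "a \<in> carrier S" and b: "b \<in> carrier S" and "x \<in> carrier Ind" "y \<in> carrier Ind"
  then obtain f g where *: "f \<in> carrier G" "x = H #>\<^bsub>G\<^esub> f" "g \<in> carrier G" "y = H #>\<^bsub>G\<^esub> g"
    "a \<in> carrier S" by (auto simp: Ind_carrier simp del: G_simps)
  show "a \<odot>\<^bsub>Ind\<^esub> x \<in> carrier Ind"
    using * lmul_closed by (auto simp: Ind_smult Ind_carrier simp del: G_simps)
  show "a \<odot>\<^bsub>Ind\<^esub> (x \<oplus>\<^bsub>Ind\<^esub> y) = a \<odot>\<^bsub>Ind\<^esub> x \<oplus>\<^bsub>Ind\<^esub> a \<odot>\<^bsub>Ind\<^esub> y"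
    using * by (simp add: Ind_smult Ind_add G_closed lmul_closed lmul_simps del: G_simps)
  have "lmul (a \<oplus>\<^bsub>S\<^esub> b) f - (lmul a f + lmul b f) \<in> H"
    using *(1)
  proof (induction rule: G_induct)
    case (diff f g)
    then show ?case
      using H_diff[of "lmul (a \<oplus>\<^bsub>S\<^esub> b) f - (lmul a f + lmul b f)" "lmul (a \<oplus>\<^bsub>S\<^esub> b) g - (lmul a g + lmul b g)"]
      by (simp add: lmul_simps algebra_simps)
  next
    case (of s n)
    then have "frag_of (a \<otimes>\<^bsub>S\<^esub> s \<oplus>\<^bsub>S\<^esub> b \<otimes>\<^bsub>S\<^esub> s, n) - frag_of (a \<otimes>\<^bsub>S\<^esub> s, n) - frag_of (b \<otimes>\<^bsub>S\<^esub> s, n)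
        \<in> tensor_rels S R \<theta> N"
      using *(5) b S.m_closed unfolding tensor_rels_def by blast
    then have "frag_of (a \<otimes>\<^bsub>S\<^esub> s \<oplus>\<^bsub>S\<^esub> b \<otimes>\<^bsub>S\<^esub> s, n) - frag_of (a \<otimes>\<^bsub>S\<^esub> s, n) - frag_of (b \<otimes>\<^bsub>S\<^esub> s, n) \<in> H"
      by (rule H_rels)
    then show ?case using of *(5) b by (simp add: lmul_simps S.l_distr algebra_simps)
  qed (simp add: lmul_simps H_zero)
  then show "(a \<oplus>\<^bsub>S\<^esub> b) \<odot>\<^bsub>Ind\<^esub> x = a \<odot>\<^bsub>Ind\<^esub> x \<oplus>\<^bsub>Ind\<^esub> b \<odot>\<^bsub>Ind\<^esub> x"
    using * b by (simp add: Ind_smult Ind_add coset_eq_iff lmul_closed G_closed del: G_simps)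
  have "lmul (a \<otimes>\<^bsub>S\<^esub> b) f = lmul a (lmul b f)"
    using *(1) by (induction rule: G_induct) (use *(5) b in \<open>simp_all add: lmul_simps S.m_assoc\<close>)
  then show "(a \<otimes>\<^bsub>S\<^esub> b) \<odot>\<^bsub>Ind\<^esub> x = a \<odot>\<^bsub>Ind\<^esub> (b \<odot>\<^bsub>Ind\<^esub> x)"
    using * b by (simp add: Ind_smult lmul_closed del: G_simps)
next
  fix x assume "x \<in> carrier Ind"
  then obtain f where f: "f \<in> carrier G" "x = H #>\<^bsub>G\<^esub> f" by (auto simp: Ind_carrier simp del: G_simps)
  have "lmul \<one>\<^bsub>S\<^esub> f = f"
    using f(1) by (induction rule: G_induct) (simp_all add: lmul_simps)
  then show "\<one>\<^bsub>S\<^esub> \<odot>\<^bsub>Ind\<^esub> x = x" using f by (simp add: Ind_smult del: G_simps)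
qed

lemma tens_closed: "s \<in> carrier S \<Longrightarrow> n \<in> carrier N \<Longrightarrow> tens s n \<in> carrier Ind"
  unfolding tens_def Ind_carrier using G_closed(4) by blast

lemma tens_smult:
  "a \<in> carrier S \<Longrightarrow> s \<in> carrier S \<Longrightarrow> n \<in> carrier N \<Longrightarrow> a \<odot>\<^bsub>Ind\<^esub> tens s n = tens (a \<otimes>\<^bsub>S\<^esub> s) n"
  unfolding tens_def by (simp add: Ind_smult G_closed lmul_simps del: G_simps)

lemma tens_balanced:
  assumes "s \<in> carrier S" "r \<in> carrier R" "n \<in> carrier N"
  shows "tens (s \<otimes>\<^bsub>S\<^esub> \<theta> r) n = tens s (r \<odot>\<^bsub>N\<^esub> n)"
proof -
  have "frag_of (s \<otimes>\<^bsub>S\<^esub> \<theta> r, n) - frag_of (s, r \<odot>\<^bsub>N\<^esub> n) \<in> tensor_rels S R \<theta> N"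
    using assms unfolding tensor_rels_def by blast
  then show ?thesis
    unfolding tens_def using assms \<theta>_closed N_smult H_rels
    by (subst coset_eq_iff) (auto simp del: G_simps intro!: G_closed)
qed

lemma tens_zero_iff:
  "s \<in> carrier S \<Longrightarrow> n \<in> carrier N \<Longrightarrow> tens s n = \<zero>\<^bsub>Ind\<^esub> \<longleftrightarrow> frag_of (s, n) \<in> H"
  unfolding tens_def Ind_zero by (subst coset_eq_iff) (simp_all add: G_closed del: G_simps)

lemma Ind_generated:
  assumes sub: "submodule P S Ind" and gen: "\<And>s n. s \<in> carrier S \<Longrightarrow> n \<in> carrier N \<Longrightarrow> tens s n \<in> P"
  shows "P = carrier Ind"
proof -
  interpret P: submodule P S Ind by (rule sub)
  interpret I: left_module S Ind by (rule left_module_Ind)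
  have "H #>\<^bsub>G\<^esub> f \<in> P" if "f \<in> carrier G" for f
    using that
  proof (induction rule: G_induct)
    case zero
    show ?case using P.one_closed by (simp add: Ind_zero)
  next
    case (diff f g)
    have "(H #>\<^bsub>G\<^esub> (f - g)) \<oplus>\<^bsub>Ind\<^esub> (H #>\<^bsub>G\<^esub> g) = H #>\<^bsub>G\<^esub> f"
      using diff by (simp add: Ind_add G_closed del: G_simps)
    moreover have "H #>\<^bsub>G\<^esub> (f - g) \<in> carrier Ind" "H #>\<^bsub>G\<^esub> g \<in> carrier Ind"
      using G_closed(3) diff unfolding Ind_carrier by blast+
    ultimately have "H #>\<^bsub>G\<^esub> (f - g) = (H #>\<^bsub>G\<^esub> f) \<ominus>\<^bsub>Ind\<^esub> (H #>\<^bsub>G\<^esub> g)"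
      by (metis I.M.a_closed I.M.add.inv_solve_right a_minus_def)
    then show ?case using P.m_closed P.m_inv_closed diff by (simp add: a_minus_def a_inv_def)
  next
    case (of s n)
    then show ?case using gen by (simp add: tens_def)
  qed
  then show ?thesis using P.subset by (auto simp: Ind_carrier simp del: G_simps)
qed

end

section \<open>Verma modules\<close>

context env
begin

lemma gen_zero_K: "x \<in> space L \<Longrightarrow> gen (scl L 0 x) \<in> K"
  using gen_scl_K[of x 0] by simp

lemma const_mult_comm: "f * (const c * g) = const c * (f * g)"
  by (simp add: mult.assoc[symmetric] const_central[of c f])

lemma p_power_K: "x \<in> space L \<Longrightarrow> gen (pmap L x) \<in> K \<Longrightarrow> gen x ^ CHAR('k) - const (\<chi> x ^ CHAR('k)) \<in> K"
  using K_add[OF gen_pmap_K[of x], of "gen (pmap L x)"] by simp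

end

section \<open>Weight ideals and their shift by \<open>X\<close>\<close>

context witt
begin

declare L_simps(1) [simp del] L0_simps(1) [simp del]

lemma p_pos: "0 < CHAR('k)"
  using p_gt by simp

lemma gen_0_K: "gen 0 \<in> K"
  using gen_zero_K[of "e 0 0"] by (simp add: witt_zero_scl e_space L_simps(1))

lemma gen_closed [simp, intro]: "x \<in> Ws \<Longrightarrow> gen x \<in> carrier F"
  by (simp add: L_simps(1) free_alg_closed)

lemma filt_gen_closed [intro]: "x \<in> Wf j \<Longrightarrow> gen x \<in> carrier F"
  using filt_subset by blast

lemma filt_gen_closed_B [simp, intro]: "x \<in> Wf 0 \<Longrightarrow> gen x \<in> carrier B.F"
  by (simp add: L0_simps(1) free_alg_closed)

lemma brk_K: "x \<in> Ws \<Longrightarrow> y \<in> Ws \<Longrightarrow> gen x * gen y - gen y * gen x - gen (br x y) \<in> K"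
  using gen_brk_K[of x y] by (simp add: L_simps(1))

lemma scl_K: "x \<in> Ws \<Longrightarrow> gen (sc c x) - const c * gen x \<in> K"
  using gen_scl_K[of x c] by (simp add: L_simps(1))

lemma add_K: "x \<in> Ws \<Longrightarrow> y \<in> Ws \<Longrightarrow> gen (x + y) - gen x - gen y \<in> K"
  using gen_add_K[of x y] by (simp add: L_simps(1))

text \<open>In the quotient by such an ideal the class of 1, unless it is zero, spans a copy of the
  one-dimensional module of weight a over the nonnegative part.\<close>

definition weight_ideal :: "'k \<Rightarrow> ('k, 'k witt) free set \<Rightarrow> bool" where
  "weight_ideal a I \<longleftrightarrow> lideal I \<and> (\<forall>y\<in>Wf 0. gen y - const (\<phi> a y) \<in> I)"

text \<open>The least weight ideal. It turns out to be the annihilator of the canonical generator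
  (\<open>ann_vac\<close>), so the quotient by it is a model of the Verma module.\<close>

definition J :: "'k \<Rightarrow> ('k, 'k witt) free set" where
  "J a = {f \<in> carrier F. \<forall>I. weight_ideal a I \<longrightarrow> f \<in> I}"

lemma weight_ideal_J: "weight_ideal a (J a)"
  using filt_gen_closed K_closed unfolding weight_ideal_def lideal_def J_def
  by (auto simp: free_alg_closed)

lemma lideal_J: "lideal (J a)"
  using weight_ideal_J by (simp add: weight_ideal_def)

lemma J_subset: "weight_ideal a I \<Longrightarrow> J a \<subseteq> I"
  by (auto simp: J_def)

lemma J_gen: "y \<in> Wf 0 \<Longrightarrow> gen y - const (\<phi> a y) \<in> J a"
  using weight_ideal_J by (simp add: weight_ideal_def)

definition X :: "('k, 'k witt) free" where
  "X = gen (e (-1) l)"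

definition \<kappa> :: 'k where
  "\<kappa> = \<chi> (e (-1) l) ^ CHAR('k)"

lemma X_closed: "X \<in> carrier F"
  unfolding X_def by (rule gen_closed[OF e_space])

lemma \<kappa>_nz: "\<kappa> \<noteq> 0"
  using \<chi>_top by (simp add: \<kappa>_def)

lemma X_p: "X ^ CHAR('k) - const \<kappa> \<in> K"
proof -
  have "pm (e (-1) l) = 0" using p_gt by (subst pm_e) auto
  then show ?thesis using p_power_K[of "e (-1) l"] gen_0_K by (simp add: X_def \<kappa>_def e_space L_simps(1))
qed

text \<open>
  Apart from the weight shift by \<open>[e\<^sub>0, e\<^bsub>-1\<^esub>t\<^sup>\<ell>] = -e\<^bsub>-1\<^esub>t\<^sup>\<ell>\<close>, brackets with \<open>e\<^bsub>-1\<^esub>t\<^sup>\<ell>\<close> only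
  produce elements that act by zero: the only dangerous value is \<open>[e\<^sub>1, e\<^bsub>-1\<^esub>t\<^sup>\<ell>] = -2e\<^sub>0t\<^sup>\<ell>\<close>, and \<open>\<chi>\<^sub>\<ell> = 0\<close>.
\<close>

lemma brk_top:
  assumes "y \<in> Wf 0"
  shows "br y (e (-1) l) + sc (Poly_Mapping.lookup y (0, 0)) (e (-1) l) \<in> Wf 0 \<and>
    \<phi> a (br y (e (-1) l) + sc (Poly_Mapping.lookup y (0, 0)) (e (-1) l)) = 0"
  using assms
proof (induction rule: filt_induct)
  case zero
  show ?case by (simp add: brk_zero_left witt_zero_scl filt_zero \<phi>_0)
next
  case (add x y)
  have "br (x + y) (e (-1) l) + sc (Poly_Mapping.lookup (x + y) (0, 0)) (e (-1) l)
      = (br x (e (-1) l) + sc (Poly_Mapping.lookup x (0, 0)) (e (-1) l))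
      + (br y (e (-1) l) + sc (Poly_Mapping.lookup y (0, 0)) (e (-1) l))"
    using add filt_subset
    by (auto simp: brk_add_left e_space subset_iff lookup_add intro!: poly_mapping_eqI
        simp: lookup_witt_scl algebra_simps)
  then show ?case using add by (simp add: filt_add \<phi>_add del: One_nat_def)
next
  case (basis i k c)
  have top: "valid (-1) l" using p_gt by (simp add: valid_def)
  have br: "br (sc c (e i k)) (e (-1) l) = sc c (sc (of_int (- 1 - i)) (e (i - 1) (k + l)))"
    using basis top by (simp add: brk_scl_left e_space brk_e)
  consider "i = 0" "k = 0" | "k > 0" | "i \<ge> 1" "k = 0" using basis by linarith
  then show ?case
  proof cases
    case 1
    have "br (sc c (e i k)) (e (-1) l) + sc (Poly_Mapping.lookup (sc c (e i k)) (0, 0)) (e (-1) l) = 0"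
      unfolding br using 1 basis
      by (intro poly_mapping_eqI) (simp add: lookup_add lookup_witt_scl e_valid)
    then show ?thesis by (simp only: \<phi>_0 filt_zero simp_thms)
  next
    case 2
    then have "e (i - 1) (k + l) = 0" by (intro e_invalid) (simp add: valid_def)
    moreover have "Poly_Mapping.lookup (sc c (e i k)) (0, 0) = 0"
      using 2 basis by (simp add: lookup_witt_scl e_valid lookup_single when_def)
    ultimately show ?thesis
      unfolding br by (simp add: witt_scl_zero witt_zero_scl filt_zero \<phi>_0)
  next
    case 3
    have "Poly_Mapping.lookup (sc c (e i k)) (0, 0) = 0"
      using 3 basis by (simp add: lookup_witt_scl e_valid lookup_single when_def)
    then show ?thesis
      using 3 l_ge unfolding br
      by (auto simp: witt_zero_scl \<phi>_scl \<phi>_e wt_def chi_seq_top intro!: filt_scl e_filt)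
  qed
qed

text \<open>The left ideal of all f with f X in \<open>J a\<close> satisfies the weight conditions
  for a - 1, hence contains the least ideal that does.\<close>

lemma J_shift1: "f \<in> J (a - 1) \<Longrightarrow> f * X \<in> J a"
proof -
  define I where "I = {f \<in> carrier F. f * X \<in> J a}"
  have "weight_ideal (a - 1) I"
    unfolding weight_ideal_def
  proof (intro conjI ballI)
    show "lideal I"
      unfolding lideal_def I_def using K_closed lideal_K[OF lideal_J] K_right[OF X_closed]
      by (auto simp: distrib_right mult.assoc intro: lideal_add[OF lideal_J] lideal_mult[OF lideal_J])
    fix y assume y: "y \<in> Wf 0"
    define y0 where "y0 = Poly_Mapping.lookup y (0, 0)"
    define x where "x = e (-1) l"
    define z where "z = br y x + sc y0 x"
    have ys: "y \<in> Ws" and xs: "x \<in> Ws" using y filt_subset e_space by (auto simp: x_def)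
    have brs: "br y x \<in> Ws" using filt_brk[of y "-1" x 0] brk_space[of y x] ys xs by (simp add: L_simps(1))
    have scs: "sc y0 x \<in> Ws" using xs scl_space[of x y0] by (simp add: L_simps(1))
    have z: "z \<in> Wf 0" "\<phi> a z = 0" using brk_top[OF y] by (simp_all add: z_def x_def y0_def)
    have \<phi>: "\<phi> (a - 1) y = \<phi> a y - y0" by (simp add: weight_form_def y0_def algebra_simps)
    \<comment> \<open>Moving X to the left of y produces the bracket of y with e_{-1}t^l. Together
      with the weight shift \<open>y0\<close> it forms z, on which \<phi> a vanishes; the other
      terms are relations in \<open>K\<close>.\<close>
    have "(gen y - const (\<phi> (a - 1) y)) * X
       = X * (gen y - const (\<phi> a y)) + (gen y * gen x - gen x * gen y - gen (br y x))
         + (gen z - const (\<phi> a z)) - (gen z - gen (br y x) - gen (sc y0 x)) - (gen (sc y0 x) - const y0 * gen x)"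
      by (simp add: X_def x_def \<phi> z(2)[unfolded x_def] z_def[symmetric, unfolded x_def] const_diff algebra_simps const_central)
    also have "\<dots> \<in> J a"
      unfolding z_def
      by (intro lideal_add[OF lideal_J] lideal_diff[OF lideal_J] lideal_mult[OF lideal_J] X_closed
          J_gen y z[unfolded z_def] lideal_K[OF lideal_J] brk_K scl_K add_K ys xs brs scs)
    finally show "gen y - const (\<phi> (a - 1) y) \<in> I"
      using free_alg_closed(8)[OF filt_gen_closed[OF y] free_alg_closed(3)] by (simp add: I_def)
  qed
  then show "f \<in> J (a - 1) \<Longrightarrow> f * X \<in> J a" using J_subset[of "a - 1" I] by (auto simp: I_def)
qed

lemma J_shift: "f \<in> J (a - of_nat j) \<Longrightarrow> f * X ^ j \<in> J a"
proof (induction j arbitrary: f)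
  case (Suc j)
  have "f * X \<in> J (a - of_nat j)"
    using Suc.prems by (intro J_shift1) (simp add: algebra_simps)
  from Suc.IH[OF this] show ?case by (simp add: mult.assoc)
qed simp

text \<open>A further factor X^(p-j) leads from \<open>J a\<close> to
  \<open>J (a - of_nat j)\<close>, because a = (a - j) - (p - j) in characteristic p; and X^p is the
  nonzero scalar \<kappa> modulo \<open>K\<close>.\<close>

lemma J_unshift:
  assumes f: "f \<in> carrier F" and j: "j \<le> CHAR('k)" and fX: "f * X ^ j \<in> J a"
  shows "f \<in> J (a - of_nat j)"
proof -
  define b where "b = a - of_nat j"
  define j' where "j' = CHAR('k) - j"
  have "of_nat j + of_nat j' = (of_nat CHAR('k) :: 'k)" using j by (simp add: j'_def flip: of_nat_add)
  then have "b - of_nat j' = a" by (simp add: b_def algebra_simps)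
  then have "f * X ^ j * X ^ j' \<in> J b" using J_shift[of _ b j'] fX by simp
  moreover have "X ^ j * X ^ j' = X ^ CHAR('k)" using j by (simp add: j'_def flip: power_add)
  ultimately have 1: "f * X ^ CHAR('k) \<in> J b" by (simp add: mult.assoc)
  have "f * (X ^ CHAR('k) - const \<kappa>) \<in> J b" by (intro lideal_K[OF lideal_J] K_left f X_p)
  from lideal_diff[OF lideal_J 1 this] have "const \<kappa> * f \<in> J b"
    by (simp add: algebra_simps const_central)
  then show ?thesis using lideal_const[OF lideal_J _ f] \<kappa>_nz by (auto simp: b_def)
qed

lemma of_nat_frobenius: "(of_nat j :: 'k) ^ CHAR('k) = of_nat j"
  by (induction j) (simp_all add: frobenius_add p_pos power_0_left)

text \<open>The difference of two weights is a root of T^p - T. This polynomial has at most p roots,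
  and the p elements of the prime field already are roots.\<close>

lemma weights_diff:
  assumes "a \<in> weights l \<chi>" "b \<in> weights l \<chi>"
  obtains j where "j < CHAR('k)" "b = a - of_nat j"
proof -
  define q :: "'k poly" where "q = monom 1 CHAR('k) - [:0, 1:]"
  have "coeff q CHAR('k) = 1" using p_gt by (auto simp: q_def coeff_pCons split: nat.splits)
  then have q: "q \<noteq> 0" by auto
  have deg: "degree q \<le> CHAR('k)"
    unfolding q_def using p_gt by (intro degree_diff_le) (auto simp: degree_monom_le)
  have roots: "poly q x = 0 \<longleftrightarrow> x ^ CHAR('k) = x" for x
    by (simp add: q_def poly_monom)
  have inj: "inj_on (of_nat :: nat \<Rightarrow> 'k) {..<CHAR('k)}"
  proof (rule linorder_inj_onI')
    fix i j assume "i \<in> {..<CHAR('k)}" "j \<in> {..<CHAR('k)}" "i < j"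
    then have "\<not> CHAR('k) dvd j - i" by (auto dest: dvd_imp_le)
    then have "of_nat (j - i) \<noteq> (0 :: 'k)" by (simp add: of_nat_eq_0_iff_char_dvd)
    then show "of_nat i \<noteq> (of_nat j :: 'k)" using \<open>i < j\<close> by (simp add: of_nat_diff)
  qed
  have "card {x. poly q x = 0} \<le> card ((of_nat :: nat \<Rightarrow> 'k) ` {..<CHAR('k)})"
    using card_poly_roots_bound[OF q] deg by (simp add: card_image[OF inj])
  moreover have "of_nat ` {..<CHAR('k)} \<subseteq> {x. poly q x = 0}"
    by (auto simp: roots of_nat_frobenius)
  ultimately have eq: "of_nat ` {..<CHAR('k)} = {x. poly q x = 0}"
    using poly_roots_finite[OF q] by (intro card_seteq) auto
  have "(a - b) ^ CHAR('k) + b ^ CHAR('k) = a ^ CHAR('k)"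
    by (simp flip: frobenius_add)
  then have "(a - b) ^ CHAR('k) = a - b" using assms by (simp add: weights_def algebra_simps)
  then have "a - b \<in> of_nat ` {..<CHAR('k)}" unfolding eq by (simp add: roots)
  then obtain j where "j < CHAR('k)" "a - b = of_nat j" by auto
  then show ?thesis using that[of j] by (simp add: algebra_simps)
qed

section \<open>Comparison with the nonnegative part\<close>

lemma lideal_restrict: "ideal (K \<inter> carrier B.F) B.F"
proof (rule idealI[OF ring_free_alg])
  have sub: "carrier B.F \<subseteq> carrier F" using free_alg_mono[OF filt_subset] by (simp add: L_simps(1) L0_simps(1))
  interpret F: ring B.F by (rule ring_free_alg)
  show "subgroup (K \<inter> carrier B.F) (add_monoid B.F)"
    using sub K_zero K_left[of "- 1"] by (intro F.add.subgroupI) (auto intro: K_add)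
  show "x \<otimes>\<^bsub>B.F\<^esub> a \<in> K \<inter> carrier B.F" "a \<otimes>\<^bsub>B.F\<^esub> x \<in> K \<inter> carrier B.F"
    if "a \<in> K \<inter> carrier B.F" "x \<in> carrier B.F" for a x
    using that sub by (auto intro: K_left K_right)
qed

text \<open>Relations of the subalgebra are relations of the whole algebra. This makes the map
  \<theta> between the two reduced enveloping algebras well defined.\<close>

lemma B_K_subset: "B.K \<subseteq> K"
proof -
  have sp: "x \<in> Wf 0 \<Longrightarrow> x \<in> Ws" for x using filt_subset by auto
  have "env_rels L0 \<subseteq> K"
  proof
    fix r assume "r \<in> env_rels L0"
    then show "r \<in> K"
      unfolding env_rels_def L0_simps using add_K brk_K scl_K sp by blast
  qed
  moreover have "B.p_rels \<subseteq> K"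
    unfolding B.p_rels_def using gen_pmap_K sp by (auto simp: L_simps(1) L0_simps(1))
  ultimately have "B.K \<subseteq> K \<inter> carrier B.F"
    using B.env_rels_closed B.p_rels_closed by (intro B.K_minimal lideal_restrict) auto
  then show ?thesis by blast
qed

lemma B_F_subset: "f \<in> carrier B.F \<Longrightarrow> f \<in> carrier F"
  using free_alg_mono[OF filt_subset[of 0]] by (auto simp: L_simps(1) L0_simps(1))

definition \<theta> :: "'k ured \<Rightarrow> 'k ured" where
  "\<theta> = red_lift \<pi>"

lemma \<theta>: "f \<in> carrier B.F \<Longrightarrow> \<theta> (B.\<pi> f) = \<pi> f"
  unfolding \<theta>_def using B_K_subset B_F_subset red_proj_eq_iff
  by (intro B.red_lift_proj) blast+

text \<open>The zeros of the evaluation form an ideal that contains all relations, by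
  \<open>\<phi>_brk\<close> and \<open>\<phi>_p\<close>. Hence the action on the one-dimensional
  module is well defined.\<close>

lemma char_eval_kernel:
  assumes a: "a \<in> weights l \<chi>" and f: "f \<in> B.K"
  shows "char_eval (\<phi> a) f = 0"
proof -
  let ?I = "{f \<in> carrier B.F. char_eval (\<phi> a) f = 0}"
  have "B.K \<subseteq> ?I"
  proof (rule B.K_minimal)
    interpret F: ring B.F by (rule ring_free_alg)
    show "ideal ?I B.F"
    proof (rule idealI[OF ring_free_alg])
      have um: "char_eval (\<phi> a) (- f) = - char_eval (\<phi> a) f" for f :: "('k, 'k witt) free"
        using char_eval_simps(4)[of "\<phi> a" 0 f] by (simp add: char_eval_simps)
      show "subgroup ?I (add_monoid B.F)"
        by (intro F.add.subgroupI) (auto simp: char_eval_simps um intro: exI[of _ 0])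
    qed (auto simp: char_eval_simps)
    have "f \<in> ?I" if "f \<in> env_rels L0" for f
    proof -
      have "f \<in> carrier B.F" using that B.env_rels_closed by blast
      moreover have "char_eval (\<phi> a) f = 0"
        using that unfolding env_rels_def L0_simps
        by (auto simp: char_eval_simps \<phi>_add \<phi>_scl \<phi>_brk mult.commute)
      ultimately show ?thesis by simp
    qed
    then show "env_rels L0 \<subseteq> ?I" by blast
    have "f \<in> ?I" if "f \<in> B.p_rels" for f
    proof -
      have "f \<in> carrier B.F" using that B.p_rels_closed by blast
      moreover have "char_eval (\<phi> a) f = 0"
        using that unfolding B.p_rels_def L0_simps
        by (auto simp: char_eval_simps \<phi>_p[OF a])
      ultimately show ?thesis by simp
    qed
    then show "B.p_rels \<subseteq> ?I" by blast
  qed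
  then show ?thesis using f by blast
qed

lemma char_module_smult:
  assumes "a \<in> weights l \<chi>" "f \<in> carrier B.F"
  shows "B.\<pi> f \<odot>\<^bsub>char_module (\<phi> a)\<^esub> c = char_eval (\<phi> a) f * c"
proof -
  have "char_eval (\<phi> a) g = char_eval (\<phi> a) h" if "g - h \<in> B.K" for g h
    using char_eval_kernel[OF assms(1) that] by (simp add: char_eval_simps)
  then have "red_lift (char_eval (\<phi> a)) (B.\<pi> f) = char_eval (\<phi> a) f"
    using assms(2) by (intro B.red_lift_proj) blast+
  then show ?thesis by (simp add: char_module_def)
qed

lemma char_module_simps: "carrier (char_module \<psi>) = UNIV" "c \<oplus>\<^bsub>char_module \<psi>\<^esub> d = c + d"
  by (simp_all add: char_module_def)

lemma J_char_eval:
  assumes "f \<in> carrier B.F"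
  shows "f - const (char_eval (\<phi> a) f) \<in> J a"
  using assms
proof (induction rule: free_alg_induct)
  case (add f g)
  then show ?case using lideal_add[OF lideal_J add(3,4)] by (simp add: char_eval_simps const_add algebra_simps)
next
  case (const c)
  then show ?case by (simp add: char_eval_simps lideal_zero[OF lideal_J])
next
  case (gen x f)
  then have x: "x \<in> Wf 0" by (simp add: L0_simps(1))
  have "gen x * f - const (char_eval (\<phi> a) (gen x * f))
    = gen x * (f - const (char_eval (\<phi> a) f)) + const (char_eval (\<phi> a) f) * (gen x - const (\<phi> a x))"
  proof -
    have "const (\<phi> a x * char_eval (\<phi> a) f) = const (char_eval (\<phi> a) f) * const (\<phi> a x)"
      by (simp add: mult.commute flip: const_mult)
    then show ?thesis
      by (simp add: char_eval_simps right_diff_distrib const_central[of "char_eval (\<phi> a) f" "gen x"])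
  qed
  then show ?case
    using lideal_add[OF lideal_J lideal_mult[OF lideal_J filt_gen_closed[OF x] gen(3)]
        lideal_mult[OF lideal_J free_alg_closed(3) J_gen[OF x]]] by simp
qed

section \<open>The Verma module of a fixed weight as a cyclic module\<close>

context
  fixes a assumes a: "a \<in> weights l \<chi>"
begin

interpretation V: induced U "red_env_alg L0 \<chi>" \<theta> "char_module (\<phi> a)"
proof (intro induced.intro induced_axioms.intro ring_U)
  fix r assume "r \<in> carrier (red_env_alg L0 \<chi>)"
  then obtain f where "f \<in> carrier B.F" "r = B.\<pi> f" using B.red_proj_surj by blast
  then show "\<theta> r \<in> carrier U" using \<theta> B_F_subset by auto
qed (simp_all add: char_module_simps)

lemma verma_eq: "verma l pm \<chi> a = V.Ind"
  by (simp add: verma_def \<theta>_def)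

abbreviation "vac \<equiv> V.tens (\<pi> 1) 1"

lemma left_module_verma: "left_module U (verma l pm \<chi> a)"
  unfolding verma_eq by (rule V.left_module_Ind)

lemma tens_eq:
  assumes "f \<in> carrier F" "g \<in> carrier B.F"
  shows "V.tens (\<pi> (f * g)) c = V.tens (\<pi> f) (char_eval (\<phi> a) g * c)"
  using V.tens_balanced[of "\<pi> f" "B.\<pi> g" c] assms B_F_subset[OF assms(2)]
  by (simp add: char_module_simps char_module_smult[OF a] \<theta> red_proj_mult)

lemma vac_closed: "vac \<in> carrier V.Ind"
  by (rule V.tens_closed) (auto simp: char_module_simps)

lemma act_vac: "f \<in> carrier F \<Longrightarrow> \<pi> f \<odot>\<^bsub>V.Ind\<^esub> vac = V.tens (\<pi> f) 1"
  by (subst V.tens_smult) (auto simp: char_module_simps simp flip: red_proj_mult)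

lemma orbit_vac: "orbit V.Ind vac = carrier V.Ind"
proof (rule V.Ind_generated)
  show "submodule (orbit V.Ind vac) U V.Ind"
    by (rule submodule_orbit[OF V.left_module_Ind vac_closed])
  fix s and c :: 'k assume "s \<in> carrier U"
  then obtain f where f: "f \<in> carrier F" "s = \<pi> f" using red_proj_surj by blast
  have "V.tens s c = \<pi> (f * const c) \<odot>\<^bsub>V.Ind\<^esub> vac"
    using f tens_eq[of f "const c" 1] by (simp add: act_vac free_alg_closed char_eval_simps)
  then show "V.tens s c \<in> orbit V.Ind vac" using f unfolding orbit_def by blast
qed

lemma weight_ideal_ann_vac: "weight_ideal a (ann V.Ind vac)"
  unfolding weight_ideal_def
proof (intro conjI ballI)
  show "lideal (ann V.Ind vac)" by (rule lideal_ann[OF V.left_module_Ind vac_closed])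
  fix y assume y: "y \<in> Wf 0"
  have "V.tens (\<pi> (gen y)) 1 = V.tens (\<pi> (const (\<phi> a y))) 1"
    using tens_eq[of 1 "gen y" 1] tens_eq[of 1 "const (\<phi> a y)" 1] y
    by (simp add: char_eval_simps)
  then show "gen y - const (\<phi> a y) \<in> ann V.Ind vac"
    using act_eq_iff[OF V.left_module_Ind filt_gen_closed[OF y] free_alg_closed(3)[of "\<phi> a y"] vac_closed]
    by (simp add: act_vac filt_gen_closed[OF y])
qed

text \<open>
  Evaluating formal sums of pairs at representatives modulo \<open>K\<close> sends all relations of the tensor
  product into \<open>J a\<close>; this bounds the annihilator of the canonical generator from above.
\<close>

definition \<Psi> :: "('k ured \<times> 'k \<Rightarrow>\<^sub>0 int) \<Rightarrow> ('k, 'k witt) free" where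
  "\<Psi> z = (\<Sum>(s, n)\<in>Poly_Mapping.keys z. of_int (Poly_Mapping.lookup z (s, n)) * (red_rep s * const n))"

lemma \<Psi>_add: "\<Psi> (z + w) = \<Psi> z + \<Psi> w"
  unfolding \<Psi>_def case_prod_beta prod.collapse
  by (rule setsum_keys_plus_distrib) (simp_all add: distrib_right)

lemma \<Psi>_diff: "\<Psi> (z - w) = \<Psi> z - \<Psi> w"
  using \<Psi>_add[of "z - w" w] by simp

lemma \<Psi>_of: "\<Psi> (frag_of (s, n)) = red_rep s * const n"
  by (simp add: \<Psi>_def keys_frag_of)

lemma red_rep_proj: "f \<in> carrier F \<Longrightarrow> red_rep (\<pi> f) \<in> carrier F \<and> red_rep (\<pi> f) - f \<in> K"
  using red_rep[of "\<pi> f"] red_proj_eq_iff[of "red_rep (\<pi> f)" f] by auto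

lemma \<Psi>_H:
  assumes "z \<in> V.H"
  shows "\<Psi> z \<in> J a"
  using assms
proof (induction rule: V.H_induct)
  case (rel z)
  let ?N = "char_module (\<phi> a)"
  consider (1) s s' n where "z = frag_of (s \<oplus>\<^bsub>U\<^esub> s', n) - frag_of (s, n) - frag_of (s', n)"
      "s \<in> carrier U" "s' \<in> carrier U"
    | (2) s n n' where "z = frag_of (s, n \<oplus>\<^bsub>?N\<^esub> n') - frag_of (s, n) - frag_of (s, n')" "s \<in> carrier U"
    | (3) s r n where "z = frag_of (s \<otimes>\<^bsub>U\<^esub> \<theta> r, n) - frag_of (s, r \<odot>\<^bsub>?N\<^esub> n)"
      "s \<in> carrier U" "r \<in> carrier (red_env_alg L0 \<chi>)"
    using rel unfolding tensor_rels_def by blast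
  then show ?case
  proof cases
    case 1
    then obtain f g where fg: "f \<in> carrier F" "s = \<pi> f" "g \<in> carrier F" "s' = \<pi> g"
      using red_proj_surj[OF 1(2)] red_proj_surj[OF 1(3)] by blast
    have "\<Psi> z = ((red_rep (\<pi> (f + g)) - (f + g)) - (red_rep (\<pi> f) - f) - (red_rep (\<pi> g) - g)) * const n"
      unfolding 1(1) fg(2,4) using fg by (simp add: \<Psi>_diff \<Psi>_add \<Psi>_of red_proj_add algebra_simps)
    also have "\<dots> \<in> K"
      using K_right[OF free_alg_closed(3) lideal_diff[OF lideal_K_self lideal_diff[OF lideal_K_self]]]
        fg red_rep_proj[of f] red_rep_proj[of g] red_rep_proj[of "f + g"] by blast
    finally show ?thesis by (rule lideal_K[OF lideal_J])
  next
    case 2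
    have "\<Psi> z = 0" unfolding 2(1) by (simp add: \<Psi>_diff \<Psi>_add \<Psi>_of char_module_simps const_add algebra_simps)
    then show ?thesis by (simp add: lideal_zero[OF lideal_J])
  next
    case 3
    then obtain f g where fg: "f \<in> carrier F" "s = \<pi> f" "g \<in> carrier B.F" "r = B.\<pi> g"
      using red_proj_surj[OF 3(2)] B.red_proj_surj[OF 3(3)] by blast
    then have g: "g \<in> carrier F" by (rule_tac B_F_subset)
    have "\<Psi> z = red_rep (\<pi> (f * g)) * const n - red_rep (\<pi> f) * const (char_eval (\<phi> a) g * n)"
      unfolding 3(1) fg(2,4) using fg g by (simp add: \<Psi>_diff \<Psi>_add \<Psi>_of \<theta> char_module_smult[OF a] red_proj_mult)
    \<comment> \<open>The first two differences lie in \<open>K\<close>, since a representative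
      agrees with f * g or f modulo \<open>K\<close>. The last term lies in \<open>J a\<close>,
      because modulo \<open>J a\<close> the element g equals its character value.\<close>
    also have "\<dots> = (red_rep (\<pi> (f * g)) - f * g) * const n - (red_rep (\<pi> f) - f) * const (char_eval (\<phi> a) g * n)
        + const n * (f * (g - const (char_eval (\<phi> a) g)))"
    proof -
      have "const n * (f * g) = f * g * const n" by (rule const_central)
      moreover have "const n * (f * const (char_eval (\<phi> a) g)) = f * const (char_eval (\<phi> a) g * n)"
        by (simp add: const_central[of n] const_mult mult.assoc)
      ultimately show ?thesis by (simp add: algebra_simps)
    qed
    also have "\<dots> \<in> J a"
    proof (rule lideal_add[OF lideal_J lideal_diff[OF lideal_J]])
      show "(red_rep (\<pi> (f * g)) - f * g) * const n \<in> J a"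
        using red_rep_proj[of "f * g"] fg(1) g by (intro lideal_K[OF lideal_J] K_right) auto
      show "(red_rep (\<pi> f) - f) * const (char_eval (\<phi> a) g * n) \<in> J a"
        using red_rep_proj[of f] fg(1) by (intro lideal_K[OF lideal_J] K_right) auto
      show "const n * (f * (g - const (char_eval (\<phi> a) g))) \<in> J a"
        using fg(1) J_char_eval[OF fg(3)] by (intro lideal_mult[OF lideal_J]) auto
    qed
    finally show ?thesis .
  qed
next
  case zero
  then show ?case by (simp add: \<Psi>_def lideal_zero[OF lideal_J])
next
  case (diff z w)
  then show ?case by (simp add: \<Psi>_diff lideal_diff[OF lideal_J])
qed

text \<open>The canonical generator has weight a, so minimality of \<open>J a\<close> gives one
  inclusion. For the other, a vanishing tensor lies in the subgroup of relations, and \<Psi> carries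
  it to an element of \<open>J a\<close> that agrees with f modulo \<open>K\<close>.\<close>

lemma ann_vac: "ann V.Ind vac = J a"
proof
  show "J a \<subseteq> ann V.Ind vac" by (rule J_subset[OF weight_ideal_ann_vac])
  show "ann V.Ind vac \<subseteq> J a"
  proof
    fix f assume "f \<in> ann V.Ind vac"
    then have f: "f \<in> carrier F" and "\<pi> f \<odot>\<^bsub>V.Ind\<^esub> vac = \<zero>\<^bsub>V.Ind\<^esub>"
      unfolding ann_def by blast+
    then have "V.tens (\<pi> f) 1 = \<zero>\<^bsub>V.Ind\<^esub>" by (simp only: act_vac)
    then have "frag_of (\<pi> f, 1) \<in> V.H" using f by (simp add: V.tens_zero_iff char_module_simps)
    then have "red_rep (\<pi> f) \<in> J a" using \<Psi>_H \<Psi>_of[of "\<pi> f" 1] by fastforce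
    moreover have "red_rep (\<pi> f) - f \<in> J a" using red_rep_proj[OF f] lideal_K[OF lideal_J] by blast
    ultimately have "red_rep (\<pi> f) - (red_rep (\<pi> f) - f) \<in> J a" by (rule lideal_diff[OF lideal_J])
    then show "f \<in> J a" by simp
  qed
qed

lemma verma_generator:
  "\<exists>v\<in>carrier (verma l pm \<chi> a). orbit (verma l pm \<chi> a) v = carrier (verma l pm \<chi> a) \<and>
     ann (verma l pm \<chi> a) v = J a"
  unfolding verma_eq using vac_closed orbit_vac ann_vac by blast

end

lemma shift_vector:
  assumes M: "left_module U M" and v: "v \<in> carrier M" "orbit M v = carrier M" and j: "j < CHAR('k)"
  defines "w \<equiv> \<pi> (X ^ j) \<odot>\<^bsub>M\<^esub> v"
  shows "w \<in> carrier M" "orbit M w = carrier M" "ann M w = {f \<in> carrier F. f * X ^ j \<in> ann M v}"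
proof -
  have Xj: "X ^ n \<in> carrier F" for n using X_closed by blast
  show w: "w \<in> carrier M" unfolding w_def using v Xj by (intro act_closed[OF M])
  show "ann M w = {f \<in> carrier F. f * X ^ j \<in> ann M v}"
    using Xj v by (auto simp: ann_def w_def act_mult[OF M] free_alg_closed)
  \<comment> \<open>Modulo \<open>K\<close> the product of X^(p-j) and X^j is \<kappa>, so v is
    recovered from w.\<close>
  have "v = \<pi> (const (inverse \<kappa>) * X ^ (CHAR('k) - j)) \<odot>\<^bsub>M\<^esub> w"
  proof -
    have 1: "const (inverse \<kappa>) * (X ^ CHAR('k) - const \<kappa>) \<in> ann M v"
      by (intro lideal_K[OF lideal_ann[OF M v(1)]] K_left X_p) auto
    have e1: "const (inverse \<kappa>) * X ^ (CHAR('k) - j) * X ^ j = const (inverse \<kappa>) * X ^ CHAR('k)"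
      using j by (simp add: mult.assoc flip: power_add)
    have e2: "const (inverse \<kappa>) * const \<kappa> = 1" using \<kappa>_nz by (simp flip: const_mult)
    have "const (inverse \<kappa>) * X ^ (CHAR('k) - j) * X ^ j - 1 \<in> ann M v"
      using 1 unfolding right_diff_distrib e2 e1 .
    then have "\<pi> (const (inverse \<kappa>) * X ^ (CHAR('k) - j) * X ^ j) \<odot>\<^bsub>M\<^esub> v = v"
      using Xj v act_eq_iff[OF M, of _ 1 v] by (simp add: act_one[OF M] free_alg_closed)
    then show ?thesis using Xj v by (simp add: w_def act_mult[OF M] free_alg_closed)
  qed
  moreover have "const (inverse \<kappa>) * X ^ (CHAR('k) - j) \<in> carrier F" using Xj by auto
  ultimately obtain g where g: "g \<in> carrier F" "v = \<pi> g \<odot>\<^bsub>M\<^esub> w" by blast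
  have "orbit M v \<subseteq> orbit M w"
  proof
    fix x assume "x \<in> orbit M v"
    then obtain f where "f \<in> carrier F" "x = \<pi> f \<odot>\<^bsub>M\<^esub> v" unfolding orbit_def by blast
    then have "x = \<pi> (f * g) \<odot>\<^bsub>M\<^esub> w" "f * g \<in> carrier F"
      using g w by (auto simp: act_mult[OF M])
    then show "x \<in> orbit M w" unfolding orbit_def by blast
  qed
  moreover have "orbit M w \<subseteq> carrier M" using act_closed[OF M _ w] unfolding orbit_def by blast
  ultimately show "orbit M w = carrier M" using v by blast
qed

text \<open>With b = a - j, the vector X^j v still generates the first module, and the two shift
  lemmas identify its annihilator as exactly \<open>J b\<close>.\<close>

lemma verma_iso:
  assumes a: "a \<in> weights l \<chi>" and b: "b \<in> weights l \<chi>"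
  shows "module_iso U (verma l pm \<chi> a) (verma l pm \<chi> b)"
proof -
  let ?A = "verma l pm \<chi> a" and ?B = "verma l pm \<chi> b"
  obtain v where v: "v \<in> carrier ?A" "orbit ?A v = carrier ?A" "ann ?A v = J a"
    using verma_generator[OF a] by blast
  obtain w where w: "w \<in> carrier ?B" "orbit ?B w = carrier ?B" "ann ?B w = J b"
    using verma_generator[OF b] by blast
  obtain j where j: "j < CHAR('k)" "b = a - of_nat j" using weights_diff[OF a b] .
  define v' where "v' = \<pi> (X ^ j) \<odot>\<^bsub>?A\<^esub> v"
  note s = shift_vector[OF left_module_verma[OF a] v(1,2) j(1), folded v'_def]
  have "f \<in> ann ?A v' \<longleftrightarrow> f \<in> J b" for f
    using J_shift[of f a j] J_unshift[of f j a] j lideal_closed[OF lideal_J] by (auto simp: s(3) v(3))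
  then have "ann ?A v' = ann ?B w" by (auto simp: w(3))
  then show ?thesis
    using cyclic_module_iso[OF left_module_verma[OF a] left_module_verma[OF b] s(1,2) w(1,2)] by blast
qed

end

section \<open>Simple modules\<close>

lemma (in env) lideal_const_mult: "lideal I \<Longrightarrow> f \<in> I \<Longrightarrow> const c * f \<in> I"
  by (rule lideal_mult) auto

context witt
begin

lemma lideal_gen_mult: "lideal I \<Longrightarrow> x \<in> Ws \<Longrightarrow> f \<in> I \<Longrightarrow> gen x * f \<in> I"
  by (rule lideal_mult) auto

section \<open>The commutative algebra generated in degree -1\<close>

definition D :: "'k witt set" where
  "D = {e (-1) i | i. i \<le> l}"

abbreviation "FD \<equiv> (carrier (free_alg D) :: ('k, 'k witt) free set)"

lemma D_space: "D \<subseteq> Ws"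
  by (auto simp: D_def e_space)

lemma FD_F: "h \<in> FD \<Longrightarrow> h \<in> carrier F"
  using free_alg_mono[OF D_space] by (auto simp: L_simps(1))

lemma brk_D: "x \<in> D \<Longrightarrow> y \<in> D \<Longrightarrow> br x y = sc 0 (e (-2) 0)"
  using p_gt by (auto simp: D_def brk_e valid_def witt_zero_scl)

lemma brk_zero_K: "x \<in> Ws \<Longrightarrow> y \<in> Ws \<Longrightarrow> br x y = 0 \<Longrightarrow> gen x * gen y - gen y * gen x \<in> K"
  using K_add[OF brk_K[of x y], of "gen 0"] gen_0_K by simp

lemma br_space: "x \<in> Ws \<Longrightarrow> y \<in> Ws \<Longrightarrow> br x y \<in> Ws"
  using brk_space[of x y] by (simp add: L_simps(1))

lemma D_comm_K: "x \<in> D \<Longrightarrow> y \<in> D \<Longrightarrow> gen x * gen y - gen y * gen x \<in> K"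
  using D_space brk_D[of x y] by (intro brk_zero_K) (auto simp: witt_zero_scl)

lemma FD_gen_comm_K:
  assumes x: "x \<in> D" and h: "h \<in> FD"
  shows "gen x * h - h * gen x \<in> K"
  using h
proof (induction rule: free_alg_induct)
  case (add f g)
  then show ?case using K_add[OF add(3,4)] by (simp add: algebra_simps)
next
  case (const c)
  then show ?case by (simp add: const_central[of c] K_zero)
next
  case (gen y f)
  have f: "f \<in> carrier F" and y: "gen y \<in> carrier F" using gen FD_F D_space by auto
  have "gen x * (gen y * f) - gen y * f * gen x
     = (gen x * gen y - gen y * gen x) * f + gen y * (gen x * f - f * gen x)"
    by (simp add: algebra_simps)
  then show ?case using K_add[OF K_right[OF f D_comm_K[OF x gen(1)]] K_left[OF y gen(3)]] by simp
qed

lemma FD_comm_K: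
  assumes h: "h \<in> FD" and g: "g \<in> FD"
  shows "h * g - g * h \<in> K"
  using h
proof (induction rule: free_alg_induct)
  case (add f f')
  then show ?case using K_add[OF add(3,4)] by (simp add: algebra_simps)
next
  case (const c)
  then show ?case by (simp add: const_central[of c] K_zero)
next
  case (gen x f)
  have f: "f \<in> carrier F" and x: "gen x \<in> carrier F" using gen FD_F D_space by auto
  have "gen x * f * g - g * (gen x * f)
     = gen x * (f * g - g * f) + (gen x * g - g * gen x) * f"
    by (simp add: algebra_simps)
  then show ?case using K_add[OF K_left[OF x gen(3)] K_right[OF f FD_gen_comm_K[OF gen(1) g]]] by simp
qed

lemma gen_reduce:
  assumes I: "weight_ideal a I" and y: "y \<in> Wf (-1)"
  shows "\<exists>h\<in>FD. gen y - h \<in> I"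
proof -
  have lI: "lideal I" using I by (simp add: weight_ideal_def)
  show ?thesis
    using y
  proof (induction rule: filt_induct)
    case zero
    then show ?case using lideal_K[OF lI gen_0_K] by (intro bexI[of _ 0]) auto
  next
    case (add x y)
    then obtain h h' where h: "h \<in> FD" "gen x - h \<in> I" "h' \<in> FD" "gen y - h' \<in> I" by blast
    have "gen (x + y) - gen x - gen y \<in> I"
      using add filt_subset by (intro lideal_K[OF lI] add_K) auto
    from lideal_add[OF lI lideal_add[OF lI this h(2)] h(4)]
    have "gen (x + y) - (h + h') \<in> I" by (simp add: algebra_simps)
    then show ?case using h by blast
  next
    case (basis i k c)
    show ?case
    proof (cases "i = -1")
      case True
      then have "e i k \<in> D" using basis by (auto simp: D_def valid_def)
      then have "const c * gen (e i k) \<in> FD" by (intro free_alg_closed)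
      then show ?thesis using lideal_K[OF lI scl_K[OF e_space]] by blast
    next
      case False
      then have "sc c (e i k) \<in> Wf 0" using basis by (intro filt_scl e_filt) simp
      then have "gen (sc c (e i k)) - const (\<phi> a (sc c (e i k))) \<in> I" using I by (simp add: weight_ideal_def)
      then show ?thesis by blast
    qed
  qed
qed

text \<open>Moving y past the first factor x leaves the commutator of y and x in front of a shorter
  word, so the induction has to treat all y at once.\<close>

lemma gen_mult_reduce:
  assumes I: "weight_ideal a I" and h: "h \<in> FD"
  shows "\<forall>y\<in>Ws. \<exists>h'\<in>FD. gen y * h - h' \<in> I"
  using h
proof (induction rule: free_alg_induct)
  case (add f g)
  show ?case
  proof
    fix y assume "y \<in> Ws"
    then obtain f' g' where "f' \<in> FD" "gen y * f - f' \<in> I" "g' \<in> FD" "gen y * g - g' \<in> I"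
      using add(3,4) by blast
    moreover have lI: "lideal I" using I by (simp add: weight_ideal_def)
    ultimately show "\<exists>h'\<in>FD. gen y * (f + g) - h' \<in> I"
      using lideal_add[OF lI, of "gen y * f - f'" "gen y * g - g'"]
      by (intro bexI[of _ "f' + g'"]) (auto simp: algebra_simps)
  qed
next
  case (const c)
  show ?case
  proof
    fix y assume "y \<in> Ws"
    then obtain h where h: "h \<in> FD" "gen y - h \<in> I" using gen_reduce[OF I] by (auto simp: filt_space)
    have "lideal I" using I by (simp add: weight_ideal_def)
    from lideal_mult[OF this free_alg_closed(3) h(2), of c]
    show "\<exists>h'\<in>FD. gen y * const c - h' \<in> I"
      using h by (intro bexI[of _ "const c * h"]) (auto simp: algebra_simps const_central[of c "gen y"])
  qed
next
  case (gen x h)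
  have lI: "lideal I" using I by (simp add: weight_ideal_def)
  show ?case
  proof
    fix y assume y: "y \<in> Ws"
    have x: "x \<in> Ws" using gen D_space by auto
    obtain h1 where h1: "h1 \<in> FD" "gen y * h - h1 \<in> I" using gen(3) y by blast
    obtain h2 where h2: "h2 \<in> FD" "gen (br y x) * h - h2 \<in> I" using gen(3) br_space[OF y x] by blast
    have 1: "gen x * (gen y * h - h1) \<in> I" by (intro lideal_mult[OF lI] h1 gen_closed x)
    have 2: "(gen y * gen x - gen x * gen y - gen (br y x)) * h \<in> I"
      by (intro lideal_K[OF lI] K_right brk_K x y FD_F gen(2))
    from lideal_add[OF lI lideal_add[OF lI 1 2] h2(2)]
    have "gen y * (gen x * h) - (gen x * h1 + h2) \<in> I" by (simp add: algebra_simps)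
    moreover have "gen x * h1 + h2 \<in> FD" using gen(1) h1 h2 by auto
    ultimately show "\<exists>h'\<in>FD. gen y * (gen x * h) - h' \<in> I" by blast
  qed
qed

lemma reduce:
  assumes I: "weight_ideal a I" and f: "f \<in> carrier F"
  shows "\<exists>h\<in>FD. f - h \<in> I"
  using f
proof (induction rule: free_alg_induct)
  case (add f g)
  have lI: "lideal I" using I by (simp add: weight_ideal_def)
  obtain f' g' where "f' \<in> FD" "f - f' \<in> I" "g' \<in> FD" "g - g' \<in> I" using add(3,4) by blast
  then show ?case using lideal_add[OF lI, of "f - f'" "g - g'"]
    by (intro bexI[of _ "f' + g'"]) (auto simp: algebra_simps)
next
  case (const c)
  have lI: "lideal I" using I by (simp add: weight_ideal_def)
  show ?case using lideal_zero[OF lI] by (intro bexI[of _ "const c"]) auto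
next
  case (gen y f)
  have lI: "lideal I" using I by (simp add: weight_ideal_def)
  have y: "y \<in> Ws" using gen by (simp add: L_simps(1))
  obtain h where h: "h \<in> FD" "f - h \<in> I" using gen(3) by blast
  obtain h' where h': "h' \<in> FD" "gen y * h - h' \<in> I" using gen_mult_reduce[OF I h(1)] y by blast
  have "gen y * (f - h) \<in> I" using y h by (intro lideal_mult[OF lI]) auto
  from lideal_add[OF lI this h'(2)] have "gen y * f - h' \<in> I" by (simp add: algebra_simps)
  then show ?case using h' by blast
qed

text \<open>Commuting elements have joint eigenvectors, found one index at a time. The p-map kills
  degree -1, so the p-th power of e_{-1}t^i is \<chi>(e_{-1}t^i)^p, and uniqueness of p-th roots
  fixes the eigenvalue. The vector is sought inside \<open>FD\<close> so that it commutes with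
  \<open>FD\<close> modulo \<open>K\<close>.\<close>

lemma D_eigenvector:
  assumes I: "lideal I" "1 \<notin> I" and n: "n \<le> Suc l"
  shows "\<exists>g\<in>FD. g \<notin> I \<and> (\<forall>i<n. (gen (e (-1) i) - const (\<chi> (e (-1) i))) * g \<in> I)"
  using n
proof (induction n)
  case 0
  then show ?case using I by (intro bexI[of _ 1]) auto
next
  case (Suc n)
  define T where "T = {g \<in> FD. \<forall>i<n. (gen (e (-1) i) - const (\<chi> (e (-1) i))) * g \<in> I}"
  define Y where "Y = (gen (e (-1) n) :: ('k, 'k witt) free)"
  have nD: "e (-1) n \<in> D" using Suc.prems by (auto simp: D_def)
  have Y: "Y \<in> carrier F" unfolding Y_def by (intro gen_closed e_space)
  obtain g where g: "g \<in> T" "g \<notin> I" using Suc by (auto simp: T_def)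
  have "\<exists>h\<in>T. \<exists>r. h \<notin> I \<and> (Y - const r) * h \<in> I \<and> r ^ CHAR('k) = \<chi> (e (-1) n) ^ CHAR('k) + 0 * r"
  proof (rule eigenvector_p[OF I(1) Y])
    show "T \<subseteq> carrier F" using FD_F by (auto simp: T_def)
    show "f + h \<in> T" if "f \<in> T" "h \<in> T" for f h
      using that lideal_add[OF I(1)] by (auto simp: T_def distrib_left)
    show "const c * f \<in> T" if "f \<in> T" for c f
    proof -
      have "(gen (e (-1) i) - const (\<chi> (e (-1) i))) * (const c * f) \<in> I" if "i < n" for i
        unfolding const_mult_comm using \<open>f \<in> T\<close> that by (intro lideal_const_mult[OF I(1)]) (auto simp: T_def)
      then show ?thesis using that by (auto simp: T_def)
    qed
    show "Y * f \<in> T" if "f \<in> T" for f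
    proof -
      have "(gen (e (-1) i) - const (\<chi> (e (-1) i))) * (Y * f) \<in> I" if "i < n" for i
      proof -
        have iD: "e (-1) i \<in> D" using Suc.prems that by (auto simp: D_def)
        have "(gen (e (-1) i) * Y - Y * gen (e (-1) i)) * f \<in> I"
          unfolding Y_def using \<open>f \<in> T\<close> by (intro lideal_K[OF I(1)] K_right D_comm_K iD nD FD_F) (auto simp: T_def)
        moreover have "Y * ((gen (e (-1) i) - const (\<chi> (e (-1) i))) * f) \<in> I"
          unfolding Y_def using \<open>f \<in> T\<close> that by (intro lideal_gen_mult[OF I(1) e_space]) (auto simp: T_def)
        ultimately have "(gen (e (-1) i) * Y - Y * gen (e (-1) i)) * f
           + Y * ((gen (e (-1) i) - const (\<chi> (e (-1) i))) * f) \<in> I"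
          by (rule lideal_add[OF I(1)])
        then show ?thesis by (simp add: algebra_simps const_mult_comm)
      qed
      moreover have "Y * f \<in> FD" using that nD by (auto simp: T_def Y_def)
      ultimately show ?thesis by (auto simp: T_def)
    qed
    show "CHAR('k) > 1" using p_gt by simp
    show "(Y ^ CHAR('k) - const (\<chi> (e (-1) n) ^ CHAR('k)) - const 0 * Y) * h \<in> I" if "h \<in> T" for h
    proof -
      have "pm (e (-1) n) = 0" using Suc.prems p_gt by (subst pm_e) auto
      then have "Y ^ CHAR('k) - const (\<chi> (e (-1) n) ^ CHAR('k)) \<in> K"
        using p_power_K[of "e (-1) n"] gen_0_K by (simp add: Y_def e_space L_simps(1))
      then have "(Y ^ CHAR('k) - const (\<chi> (e (-1) n) ^ CHAR('k))) * h \<in> I"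
        using that by (intro lideal_K[OF I(1)] K_right FD_F) (auto simp: T_def)
      then show ?thesis by simp
    qed
  qed (use g in auto)
  then obtain h r where h: "h \<in> T" "h \<notin> I" "(Y - const r) * h \<in> I" "r ^ CHAR('k) = \<chi> (e (-1) n) ^ CHAR('k)"
    by auto
  have "r = \<chi> (e (-1) n)" by (rule frobenius_inj[OF h(4)])
  then show ?case using h by (intro bexI[of _ h]) (auto simp: T_def Y_def less_Suc_eq)
qed

text \<open>Take a joint eigenvector g in \<open>FD\<close> outside I. Modulo I the product h g is
  the augmentation of h times g; it is also congruent to g h, which lies in the left ideal
  I.\<close>

lemma FD_ideal_augmentation:
  assumes I: "lideal I" "1 \<notin> I" and h: "h \<in> FD" "h \<in> I"
  shows "char_eval \<chi> h = 0"
proof -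
  obtain g where g: "g \<in> FD" "g \<notin> I" and ev: "\<And>i. i \<le> l \<Longrightarrow> (gen (e (-1) i) - const (\<chi> (e (-1) i))) * g \<in> I"
    using D_eigenvector[OF I order_refl] by (auto simp: less_Suc_eq_le)
  have gF: "g \<in> carrier F" using g FD_F by simp
  have "(f - const (char_eval \<chi> f)) * g \<in> I" if "f \<in> FD" for f
    using that
  proof (induction rule: free_alg_induct)
    case (add f f')
    then show ?case using lideal_add[OF I(1) add(3,4)] by (simp add: char_eval_simps const_add algebra_simps)
  next
    case (const c)
    then show ?case by (simp add: char_eval_simps lideal_zero[OF I(1)])
  next
    case (gen x f)
    have 1: "gen x * ((f - const (char_eval \<chi> f)) * g) \<in> I"
      using gen D_space by (intro lideal_gen_mult[OF I(1)]) auto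
    have 2: "const (char_eval \<chi> f) * ((gen x - const (\<chi> x)) * g) \<in> I"
      using gen(1) ev by (intro lideal_const_mult[OF I(1)]) (auto simp: D_def)
    have e: "const (\<chi> x * char_eval \<chi> f) * g = const (char_eval \<chi> f) * (const (\<chi> x) * g)"
      by (simp add: mult.commute flip: const_mult mult.assoc)
    have "(gen x * f - const (char_eval \<chi> (gen x * f))) * g
       = gen x * ((f - const (char_eval \<chi> f)) * g) + const (char_eval \<chi> f) * ((gen x - const (\<chi> x)) * g)"
      by (simp add: char_eval_simps left_diff_distrib right_diff_distrib mult.assoc const_mult_comm[of "gen x"] e)
    then show ?case using lideal_add[OF I(1) 1 2] by simp
  qed
  from this[OF h(1)] have 1: "(h - const (char_eval \<chi> h)) * g \<in> I" .
  have 2: "h * g - g * h \<in> I" by (intro lideal_K[OF I(1)] FD_comm_K h g)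
  have 3: "g * h \<in> I" by (intro lideal_mult[OF I(1)] gF h)
  have "(h * g - g * h) + g * h - (h - const (char_eval \<chi> h)) * g = const (char_eval \<chi> h) * g"
    by (simp add: algebra_simps)
  then have "const (char_eval \<chi> h) * g \<in> I" using lideal_diff[OF I(1) lideal_add[OF I(1) 2 3] 1] by simp
  then show ?thesis using lideal_const[OF I(1) _ gF g(2)] by blast
qed

section \<open>Joint eigenvectors of the nonnegative part\<close>

definition rank :: "int \<Rightarrow> nat \<Rightarrow> nat" where
  "rank i k = nat i * Suc l + k"

text \<open>Ranks order the basis of the nonnegative part by degree and then by the power of t, and
  conditions are imposed from the top rank down. Rank 0 belongs to e_0, whose eigenvalue is not
  prescribed, so these sets are used for n >= 1.\<close>

definition joint_eigen :: "('k, 'k witt) free set \<Rightarrow> nat \<Rightarrow> ('k, 'k witt) free set" where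
  "joint_eigen I n = {g \<in> carrier F. \<forall>i k. valid i k \<longrightarrow> 0 \<le> i \<longrightarrow> n \<le> rank i k \<longrightarrow>
     (gen (e i k) - const (if i = 0 then c0 k else 0)) * g \<in> I}"

lemma joint_eigenD: "f \<in> joint_eigen I n \<Longrightarrow> valid i k \<Longrightarrow> 0 \<le> i \<Longrightarrow> n \<le> rank i k \<Longrightarrow>
    (gen (e i k) - const (if i = 0 then c0 k else 0)) * f \<in> I"
  by (auto simp: joint_eigen_def)

lemma rank_le: "valid i k \<Longrightarrow> valid j m \<Longrightarrow> 0 \<le> i \<Longrightarrow> 0 \<le> j \<Longrightarrow> rank i k \<le> rank j m \<Longrightarrow> i \<le> j"
proof (rule ccontr)
  assume *: "valid i k" "valid j m" "0 \<le> i" "0 \<le> j" "rank i k \<le> rank j m" "\<not> i \<le> j"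
  have "nat j * Suc l + m < Suc (nat j) * Suc l" using * by (simp add: valid_def)
  also have "\<dots> \<le> nat i * Suc l" using * by (intro mult_le_mono1) auto
  finally show False using * by (simp add: rank_def)
qed

text \<open>Let e_jt^m have larger rank than e_it^k. If i = j the two commute. If i < j their
  bracket has positive degree i + j and at least the rank of e_jt^m, or is zero, so it kills f
  modulo I. Either way the eigenvalue conditions survive.\<close>

lemma joint_eigen_mult:
  assumes I: "lideal I" and ik: "valid i k" "0 \<le> i" "rank i k = n" and f: "f \<in> joint_eigen I (Suc n)"
  shows "gen (e i k) * f \<in> joint_eigen I (Suc n)"
proof -
  let ?Y = "gen (e i k) :: ('k, 'k witt) free"
  have fF: "f \<in> carrier F" using f by (simp add: joint_eigen_def)
  have "(gen (e j m) - const (if j = 0 then c0 m else 0)) * (?Y * f) \<in> I"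
    if jm: "valid j m" "0 \<le> j" "Suc n \<le> rank j m" for j m
  proof -
    define c where "c = (if j = 0 then c0 m else 0)"
    have 1: "?Y * ((gen (e j m) - const c) * f) \<in> I"
      unfolding c_def by (intro lideal_gen_mult[OF I e_space] joint_eigenD[OF f jm])
    have "(gen (e j m) * ?Y - ?Y * gen (e j m) - gen (br (e j m) (e i k))) * f \<in> I"
      by (intro lideal_K[OF I] K_right brk_K e_space fF)
    moreover have "gen (br (e j m) (e i k)) * f \<in> I"
    proof -
      have 2: "(gen (sc (of_int (i - j)) (e (i + j) (k + m))) - const (of_int (i - j)) * gen (e (i + j) (k + m))) * f \<in> I"
        by (intro lideal_K[OF I] K_right scl_K e_space fF)
      have "const (of_int (i - j)) * (gen (e (i + j) (k + m)) * f) \<in> I"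
      proof (cases "i = j")
        case True
        then show ?thesis by (simp add: lideal_zero[OF I])
      next
        case False
        then have ij: "i < j" using rank_le[OF ik(1) jm(1) ik(2) jm(2)] ik(3) jm(3) by simp
        show ?thesis
        proof (cases "valid (i + j) (k + m)")
          case True
          have "nat j * Suc l \<le> nat (i + j) * Suc l" using ik(2) by (intro mult_le_mono1) auto
          then have "Suc n \<le> rank (i + j) (k + m)" using jm(3) by (simp add: rank_def)
          then have "(gen (e (i + j) (k + m)) - const (if i + j = 0 then c0 (k + m) else 0)) * f \<in> I"
            using joint_eigenD[OF f True] ij ik(2) by simp
          then have "gen (e (i + j) (k + m)) * f \<in> I" using ij ik(2) by simp
          then show ?thesis by (rule lideal_const_mult[OF I])
        next
          case False
          then have "gen (e (i + j) (k + m)) * f \<in> I"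
            using gen_0_K fF by (intro lideal_K[OF I] K_right) (auto simp: e_invalid)
          then show ?thesis by (rule lideal_const_mult[OF I])
        qed
      qed
      from lideal_add[OF I 2 this] show ?thesis
        using brk_e[OF jm(1) ik(1)] by (simp add: algebra_simps add.commute)
    qed
    ultimately have "(gen (e j m) * ?Y - ?Y * gen (e j m) - gen (br (e j m) (e i k))) * f
        + gen (br (e j m) (e i k)) * f + ?Y * ((gen (e j m) - const c) * f) \<in> I"
      using 1 by (intro lideal_add[OF I])
    then show ?thesis unfolding c_def[symmetric] by (simp add: algebra_simps const_mult_comm)
  qed
  then show ?thesis using fF e_space by (auto simp: joint_eigen_def)
qed

lemma joint_eigen_step:
  assumes I: "lideal I" and ik: "valid i k" "0 \<le> i" "rank i k = n" and g: "g \<in> joint_eigen I (Suc n)" "g \<notin> I"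
    and rel: "\<And>h. h \<in> joint_eigen I (Suc n) \<Longrightarrow> (gen (e i k) ^ CHAR('k) - const a - const b * gen (e i k)) * h \<in> I"
  shows "\<exists>h\<in>joint_eigen I (Suc n). \<exists>r. h \<notin> I \<and> (gen (e i k) - const r) * h \<in> I \<and> r ^ CHAR('k) = a + b * r"
proof (rule eigenvector_p[OF I _ _ _ _ _ g _ rel])
  show "gen (e i k) \<in> carrier F" by (intro gen_closed e_space)
  show "joint_eigen I (Suc n) \<subseteq> carrier F" by (auto simp: joint_eigen_def)
  show "f + h \<in> joint_eigen I (Suc n)" if "f \<in> joint_eigen I (Suc n)" "h \<in> joint_eigen I (Suc n)" for f h
    using that lideal_add[OF I] by (auto simp: joint_eigen_def distrib_left)
  show "const c * f \<in> joint_eigen I (Suc n)" if "f \<in> joint_eigen I (Suc n)" for c f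
  proof -
    have "(gen (e j m) - const d) * (const c * f) \<in> I" if "(gen (e j m) - const d) * f \<in> I" for j m d
      unfolding const_mult_comm by (rule lideal_const_mult[OF I that])
    then show ?thesis using that by (auto simp: joint_eigen_def)
  qed
  show "gen (e i k) * f \<in> joint_eigen I (Suc n)" if "f \<in> joint_eigen I (Suc n)" for f
    by (rule joint_eigen_mult[OF I ik that])
  show "CHAR('k) > 1" using p_gt by simp
qed

lemma gen_pm_K: "gen (e i k) ^ CHAR('k) - gen (pm (e i k)) - const (\<chi> (e i k) ^ CHAR('k)) \<in> K"
  using gen_pmap_K[of "e i k"] by (simp add: L_simps(1) e_space)

lemma rank_inj: "valid i k \<Longrightarrow> valid j m \<Longrightarrow> 0 \<le> i \<Longrightarrow> 0 \<le> j \<Longrightarrow> rank i k = rank j m \<Longrightarrow> i = j \<and> k = m"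
proof -
  assume *: "valid i k" "valid j m" "0 \<le> i" "0 \<le> j" "rank i k = rank j m"
  then have "i = j" using rank_le[of i k j m] rank_le[of j m i k] by simp
  then show ?thesis using * by (simp add: rank_def)
qed

text \<open>Descending induction from a number above all ranks, where 1 meets the empty condition.
  For k >= 1 the p-map sends e_0t^k to e_0t^{kp}, which is zero or of larger rank and so already
  acts by \<chi>_{kp}; the equation for \<chi>_k then forces the eigenvalue. In positive degree the
  p-th power acts by zero.\<close>

lemma joint_eigen_nonempty:
  assumes I: "lideal I" "1 \<notin> I" and n: "1 \<le> n" "n \<le> CHAR('k) * Suc l"
  shows "\<exists>g\<in>joint_eigen I n. g \<notin> I"
  using n(2,1)
proof (induction rule: inc_induct)
  case base
  have "rank i k < CHAR('k) * Suc l" if "valid i k" for i k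
  proof -
    have "nat i * Suc l + k < Suc (nat i) * Suc l" using that by (simp add: valid_def)
    also have "\<dots> \<le> CHAR('k) * Suc l" using that p_gt by (intro mult_le_mono1) (auto simp: valid_def)
    finally show ?thesis by (simp add: rank_def)
  qed
  then have "1 \<in> joint_eigen I (CHAR('k) * Suc l)" unfolding joint_eigen_def by (auto simp: not_le[symmetric])
  then show ?case using I by blast
next
  case (step n)
  then obtain g where g: "g \<in> joint_eigen I (Suc n)" "g \<notin> I" by auto
  show ?case
  proof (cases "\<exists>i k. valid i k \<and> 0 \<le> i \<and> rank i k = n")
    \<comment> \<open>No basis element has degree p - 1, so the last block of l + 1 numbers contains
      no ranks and imposes no new condition.\<close>
    case False
    then have "Suc n \<le> rank i k" if "valid i k" "0 \<le> i" "n \<le> rank i k" for i k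
      using that by (metis le_antisym not_less_eq_eq)
    then have "g \<in> joint_eigen I n" using joint_eigenD[OF g(1)] g(1) by (simp add: joint_eigen_def)
    then show ?thesis using g by auto
  next
    case True
    then obtain i k where ik: "valid i k" "0 \<le> i" "rank i k = n" by blast
    define a where "a = (if i = 0 then c0 (k * CHAR('k)) else 0) + \<chi> (e i k) ^ CHAR('k)"
    define r0 where "r0 = (if i = 0 then c0 k else 0)"
    have kpos: "i = 0 \<Longrightarrow> 1 \<le> k" using ik step.prems by (simp add: rank_def)
    have a_root: "r0 ^ CHAR('k) = a"
    proof (cases "i = 0")
      case True
      then show ?thesis using chi_seq(3)[of k] kpos ik(1) by (simp add: a_def r0_def valid_def)
    next
      case False
      then have "\<chi> (e i k) = 0" using ik by (intro \<chi>_filt1 e_filt) simp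
      then show ?thesis using False p_pos by (simp add: a_def r0_def)
    qed
    have rel: "(gen (e i k) ^ CHAR('k) - const a - const 0 * gen (e i k)) * h \<in> I" if h: "h \<in> joint_eigen I (Suc n)" for h
    proof -
      have hF: "h \<in> carrier F" using h by (simp add: joint_eigen_def)
      have 1: "(gen (e i k) ^ CHAR('k) - gen (pm (e i k)) - const (\<chi> (e i k) ^ CHAR('k))) * h \<in> I"
        by (intro lideal_K[OF I(1)] K_right gen_pm_K hF)
      have "(gen (pm (e i k)) - const (if i = 0 then c0 (k * CHAR('k)) else 0)) * h \<in> I"
      proof (cases "i = 0 \<and> k * CHAR('k) \<le> l")
        case True
        have "k * 1 < k * CHAR('k)" using kpos True p_gt by (intro mult_strict_left_mono) auto
        then have "Suc n \<le> rank 0 (k * CHAR('k))" using ik True by (simp add: rank_def Suc_le_eq)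
        moreover have "valid 0 (k * CHAR('k))" using True p_gt by (simp add: valid_def)
        ultimately have "(gen (e 0 (k * CHAR('k))) - const (c0 (k * CHAR('k)))) * h \<in> I"
          using joint_eigenD[OF h, of 0 "k * CHAR('k)"] by simp
        then show ?thesis using True ik(1) by (simp add: pm_e valid_def)
      next
        case False
        have "pm (e i k) = 0" using False ik(1) e_invalid[of 0 "k * CHAR('k)"] by (auto simp: pm_e valid_def)
        moreover have "(if i = 0 then c0 (k * CHAR('k)) else 0) = 0" using False chi_seq(2) by auto
        ultimately show ?thesis using gen_0_K hF by (auto intro!: lideal_K[OF I(1)] K_right)
      qed
      from lideal_add[OF I(1) 1 this] show ?thesis by (simp add: a_def const_add algebra_simps)
    qed
    have "\<exists>h\<in>joint_eigen I (Suc n). \<exists>r. h \<notin> I \<and> (gen (e i k) - const r) * h \<in> I \<and> r ^ CHAR('k) = a + 0 * r"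
      by (rule joint_eigen_step[OF I(1) ik g rel])
    then obtain h r where h: "h \<in> joint_eigen I (Suc n)" "h \<notin> I" "(gen (e i k) - const r) * h \<in> I"
      "r ^ CHAR('k) = a + 0 * r"
      by blast
    have "r ^ CHAR('k) = r0 ^ CHAR('k)" using h(4) a_root by simp
    then have "r = r0" by (rule frobenius_inj)
    have "(gen (e j m) - const (if j = 0 then c0 m else 0)) * h \<in> I"
      if "valid j m" "0 \<le> j" "n \<le> rank j m" for j m
    proof (cases "rank j m = n")
      case True
      then have "j = i" "m = k" using rank_inj[OF that(1) ik(1) that(2) ik(2)] ik(3) by simp_all
      then show ?thesis using h(3) by (simp only: \<open>r = r0\<close> r0_def)
    next
      case False
      then show ?thesis using that h(1) by (auto simp: joint_eigen_def)
    qed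
    then have "h \<in> joint_eigen I n" using h(1) by (auto simp: joint_eigen_def)
    then show ?thesis using h(2) by blast
  qed
qed

text \<open>Only e_0 is left. It preserves the joint eigenspace of all higher ranks, and the
  relation e_0^p = e_0 + \<chi>(e_0)^p makes its eigenvalue an element of
  \<open>weights l \<chi>\<close>.\<close>

lemma weight_vector:
  assumes I: "lideal I" "1 \<notin> I"
  shows "\<exists>g\<in>carrier F. g \<notin> I \<and> (\<exists>a\<in>weights l \<chi>. \<forall>y\<in>Wf 0. (gen y - const (\<phi> a y)) * g \<in> I)"
proof -
  have "1 \<le> CHAR('k) * Suc l" using p_gt by simp
  then obtain g where g: "g \<in> joint_eigen I (Suc 0)" "g \<notin> I" using joint_eigen_nonempty[OF I, of 1] by auto
  have v0: "valid 0 0" using p_gt by (simp add: valid_def)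
  have "(gen (e 0 0) ^ CHAR('k) - const (\<chi> (e 0 0) ^ CHAR('k)) - const 1 * gen (e 0 0)) * h \<in> I"
    if h: "h \<in> joint_eigen I (Suc 0)" for h
  proof -
    have "pm (e 0 0) = e 0 0" using p_gt by (subst pm_e) auto
    then have "(gen (e 0 0) ^ CHAR('k) - gen (e 0 0) - const (\<chi> (e 0 0) ^ CHAR('k))) * h \<in> I"
      using lideal_K[OF I(1) K_right[OF _ gen_pm_K[of 0 0]], of h] h by (simp add: joint_eigen_def)
    then show ?thesis by (simp add: algebra_simps)
  qed
  from joint_eigen_step[OF I(1) v0 _ _ g this]
  obtain h r where h: "h \<in> joint_eigen I (Suc 0)" "h \<notin> I" "(gen (e 0 0) - const r) * h \<in> I"
    "r ^ CHAR('k) = \<chi> (e 0 0) ^ CHAR('k) + r"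
    by (auto simp: rank_def)
  have hF: "h \<in> carrier F" using h by (simp add: joint_eigen_def)
  have basis: "(gen (e i k) - const (\<phi> r (e i k))) * h \<in> I" if "valid i k" "0 \<le> i" for i k
  proof (cases "i = 0 \<and> k = 0")
    case True
    then show ?thesis using h(3) by (simp add: \<phi>_e wt_def)
  next
    case False
    then have "Suc 0 \<le> rank i k" using that by (auto simp: rank_def Suc_le_eq)
    then show ?thesis using h(1) that False by (auto simp: joint_eigen_def \<phi>_e wt_def split: if_splits)
  qed
  have "(gen y - const (\<phi> r y)) * h \<in> I" if "y \<in> Wf 0" for y
    using that
  proof (induction rule: filt_induct)
    case zero
    then show ?case using gen_0_K hF by (auto simp: \<phi>_0 intro!: lideal_K[OF I(1)] K_right)
  next
    case (add x y)
    have "(gen (x + y) - gen x - gen y) * h \<in> I"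
      using add filt_subset by (intro lideal_K[OF I(1)] K_right add_K hF) auto
    from lideal_add[OF I(1) lideal_add[OF I(1) this add(3)] add(4)]
    show ?case by (simp add: \<phi>_add const_add algebra_simps)
  next
    case (basis i k c)
    have 1: "(gen (sc c (e i k)) - const c * gen (e i k)) * h \<in> I"
      by (intro lideal_K[OF I(1)] K_right scl_K e_space hF)
    have 2: "const c * ((gen (e i k) - const (\<phi> r (e i k))) * h) \<in> I"
      using \<open>valid i k\<close> \<open>0 \<le> i\<close> \<open>\<And>i k. valid i k \<Longrightarrow> 0 \<le> i \<Longrightarrow> (gen (e i k) - const (\<phi> r (e i k))) * h \<in> I\<close>
      by (intro lideal_const_mult[OF I(1)])
    from lideal_add[OF I(1) 1 2] show ?case by (simp add: \<phi>_scl const_mult algebra_simps)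
  qed
  moreover have "r \<in> weights l \<chi>" using h(4) by (simp add: weights_def)
  ultimately show ?thesis using h(2) hF by blast
qed

section \<open>Weight vectors in simple modules and uniqueness\<close>

lemma simple_weight_vector:
  assumes M: "simple_module U M"
  shows "\<exists>v\<in>carrier M. v \<noteq> \<zero>\<^bsub>M\<^esub> \<and> (\<exists>a\<in>weights l \<chi>. weight_ideal a (ann M v))"
proof -
  have lM: "left_module U M" and "carrier M \<noteq> {\<zero>\<^bsub>M\<^esub>}" using M by (auto simp: simple_module_def)
  interpret M: left_module U M by (rule lM)
  obtain m where m: "m \<in> carrier M" "m \<noteq> \<zero>\<^bsub>M\<^esub>" using \<open>carrier M \<noteq> {\<zero>\<^bsub>M\<^esub>}\<close> M.M.zero_closed by blast
  have "1 \<notin> ann M m" using one_in_ann_iff[OF lM m(1)] m(2) by simp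
  then obtain g a where g: "g \<in> carrier F" "g \<notin> ann M m" "a \<in> weights l \<chi>"
    "\<And>y. y \<in> Wf 0 \<Longrightarrow> (gen y - const (\<phi> a y)) * g \<in> ann M m"
    using weight_vector[OF lideal_ann[OF lM m(1)]] by blast
  define v where "v = \<pi> g \<odot>\<^bsub>M\<^esub> m"
  have v: "v \<in> carrier M" unfolding v_def by (intro act_closed[OF lM] g m)
  have v0: "v \<noteq> \<zero>\<^bsub>M\<^esub>" using g(1,2) by (auto simp: v_def ann_def)
  have "gen y - const (\<phi> a y) \<in> ann M v" if "y \<in> Wf 0" for y
  proof -
    have "gen y - const (\<phi> a y) \<in> carrier F" using that by (intro free_alg_closed filt_gen_closed)
    then show ?thesis using g(4)[OF that] g(1) m(1) by (simp add: ann_def v_def act_mult[OF lM])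
  qed
  then have "weight_ideal a (ann M v)" using lideal_ann[OF lM v] by (simp add: weight_ideal_def)
  then show ?thesis using v v0 g(3) by blast
qed

lemma simple_weight_vector_any:
  assumes M: "simple_module U M" and b: "b \<in> weights l \<chi>"
  shows "\<exists>w\<in>carrier M. w \<noteq> \<zero>\<^bsub>M\<^esub> \<and> weight_ideal b (ann M w)"
proof -
  have lM: "left_module U M" and ne: "carrier M \<noteq> {\<zero>\<^bsub>M\<^esub>}" using M by (auto simp: simple_module_def)
  obtain v a where v: "v \<in> carrier M" "v \<noteq> \<zero>\<^bsub>M\<^esub>" and a: "a \<in> weights l \<chi>" "weight_ideal a (ann M v)"
    using simple_weight_vector[OF M] by blast
  obtain j where j: "j < CHAR('k)" "b = a - of_nat j" using weights_diff[OF a(1) b] .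
  define w where "w = \<pi> (X ^ j) \<odot>\<^bsub>M\<^esub> v"
  note s = shift_vector[OF lM v(1) simple_orbit[OF M v] j(1), folded w_def]
  have "orbit M \<zero>\<^bsub>M\<^esub> \<subseteq> {\<zero>\<^bsub>M\<^esub>}"
    unfolding orbit_def using left_module_smult_zeros(1)[OF lM] by auto
  then have "w \<noteq> \<zero>\<^bsub>M\<^esub>" using s(1,2) ne by auto
  moreover have "gen y - const (\<phi> b y) \<in> ann M w" if "y \<in> Wf 0" for y
  proof -
    have "(gen y - const (\<phi> b y)) * X ^ j \<in> J a"
      using J_gen[OF that, of b] j by (intro J_shift) simp
    moreover have "gen y - const (\<phi> b y) \<in> carrier F" using that by (intro free_alg_closed filt_gen_closed)
    ultimately show ?thesis using J_subset[OF a(2)] s(3) by blast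
  qed
  ultimately show ?thesis using s(1) lideal_ann[OF lM s(1)] by (auto simp: weight_ideal_def)
qed

text \<open>
  Two different annihilators of weight vectors of weight \<open>a\<close> would give an element \<open>h\<close> of the
  commutative algebra generated by the \<open>e\<^bsub>-1\<^esub>t\<^sup>i\<close> acting as zero in one module and fixing the weight
  vector in the other; but the augmentation of \<open>h\<close> is visible in both.
\<close>

lemma weight_ideal_ann_subset:
  assumes M: "simple_module U M" and v: "v \<in> carrier M" "v \<noteq> \<zero>\<^bsub>M\<^esub>" "weight_ideal a (ann M v)"
    and N: "simple_module U N" and w: "w \<in> carrier N" "w \<noteq> \<zero>\<^bsub>N\<^esub>" "weight_ideal a (ann N w)"
  shows "ann M v \<subseteq> ann N w"
proof
  have lM: "left_module U M" and lN: "left_module U N" using M N by (auto simp: simple_module_def)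
  have lv: "lideal (ann M v)" and lw: "lideal (ann N w)" using v w by (auto simp: weight_ideal_def)
  have one: "1 \<notin> ann M v" "1 \<notin> ann N w"
    using one_in_ann_iff[OF lM v(1)] one_in_ann_iff[OF lN w(1)] v w by auto
  fix f assume f: "f \<in> ann M v"
  then have fF: "f \<in> carrier F" by (simp add: ann_def)
  show "f \<in> ann N w"
  proof (rule ccontr)
    assume nf: "f \<notin> ann N w"
    define u where "u = \<pi> f \<odot>\<^bsub>N\<^esub> w"
    have u: "u \<in> carrier N" "u \<noteq> \<zero>\<^bsub>N\<^esub>" using nf fF act_closed[OF lN fF w(1)] by (auto simp: u_def ann_def)
    have "w \<in> orbit N u" using simple_orbit[OF N u] w(1) by simp
    then obtain g where g: "g \<in> carrier F" "\<pi> g \<odot>\<^bsub>N\<^esub> u = w" unfolding orbit_def by blast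
    then have "\<pi> (g * f) \<odot>\<^bsub>N\<^esub> w = \<pi> 1 \<odot>\<^bsub>N\<^esub> w"
      using fF w(1) by (simp add: u_def act_mult[OF lN] act_one[OF lN])
    then have gf: "g * f - 1 \<in> ann N w" using g fF w(1) act_eq_iff[OF lN, of "g * f" 1 w] by auto
    \<comment> \<open>The intersection is again a weight ideal, so a single h represents g f in both
      modules at once.\<close>
    have "weight_ideal a (ann M v \<inter> ann N w)"
      using v(3) w(3) unfolding weight_ideal_def lideal_def by blast
    then obtain h where h: "h \<in> FD" "g * f - h \<in> ann M v" "g * f - h \<in> ann N w"
      using reduce[of a _ "g * f"] g fF by auto
    have "g * f \<in> ann M v" by (intro lideal_mult[OF lv] g f)
    then have "h \<in> ann M v" using lideal_diff[OF lv _ h(2)] by fastforce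
    then have "char_eval \<chi> h = 0" by (rule FD_ideal_augmentation[OF lv one(1) h(1)])
    have "h - 1 \<in> ann N w" using lideal_diff[OF lw gf h(3)] by simp
    moreover have "h - 1 \<in> FD" using h(1) by auto
    ultimately have "char_eval \<chi> (h - 1) = 0" using FD_ideal_augmentation[OF lw one(2)] by blast
    then show False using \<open>char_eval \<chi> h = 0\<close> by (simp add: char_eval_simps)
  qed
qed

lemma simple_modules_iso:
  assumes M: "simple_module U M" and N: "simple_module U N"
  shows "module_iso U M N"
proof -
  have lM: "left_module U M" and lN: "left_module U N" using M N by (auto simp: simple_module_def)
  obtain v a where v: "v \<in> carrier M" "v \<noteq> \<zero>\<^bsub>M\<^esub>" and a: "a \<in> weights l \<chi>" "weight_ideal a (ann M v)"
    using simple_weight_vector[OF M] by blast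
  obtain w where w: "w \<in> carrier N" "w \<noteq> \<zero>\<^bsub>N\<^esub>" "weight_ideal a (ann N w)"
    using simple_weight_vector_any[OF N a(1)] by blast
  have "ann M v = ann N w"
    using weight_ideal_ann_subset[OF M v a(2) N w] weight_ideal_ann_subset[OF N w M v a(2)] by blast
  then show ?thesis
    using cyclic_module_iso[OF lM lN v(1) simple_orbit[OF M v] w(1) simple_orbit[OF N w(1,2)]] by blast
qed

end

section \<open>Nontriviality of the reduced enveloping algebra\<close>

text \<open>
  Linear operators on functions of infinitely many exponents. The shifts \<open>S i\<close> and the operators
  \<open>Pm i\<close> satisfy the relations of the Weyl algebra, with \<open>S i\<close> in the role of \<open>\<partial>/\<partial>x\<^sub>i\<close> and \<open>Pm i\<close> in
  that of multiplication by \<open>x\<^sub>i\<close>; in characteristic \<open>p\<close> the latter satisfies \<open>x\<^sub>i\<^sup>p = 0\<close>.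
\<close>

typedef (overloaded) 'k oper =
  "{T :: ((nat \<Rightarrow>\<^sub>0 nat) \<Rightarrow> 'k::field) \<Rightarrow> (nat \<Rightarrow>\<^sub>0 nat) \<Rightarrow> 'k.
     \<forall>c f g. T (\<lambda>a. c * f a + g a) = (\<lambda>a. c * T f a + T g a)}"
  morphisms app Oper
  by (rule exI[of _ "\<lambda>f. f"]) simp

setup_lifting type_definition_oper

lemma app_linear: "app T (\<lambda>a. c * f a + g a) = (\<lambda>a. c * app T f a + app T g a)"
  using app[of T] by simp

lemma app_add: "app T (\<lambda>a. f a + g a) = (\<lambda>a. app T f a + app T g a)"
  using app_linear[of T 1 f g] by simp

lemma app_zero: "app T (\<lambda>a. 0) = (\<lambda>a. 0)"
  using app_linear[of T "-1" "\<lambda>a. 0" "\<lambda>a. 0"] by simp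

lemma app_scale: "app T (\<lambda>a. c * f a) = (\<lambda>a. c * app T f a)"
  using app_linear[of T c f "\<lambda>a. 0"] by (simp add: app_zero)

instantiation oper :: (field) ring_1
begin

lift_definition zero_oper :: "'a oper" is "\<lambda>f a. 0" by simp
lift_definition one_oper :: "'a oper" is "\<lambda>f. f" by simp
lift_definition plus_oper :: "'a oper \<Rightarrow> 'a oper \<Rightarrow> 'a oper" is "\<lambda>S T f a. S f a + T f a"
  by (simp add: algebra_simps)
lift_definition minus_oper :: "'a oper \<Rightarrow> 'a oper \<Rightarrow> 'a oper" is "\<lambda>S T f a. S f a - T f a"
  by (simp add: algebra_simps)
lift_definition uminus_oper :: "'a oper \<Rightarrow> 'a oper" is "\<lambda>T f a. - T f a"
  by (simp add: algebra_simps)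
lift_definition times_oper :: "'a oper \<Rightarrow> 'a oper \<Rightarrow> 'a oper" is "\<lambda>S T f. S (T f)"
  by simp

lemma app_simps:
  "app 0 f = (\<lambda>a. 0)" "app 1 f = f" "app (S + T) f = (\<lambda>a. app S f a + app T f a)"
  "app (S - T) f = (\<lambda>a. app S f a - app T f a)" "app (- T) f = (\<lambda>a. - app T f a)"
  "app (S * T) f = app S (app T f)"
  for S T :: "'a oper"
  by (simp_all add: zero_oper.rep_eq one_oper.rep_eq plus_oper.rep_eq minus_oper.rep_eq
      uminus_oper.rep_eq times_oper.rep_eq)

lemma oper_eqI: "(\<And>f a. app S f a = app T f a) \<Longrightarrow> S = (T :: 'a oper)"
  by (metis app_inject ext)

instance
proof
  show "0 \<noteq> (1 :: 'a oper)"
  proof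
    assume "0 = (1 :: 'a oper)"
    then have "app 0 (\<lambda>_. 1 :: 'a) = app 1 (\<lambda>_. 1)" by simp
    then show False by (simp add: app_simps fun_eq_iff)
  qed
qed (rule oper_eqI, simp add: app_simps app_add app_zero algebra_simps)+

end

lemma app_sum: "app (sum T A) f a = (\<Sum>i\<in>A. app (T i) f a)"
  by (induction A rule: infinite_finite_induct) (simp_all add: app_simps)

lift_definition scal :: "'k::field \<Rightarrow> 'k oper" is "\<lambda>c f a. c * f a"
  by (simp add: algebra_simps)

lemma app_scal: "app (scal c) f = (\<lambda>a. c * f a)"
  by (simp add: scal.rep_eq)

text \<open>If f a is read as the coefficient of the divided power monomial x^a/a!, the shift is the
  partial derivative. Its p-th power is not zero, unlike that of a derivative on polynomials in
  characteristic p.\<close>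

lift_definition S :: "nat \<Rightarrow> 'k::field oper" is "\<lambda>i f a. f (a + Poly_Mapping.single i 1)"
  by simp

text \<open>The factor is the one by which x_i times a divided power monomial differs from the next
  one. It vanishes when the exponent of x_i is 0, so the truncated subtraction does no harm.\<close>

lift_definition Pm :: "nat \<Rightarrow> 'k::field oper" is
  "\<lambda>i f a. of_nat (Poly_Mapping.lookup a i) * f (a - Poly_Mapping.single i 1)"
  by (simp add: algebra_simps)

lemma app_S: "app (S i) f a = f (a + Poly_Mapping.single i 1)"
  by (simp add: S.rep_eq)

lemma app_Pm: "app (Pm i) f a = of_nat (Poly_Mapping.lookup a i) * f (a - Poly_Mapping.single i 1)"
  by (simp add: Pm.rep_eq)

lemma scalar_map_scal: "scalar_map (scal :: 'k::field \<Rightarrow> 'k oper)"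
  by unfold_locales (rule oper_eqI, simp add: app_simps app_scal app_scale algebra_simps)+

interpretation sc: scalar_map scal by (rule scalar_map_scal)

lemma app_of_nat: "app (of_nat n) f = (\<lambda>a. of_nat n * f a)"
  by (induction n) (simp_all add: app_simps distrib_right)

lemma of_nat_oper: "of_nat n = (scal (of_nat n) :: 'k::field oper)"
  by (rule oper_eqI) (simp add: app_of_nat app_scal)

lemma of_nat_char_oper: "of_nat CHAR('k) = (0 :: 'k::field oper)"
  by (rule oper_eqI) (simp add: app_of_nat app_simps)

lemma S_comm: "S i * S j = S j * (S i :: 'k::field oper)"
  by (rule oper_eqI) (simp add: app_simps app_S ac_simps)

lemma Pm_comm: "Pm i * Pm j = Pm j * (Pm i :: 'k::field oper)"
proof (cases "i = j")
  case False
  have "a - Poly_Mapping.single i 1 - Poly_Mapping.single j 1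
      = a - Poly_Mapping.single j 1 - Poly_Mapping.single i 1" for a :: "nat \<Rightarrow>\<^sub>0 nat"
    by (rule poly_mapping_eqI) (simp add: lookup_minus)
  then show ?thesis using False
    by (intro oper_eqI) (simp add: app_simps app_Pm lookup_minus lookup_single_not_eq)
qed simp

lemma S_Pm: "S i * Pm j - Pm j * S i = (if i = j then 1 else 0 :: 'k::field oper)"
proof (rule oper_eqI)
  fix f :: "(nat \<Rightarrow>\<^sub>0 nat) \<Rightarrow> 'k" and a
  show "app (S i * Pm j - Pm j * S i) f a = app (if i = j then 1 else 0) f a"
  proof (cases "Poly_Mapping.lookup a j = 0")
    case True
    then show ?thesis by (simp add: app_simps app_S app_Pm lookup_add lookup_single when_def)
  next
    case False
    then have "a + Poly_Mapping.single i 1 - Poly_Mapping.single j 1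
        = a - Poly_Mapping.single j 1 + Poly_Mapping.single i 1"
      by (intro poly_mapping_eqI) (auto simp: lookup_add lookup_minus lookup_single when_def)
    moreover have "i = j \<Longrightarrow> a - Poly_Mapping.single j 1 + Poly_Mapping.single i 1 = a"
      using False by (intro poly_mapping_eqI) (auto simp: lookup_add lookup_minus lookup_single when_def)
    ultimately show ?thesis
      by (auto simp: app_simps app_S app_Pm lookup_add lookup_single when_def algebra_simps)
  qed
qed

lemma S_power_Pm: "S i ^ n * Pm j - Pm j * S i ^ n = (if i = j then of_nat n * S i ^ (n - 1) else 0 :: 'k::field oper)"
proof (induction n)
  case (Suc n)
  have "S i ^ Suc n * Pm j - Pm j * S i ^ Suc n
     = S i * (S i ^ n * Pm j - Pm j * S i ^ n) + (S i * Pm j - Pm j * S i) * (S i ^ n :: 'k oper)"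
    by (simp add: algebra_simps)
  also have "\<dots> = (if i = j then of_nat (Suc n) * S i ^ n else 0)"
  proof (cases "i = j")
    case True
    have "S i * (of_nat n * S i ^ (n - 1)) = of_nat n * (S i * S i ^ (n - 1) :: 'k oper)"
      by (metis mult.assoc mult_of_nat_commute)
    also have "\<dots> = of_nat n * S i ^ n"
      by (cases n) simp_all
    finally show ?thesis using True unfolding Suc S_Pm by (simp add: distrib_right)
  next
    case False
    then show ?thesis unfolding Suc S_Pm by simp
  qed
  finally show ?case by simp
qed simp

text \<open>Translations carry the origin to every exponent: if T commutes with them, the value of T
  f at a is the value at 0 of T applied to the translate of f by a.\<close>

lemma oper_zeroI:
  fixes T :: "'k::field oper"
  assumes comm: "\<And>i. T * S i = S i * T" and zero: "\<And>f. app T f 0 = 0"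
  shows "T = 0"
proof -
  have step: "app T f (b + Poly_Mapping.single i 1) = app T (\<lambda>x. f (x + Poly_Mapping.single i 1)) b" for f b i
  proof -
    have "app (S i) f = (\<lambda>x. f (x + Poly_Mapping.single i 1))" by (simp add: fun_eq_iff app_S)
    then show ?thesis using arg_cong[OF comm[of i], of "\<lambda>T. app T f b"] by (simp add: app_simps app_S)
  qed
  have "app T f (b + a) = app T (\<lambda>x. f (x + a)) b" for f a b
  proof (induction a arbitrary: f b rule: poly_mapping_induct_sum)
    case (add a a')
    have "app T f (b + (a + a')) = app T f ((b + a) + a')" by (simp add: ac_simps)
    also have "\<dots> = app T (\<lambda>x. f (x + a')) (b + a)" by (rule add(2))
    also have "\<dots> = app T (\<lambda>x. f (x + a + a')) b" by (rule add(1))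
    finally show ?case by (simp add: ac_simps)
  next
    case (single i n)
    show ?case
    proof (induction n arbitrary: f b)
      case (Suc n)
      have s: "Poly_Mapping.single i (Suc n) = Poly_Mapping.single i n + Poly_Mapping.single i 1"
        by (simp flip: single_add)
      have "app T f (b + Poly_Mapping.single i (Suc n))
          = app T (\<lambda>x. f (x + Poly_Mapping.single i 1)) (b + Poly_Mapping.single i n)"
        unfolding s add.assoc[symmetric] by (rule step)
      also have "\<dots> = app T (\<lambda>x. f (x + Poly_Mapping.single i n + Poly_Mapping.single i 1)) b"
        by (rule Suc)
      finally show ?case by (simp add: s add.assoc)
    qed simp
  qed simp
  from this[of _ 0] show ?thesis using zero by (intro oper_eqI) (simp add: app_simps)
qed

text \<open>The generic power series \<open>x(t) = \<Sum>\<^sub>i x\<^sub>i t\<^sup>i\<close> and the coefficients of \<open>t\<^sup>k x(t)\<^sup>m\<close>.\<close>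

definition xs :: "'k::field oper fps" where
  "xs = Abs_fps Pm"

definition q :: "nat \<Rightarrow> nat \<Rightarrow> 'k::field oper fps" where
  "q k m = fps_X ^ k * xs ^ m"

lemma fps_const_comm:
  fixes c :: "'r::ring_1"
  shows "(\<And>n. c * fps_nth f n = fps_nth f n * c) \<Longrightarrow> fps_const c * f = f * fps_const c"
  by (simp add: fps_eq_iff)

lemma commute_q:
  fixes c :: "'k::field oper"
  assumes "\<And>i. c * Pm i = Pm i * c"
  shows "c * fps_nth (q k m) j = fps_nth (q k m) j * c"
proof -
  have 1: "fps_const c * xs = xs * fps_const c" by (rule fps_const_comm) (simp add: xs_def assms)
  have 2: "fps_const c * xs ^ m = xs ^ m * fps_const c"
  proof (induction m)
    case (Suc m)
    have "fps_const c * xs ^ Suc m = fps_const c * xs * xs ^ m" by (simp add: mult.assoc)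
    also have "\<dots> = xs * (xs ^ m * fps_const c)" by (simp only: 1 mult.assoc Suc)
    finally show ?case by (simp add: mult.assoc)
  qed simp
  have "fps_const c * q k m = q k m * fps_const c"
    unfolding q_def by (simp add: mult.assoc[symmetric] fps_mult_fps_X_power_commute[symmetric])
      (simp add: mult.assoc 2)
  then have "fps_nth (fps_const c * q k m) j = fps_nth (q k m * fps_const c) j" by simp
  then show ?thesis by simp
qed

lemma q_comm: "fps_nth (q k m) i * fps_nth (q k' m') j = fps_nth (q k' m') j * (fps_nth (q k m) i :: 'k::field oper)"
  by (intro commute_q sym[OF commute_q] Pm_comm)

lemma q_mult: "q k m * q k' m' = (q (k + k') (m + m') :: 'k::field oper fps)"
proof -
  have "xs ^ m * fps_X ^ k' = fps_X ^ k' * (xs ^ m :: 'k oper fps)"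
    by (rule fps_mult_fps_X_power_commute[symmetric])
  then have "q k m * q k' m' = fps_X ^ k * (fps_X ^ k' * xs ^ m) * (xs ^ m' :: 'k oper fps)"
    by (simp add: q_def mult.assoc[symmetric]) (simp add: mult.assoc)
  then show ?thesis by (simp add: q_def power_add mult.assoc)
qed

text \<open>The derivative of x(t) with respect to x_i is t^i, so this is the chain rule for t^k
  x(t)^m.\<close>

lemma q_S:
  "S i * fps_nth (q k m) j - fps_nth (q k m) j * S i
    = (of_nat m * fps_nth (q (i + k) (m - 1)) j :: 'k::field oper)"
proof -
  let ?s = "fps_const (S i :: 'k oper)"
  have 1: "?s * xs - xs * ?s = fps_X ^ i"
    by (rule fps_ext) (simp add: xs_def S_Pm)
  have 2: "?s * xs ^ m - xs ^ m * ?s = of_nat m * (fps_X ^ i * xs ^ (m - 1))"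
  proof (induction m)
    case (Suc m)
    have "?s * xs ^ Suc m - xs ^ Suc m * ?s
       = (?s * xs - xs * ?s) * xs ^ m + xs * (?s * xs ^ m - xs ^ m * ?s)"
      by (simp add: algebra_simps)
    also have "\<dots> = fps_X ^ i * xs ^ m + xs * (of_nat m * (fps_X ^ i * xs ^ (m - 1)))"
      unfolding 1 Suc ..
    also have "xs * (of_nat m * (fps_X ^ i * xs ^ (m - 1))) = of_nat m * (fps_X ^ i * (xs ^ m :: 'k oper fps))"
    proof (cases m)
      case (Suc m')
      have "xs * (of_nat m * (fps_X ^ i * xs ^ m')) = of_nat m * (xs * fps_X ^ i * (xs ^ m' :: 'k oper fps))"
        by (metis mult.assoc mult_of_nat_commute)
      also have "xs * fps_X ^ i = fps_X ^ i * (xs :: 'k oper fps)"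
        by (rule fps_mult_fps_X_power_commute[symmetric])
      finally show ?thesis using Suc by (simp add: mult.assoc)
    qed simp
    finally show ?case by (simp add: distrib_right)
  qed simp
  have "?s * q k m - q k m * ?s = fps_X ^ k * (?s * xs ^ m - xs ^ m * ?s)"
  proof -
    have "?s * (fps_X ^ k * xs ^ m) = fps_X ^ k * (?s * xs ^ m)"
      by (simp add: fps_mult_fps_X_power_commute[of k ?s] flip: mult.assoc)
    then show ?thesis by (simp add: q_def right_diff_distrib mult.assoc)
  qed
  also have "\<dots> = of_nat m * q (i + k) (m - 1)"
    unfolding 2 q_def by (metis add.commute mult.assoc mult_of_nat_commute power_add)
  finally have "fps_nth (?s * q k m - q k m * ?s) j = fps_nth (of_nat m * q (i + k) (m - 1)) j" by simp
  then show ?thesis by (simp flip: fps_of_nat)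
qed

lemma q_nth_shift: "fps_nth (q (i + k) m) j = (if j < i then 0 else fps_nth (q k m) (j - i))"
  by (simp add: q_def power_add mult.assoc fps_X_power_mult_nth)

lemma q_zero: "fps_nth (q k 0) j = (if j = k then 1 else 0)"
  by (simp add: q_def)

lemma app_q_origin: "m \<ge> 1 \<Longrightarrow> app (fps_nth (q k m) j) f 0 = 0"
proof -
  assume "m \<ge> 1"
  then obtain m' where m: "m = Suc m'" by (cases m) auto
  have "app (fps_nth (xs ^ m) n) f 0 = 0" for n
    by (simp add: m fps_mult_nth app_sum app_simps xs_def app_Pm)
  then show ?thesis by (simp add: q_def fps_X_power_mult_nth app_simps)
qed

text \<open>The derivatives of x(t)^p carry the factor p = 0, so its coefficients commute with all
  shifts; since they also vanish at the origin, \<open>oper_zeroI\<close> applies. This matches e_i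
  = 0 for i >= p - 1.\<close>

lemma q_char:
  assumes "prime CHAR('k)" "m \<ge> CHAR('k)"
  shows "fps_nth (q k m) j = (0 :: 'k::field oper)"
proof -
  have zero: "fps_nth (q k CHAR('k)) n = (0 :: 'k oper)" for n k
  proof (rule oper_zeroI)
    fix i
    have "S i * fps_nth (q k CHAR('k)) n - fps_nth (q k CHAR('k)) n * S i = (0 :: 'k oper)"
      unfolding q_S by (simp add: of_nat_char_oper)
    then show "fps_nth (q k CHAR('k)) n * S i = S i * (fps_nth (q k CHAR('k)) n :: 'k oper)" by simp
    show "app (fps_nth (q k CHAR('k)) n) f 0 = 0" for f :: "_ \<Rightarrow> 'k"
      by (rule app_q_origin) (use assms prime_ge_1_nat in blast)
  qed
  have "q k m = q k CHAR('k) * (q 0 (m - CHAR('k)) :: 'k oper fps)"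
    using assms by (simp add: q_mult)
  then show ?thesis by (simp add: fps_mult_nth zero)
qed

lemma of_nat_left: "f * (of_nat n * g) = of_nat n * (f * g)" for f g :: "'r::ring_1"
  by (metis mult.assoc mult_of_nat_commute)

lemma commutator_sum:
  fixes a b a' b' :: "'r::ring_1"
  shows "(a + of_nat n * b) * (a' + of_nat n' * b') - (a' + of_nat n' * b') * (a + of_nat n * b)
    = (a * a' - a' * a) + of_nat n' * (a * b' - b' * a) - of_nat n * (a' * b - b * a')
      + of_nat n * (of_nat n' * (b * b' - b' * b))"
proof -
  have "of_nat n' * (of_nat n * (b' * b)) = of_nat n * (of_nat n' * (b' * b))"
    by (rule of_nat_left)
  then show ?thesis
    by (simp add: distrib_left distrib_right right_diff_distrib mult.assoc
        of_nat_left[of a] of_nat_left[of b] of_nat_left[of a'] of_nat_left[of b'])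
qed

lemma scal_left: "f * (scal c * g) = scal c * (f * g)"
  by (metis mult.assoc sc.\<sigma>_central)

section \<open>Twisted vector fields on jets\<close>

locale oper_rep =
  fixes l :: nat and b :: "nat \<Rightarrow> 'k::field"
begin

text \<open>The vector field induced by X^m t^k \<partial> on jets x(t) modulo t^(l+1): it moves
  x(t) in the direction t^k x(t)^m.\<close>

definition A :: "nat \<Rightarrow> nat \<Rightarrow> 'k oper" where
  "A k m = (\<Sum>i\<le>l. fps_nth (q k m) i * S i)"

definition B :: "nat \<Rightarrow> nat \<Rightarrow> 'k oper" where
  "B k m = (\<Sum>i\<le>l. scal (b i) * fps_nth (q k m) i)"

text \<open>
  The action of \<open>X\<^sup>m t\<^sup>k \<partial>\<close> on functions on the space of \<open>\<ell>\<close>-jets of the line, twisted by a cocycle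
  that is linear in the coefficients of the derivative \<open>m X\<^bsup>m-1\<^esup> t\<^sup>k\<close>.
\<close>

definition R :: "nat \<Rightarrow> nat \<Rightarrow> 'k oper" where
  "R k m = A k m + of_nat m * B k (m - 1)"

lemma A_comm_q:
  "A k m * fps_nth (q k' m') j - fps_nth (q k' m') j * A k m
     = (\<Sum>i\<le>l. fps_nth (q k m) i * (S i * fps_nth (q k' m') j - fps_nth (q k' m') j * S i))"
proof -
  have "(\<Sum>i\<le>l. fps_nth (q k' m') j * (fps_nth (q k m) i * S i))
      = (\<Sum>i\<le>l. fps_nth (q k m) i * (fps_nth (q k' m') j * (S i :: 'k oper)))"
    by (simp add: mult.assoc[symmetric] q_comm[of k' m' j])
  then show ?thesis
    by (simp add: A_def sum_distrib_left sum_distrib_right right_diff_distrib sum_subtractf mult.assoc)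
qed

text \<open>The chain rule again. The coefficient of t^j in t^k' x(t)^m' involves no x_i with i > j,
  so for j <= l the truncation of the field at l is not felt. For m' = 0 the truncated m' - 1 is
  multiplied by zero.\<close>

lemma A_q:
  assumes "j \<le> l"
  shows "A k m * fps_nth (q k' m') j - fps_nth (q k' m') j * A k m
    = of_nat m' * fps_nth (q (k + k') (m + (m' - 1))) j"
proof -
  have "A k m * fps_nth (q k' m') j - fps_nth (q k' m') j * A k m
     = (\<Sum>i\<le>l. of_nat m' * (fps_nth (q k m) i * fps_nth (q (i + k') (m' - 1)) j))"
    unfolding A_comm_q q_S of_nat_left ..
  also have "\<dots> = of_nat m' * (\<Sum>i\<le>l. fps_nth (q k m) i * fps_nth (q (i + k') (m' - 1)) j)"
    by (rule sum_distrib_left[symmetric])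
  also have "(\<Sum>i\<le>l. fps_nth (q k m) i * fps_nth (q (i + k') (m' - 1)) j)
      = (\<Sum>i = 0..j. fps_nth (q k m) i * fps_nth (q k' (m' - 1)) (j - i))"
    using assms by (intro sum.mono_neutral_cong_right) (auto simp: q_nth_shift)
  also have "\<dots> = fps_nth (q (k + k') (m + (m' - 1))) j"
    by (simp add: fps_mult_nth flip: q_mult)
  finally show ?thesis .
qed

text \<open>As for any commutator of vector fields, each differentiates the coefficients of the
  other, and the second-order terms cancel because shifts commute.\<close>

lemma A_A: "A k m * A k' m' - A k' m' * A k m
    = of_nat m' * A (k + k') (m + (m' - 1)) - of_nat m * A (k + k') (m' + (m - 1))"
proof -
  let ?f = "fps_nth (q k m) :: nat \<Rightarrow> 'k oper" and ?g = "fps_nth (q k' m') :: nat \<Rightarrow> 'k oper"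
  have "A k m * A k' m' - A k' m' * A k m = (\<Sum>j\<le>l. A k m * (?g j * S j) - ?g j * S j * A k m)"
    by (simp add: A_def[of k' m'] sum_distrib_left sum_distrib_right sum_subtractf)
  also have "\<dots> = (\<Sum>j\<le>l. (A k m * ?g j - ?g j * A k m) * S j) + (\<Sum>j\<le>l. ?g j * (A k m * S j - S j * A k m))"
    unfolding sum.distrib[symmetric] by (rule sum.cong) (simp_all add: algebra_simps)
  also have "(\<Sum>j\<le>l. ?g j * (A k m * S j - S j * A k m)) = - (\<Sum>i\<le>l. (A k' m' * ?f i - ?f i * A k' m') * S i)"
  proof -
    define d where "d i j = S j * ?f i - ?f i * S j" for i j
    have "A k m * S j - S j * A k m = (\<Sum>i\<le>l. - d i j * S i)" for j
      by (simp add: d_def A_def sum_distrib_left sum_distrib_right sum_subtractf[symmetric] left_diff_distrib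
          mult.assoc S_comm)
    then have "(\<Sum>j\<le>l. ?g j * (A k m * S j - S j * A k m))
        = (\<Sum>j\<le>l. \<Sum>i\<le>l. - (?g j * d i j * S i))"
      by (simp add: sum_distrib_left mult.assoc)
    also have "\<dots> = (\<Sum>i\<le>l. \<Sum>j\<le>l. - (?g j * d i j * S i))"
      by (rule sum.swap)
    finally show ?thesis by (simp add: d_def A_comm_q[of k' m'] sum_distrib_right sum_negf)
  qed
  also have "(\<Sum>i\<le>l. (A k' m' * ?f i - ?f i * A k' m') * S i) = of_nat m * A (k + k') (m' + (m - 1))"
    by (simp add: A_q A_def[of "k + k'"] sum_distrib_left mult.assoc add.commute)
  also have "(\<Sum>j\<le>l. (A k m * ?g j - ?g j * A k m) * S j) = of_nat m' * A (k + k') (m + (m' - 1))"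
    by (simp add: A_q A_def[of "k + k'"] sum_distrib_left mult.assoc)
  finally show ?thesis by simp
qed

lemma A_B: "A k m * B k' m' - B k' m' * A k m = of_nat m' * B (k + k') (m + (m' - 1))"
proof -
  have "A k m * B k' m' - B k' m' * A k m
     = (\<Sum>j\<le>l. scal (b j) * (A k m * fps_nth (q k' m') j - fps_nth (q k' m') j * A k m))"
    by (simp add: B_def sum_distrib_left sum_distrib_right sum_subtractf scal_left right_diff_distrib mult.assoc)
  also have "\<dots> = (\<Sum>j\<le>l. of_nat m' * (scal (b j) * fps_nth (q (k + k') (m + (m' - 1))) j))"
    by (rule sum.cong) (simp_all add: A_q of_nat_left)
  finally show ?thesis by (simp add: B_def sum_distrib_left)
qed

lemma B_B: "B k m * B k' m' = B k' m' * B k m"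
proof -
  have "scal c * f * (scal d * g) = scal d * g * (scal c * f)" if "f * g = g * f" for f g :: "'k oper" and c d
  proof -
    have "scal c * f * (scal d * g) = scal c * scal d * (f * g)"
      by (metis mult.assoc sc.\<sigma>_central)
    also have "\<dots> = scal d * scal c * (g * f)"
      by (simp add: that sc.\<sigma>_central[of c])
    also have "\<dots> = scal d * g * (scal c * f)"
      by (metis mult.assoc sc.\<sigma>_central)
    finally show ?thesis .
  qed
  from this[OF q_comm] show ?thesis
    unfolding B_def sum_product by (subst sum.swap) simp
qed

lemma R_R: "R k m * R k' m' - R k' m' * R k m = of_int (int m' - int m) * R (k + k') (m + m' - 1)"
proof -
  have "R k m * R k' m' - R k' m' * R k m
     = (A k m * A k' m' - A k' m' * A k m)
       + of_nat m' * (A k m * B k' (m' - 1) - B k' (m' - 1) * A k m)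
       - of_nat m * (A k' m' * B k (m - 1) - B k (m - 1) * A k' m')
       + of_nat m * (of_nat m' * (B k (m - 1) * B k' (m' - 1) - B k' (m' - 1) * B k (m - 1)))"
    unfolding R_def by (rule commutator_sum)
  also have "\<dots> = of_nat m' * A (k + k') (m + (m' - 1)) - of_nat m * A (k + k') (m' + (m - 1))
       + of_nat (m' * (m' - 1)) * B (k + k') (m + (m' - 1 - 1))
       - of_nat (m * (m - 1)) * B (k + k') (m' + (m - 1 - 1))"
    unfolding A_A A_B B_B[of k "m - 1"] by (simp add: mult.assoc add.commute)
  also have "of_nat m' * A (k + k') (m + (m' - 1)) = of_nat m' * A (k + k') (m + m' - 1)"
    by (cases m') simp_all
  also have "of_nat m * A (k + k') (m' + (m - 1)) = of_nat m * A (k + k') (m + m' - 1)"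
    by (cases m) (simp_all add: add.commute)
  also have "of_nat (m' * (m' - 1)) * B (k + k') (m + (m' - 1 - 1)) = of_nat (m' * (m' - 1)) * B (k + k') (m + m' - 1 - 1)"
    by (cases m'; cases "m' - 1") simp_all
  also have "of_nat (m * (m - 1)) * B (k + k') (m' + (m - 1 - 1)) = of_nat (m * (m - 1)) * B (k + k') (m + m' - 1 - 1)"
    by (cases m; cases "m - 1") (simp_all add: add.commute)
  finally have *: "R k m * R k' m' - R k' m' * R k m
     = of_int (int m' - int m) * A (k + k') (m + m' - 1)
      + of_int (int (m' * (m' - 1)) - int (m * (m - 1))) * B (k + k') (m + m' - 1 - 1)"
    by (simp add: left_diff_distrib del: of_nat_mult)
  \<comment> \<open>This factorization is the cocycle condition that makes the twist compatible with
    brackets.\<close>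
  have **: "int (m' * (m' - 1)) - int (m * (m - 1)) = (int m' - int m) * int (m + m' - 1)"
    by (cases m; cases m') (simp_all add: algebra_simps)
  show ?thesis
    unfolding * ** by (simp add: R_def distrib_left mult.assoc)
qed

text \<open>In the border case m = p the exponent p - 1 in the twist is still below p, but the twist
  carries the factor m, which is zero in characteristic p.\<close>

lemma R_vanish:
  assumes "prime CHAR('k)" and "k > l \<or> m \<ge> CHAR('k)"
  shows "R k m = 0"
  using assms(2)
proof
  assume k: "k > l"
  have "fps_nth (q k n) j = (0 :: 'k oper)" if "j \<le> l" for j n
    using that k q_nth_shift[of k 0 n j] by simp
  then show ?thesis by (simp add: R_def A_def B_def)
next
  assume m: "m \<ge> CHAR('k)"
  then have "A k m = 0" by (simp add: A_def q_char[OF assms(1)])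
  moreover have "of_nat m * B k (m - 1) = 0"
  proof (cases "m = CHAR('k)")
    case True
    then show ?thesis by (simp add: of_nat_char_oper)
  next
    case False
    then show ?thesis using m by (simp add: B_def q_char[OF assms(1)])
  qed
  ultimately show ?thesis by (simp add: R_def)
qed

lemma R_zero: "k \<le> l \<Longrightarrow> R k 0 = S k"
proof -
  assume "k \<le> l"
  have "A k 0 = (\<Sum>i\<le>l. if i = k then S k else 0)"
    unfolding A_def by (rule sum.cong) (simp_all add: q_zero)
  then show ?thesis using \<open>k \<le> l\<close> by (simp add: R_def)
qed

text \<open>At the origin x(t) is zero, so for m >= 1 only the twist with exponent m - 1 = 0
  survives.\<close>

lemma R_origin:
  assumes "m \<ge> 1" "k \<le> l"
  shows "app (R k m) f 0 = (if m = 1 then b k else 0) * f 0"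
proof -
  have A0: "app (A k m) f 0 = 0" using assms by (simp add: A_def app_sum app_simps app_q_origin)
  show ?thesis
  proof (cases "m = 1")
    case True
    have "app (B k 0) f 0 = (\<Sum>i\<le>l. if i = k then b k * f 0 else 0)"
      unfolding B_def app_sum by (rule sum.cong) (simp_all add: q_zero app_simps app_scal)
    then show ?thesis using True A0 assms by (simp add: R_def app_simps)
  next
    case False
    then have "app (B k (m - 1)) f 0 = 0"
      using assms by (simp add: B_def app_sum app_simps app_scal app_q_origin)
    then show ?thesis using False A0 by (simp add: R_def app_simps app_of_nat)
  qed
qed

lemma R_commute:
  assumes "\<And>i. c * Pm i = Pm i * c" and "\<And>i. c * S i = S i * c"
  shows "c * R k m = R k m * (c :: 'k oper)"
proof -
  have q: "c * fps_nth (q k n) i = fps_nth (q k n) i * c" for n i by (rule commute_q[OF assms(1)])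
  have "c * (fps_nth (q k m) i * S i) = fps_nth (q k m) i * S i * c" for i
    by (simp add: mult.assoc[symmetric] q) (simp add: mult.assoc assms(2))
  then have A: "c * A k m = A k m * c" by (simp add: A_def sum_distrib_left sum_distrib_right)
  have "c * (scal (b i) * fps_nth (q k n) i) = scal (b i) * fps_nth (q k n) i * c" for i n
    by (simp add: mult.assoc[symmetric] sc.\<sigma>_central) (simp add: mult.assoc q sc.\<sigma>_central)
  then have B: "c * B k n = B k n * c" for n by (simp add: B_def sum_distrib_left sum_distrib_right)
  have "c * (of_nat m * B k (m - 1)) = of_nat m * B k (m - 1) * c"
    by (simp add: mult.assoc[symmetric] mult_of_nat_commute[symmetric]) (simp add: mult.assoc B)
  then show ?thesis by (simp add: R_def distrib_left distrib_right A)
qed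

text \<open>The coefficients of t^i with i <= l involve no coordinate x_j with j > l.
  \<open>oper_zeroI\<close> asks for commutation with these shifts as well.\<close>

lemma R_S_far:
  assumes "j > l"
  shows "S j * R k m = R k m * S j"
proof -
  have q: "S j * fps_nth (q k n) i = fps_nth (q k n) i * (S j :: 'k oper)" if "i \<le> l" for i n
  proof -
    have "fps_nth (q (j + k) (n - 1)) i = (0 :: 'k oper)" using that assms by (simp add: q_nth_shift)
    then show ?thesis using q_S[of j k n i, where 'k = 'k] by simp
  qed
  have "S j * (fps_nth (q k m) i * S i) = fps_nth (q k m) i * S i * (S j :: 'k oper)" if "i \<le> l" for i
    by (simp add: mult.assoc[symmetric] q[OF that]) (simp add: mult.assoc S_comm)
  then have A: "S j * A k m = A k m * S j" by (simp add: A_def sum_distrib_left sum_distrib_right)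
  have "S j * (scal (b i) * fps_nth (q k n) i) = scal (b i) * fps_nth (q k n) i * S j" if "i \<le> l" for i n
    by (simp add: mult.assoc[symmetric] sc.\<sigma>_central) (simp add: mult.assoc q[OF that] sc.\<sigma>_central)
  then have B: "S j * B k n = B k n * S j" for n by (simp add: B_def sum_distrib_left sum_distrib_right)
  have "S j * (of_nat m * B k (m - 1)) = of_nat m * B k (m - 1) * S j"
    by (simp add: mult.assoc[symmetric] mult_of_nat_commute[symmetric]) (simp add: mult.assoc B)
  then show ?thesis by (simp add: R_def distrib_left distrib_right A)
qed

end

section \<open>The representation and its p-relations\<close>

context witt
begin

lemma weights_nonempty: "\<exists>a. a \<in> weights l \<chi>"
proof -
  define d where "d = \<chi> (e 0 0) ^ CHAR('k)"
  define q :: "'k poly" where "q = monom 1 CHAR('k) - [:d, 1:]"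
  have "coeff q CHAR('k) = 1" using p_gt by (auto simp: q_def coeff_pCons split: nat.splits)
  then have "CHAR('k) \<le> degree q" by (intro le_degree) simp
  then have "degree q > 0" using p_pos by simp
  then obtain a where "poly q a = 0" using alg_closed_imp_poly_has_root by blast
  then have "a ^ CHAR('k) - a = d" by (simp add: q_def poly_monom algebra_simps)
  then show ?thesis by (auto simp: weights_def d_def)
qed

context
  fixes a assumes a: "a \<in> weights l \<chi>"
begin

interpretation O: oper_rep l "wt a" .

text \<open>The exponent comes from e_it^k = X^(i+1) t^k \<partial>. The twist by
  \<open>wt a\<close> is chosen so that, evaluated at the origin, the nonnegative part acts through
  the character \<open>\<phi> a\<close>.\<close>

definition \<rho> :: "'k witt \<Rightarrow> 'k oper" where
  "\<rho> x = (\<Sum>(i, k)\<in>Poly_Mapping.keys x. scal (Poly_Mapping.lookup x (i, k)) * O.R k (nat (i + 1)))"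

lemma \<rho>_add: "\<rho> (x + y) = \<rho> x + \<rho> y"
  unfolding \<rho>_def case_prod_beta prod.collapse
  by (rule setsum_keys_plus_distrib) (simp_all add: sc.\<sigma>_0 sc.\<sigma>_add distrib_right)

lemma \<rho>_single: "\<rho> (Poly_Mapping.single (i, k) c) = scal c * O.R k (nat (i + 1))"
  by (simp add: \<rho>_def sc.\<sigma>_0)

lemma \<rho>_scl: "\<rho> (sc c x) = scal c * \<rho> x"
proof (induction x rule: poly_mapping_induct_sum)
  case (add x y)
  have "sc c (x + y) = sc c x + sc c y"
    by (rule poly_mapping_eqI) (simp add: lookup_witt_scl lookup_add distrib_left)
  then show ?case using add by (simp add: \<rho>_add distrib_left)
next
  case (single w d)
  then show ?case by (cases w) (simp add: witt_scl_single \<rho>_single sc.\<sigma>_mult mult.assoc)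
qed (simp add: witt_scl_zero \<rho>_def)

lemma \<rho>_0: "\<rho> 0 = 0"
  by (simp add: \<rho>_def)

lemma \<rho>_sum: "\<rho> (sum f A) = (\<Sum>i\<in>A. \<rho> (f i))"
  by (induction A rule: infinite_finite_induct) (simp_all add: \<rho>_0 \<rho>_add)

lemma \<rho>_e: "-1 \<le> i \<Longrightarrow> \<rho> (e i k) = O.R k (nat (i + 1))"
proof (cases "valid i k")
  case True
  then show ?thesis by (simp add: \<rho>_def e_valid sc.\<sigma>_1)
next
  case False
  assume "-1 \<le> i"
  then have "k > l \<or> nat (i + 1) \<ge> CHAR('k)" using False by (auto simp: valid_def)
  then show ?thesis using False by (simp add: e_invalid \<rho>_0 O.R_vanish[OF prime_p])
qed

lemma \<rho>_e_brk:
  assumes "valid i k" "valid j m"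
  shows "\<rho> (br (e i k) (e j m)) = ad (\<rho> (e i k)) (\<rho> (e j m))"
proof -
  have ij: "-1 \<le> i" "-1 \<le> j" using assms by (auto simp: valid_def)
  have uminus: "scal (- c) = - (scal c :: 'k oper)" for c
    by (rule oper_eqI) (simp add: app_scal app_simps)
  have of_int: "scal (of_int n) = (of_int n :: 'k oper)" for n
    by (cases n rule: int_cases2) (simp_all add: uminus flip: of_nat_oper)
  have "ad (\<rho> (e i k)) (\<rho> (e j m)) = of_int (j - i) * O.R (k + m) (nat (i + 1) + nat (j + 1) - 1)"
    using ij by (simp add: \<rho>_e ad_def O.R_R)
  also have "\<dots> = of_int (j - i) * \<rho> (e (i + j) (k + m))"
  \<comment> \<open>For i = j = -1 the truncated exponent does not correspond to degree -2, but the
    factor j - i is zero.\<close>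
  proof (cases "i = -1 \<and> j = -1")
    case False
    then have "-1 \<le> i + j" "nat (i + j + 1) = nat (i + 1) + nat (j + 1) - 1" using ij by auto
    then show ?thesis by (simp add: \<rho>_e)
  qed simp
  finally show ?thesis by (simp only: brk_e[OF assms] \<rho>_scl of_int)
qed

lemma ad_linear:
  "ad 0 y = 0" "ad x 0 = 0" "ad (x + x') y = ad x y + ad x' y" "ad x (y + y') = ad x y + ad x y'"
  "ad (scal c * x) y = scal c * ad x y" "ad x (scal c * y) = scal c * ad x y"
  for x y x' y' :: "'k oper"
  by (simp_all add: ad_def algebra_simps scal_left)

lemma \<rho>_brk:
  assumes "x \<in> Ws" "y \<in> Ws"
  shows "\<rho> (br x y) = ad (\<rho> x) (\<rho> y)"
  using assms(1)[folded filt_space]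
proof (induction rule: filt_induct)
  case (basis i k c)
  have "\<rho> (br (e i k) y) = ad (\<rho> (e i k)) (\<rho> y)"
    using assms(2)[folded filt_space]
  proof (induction rule: filt_induct)
    case (basis j m d)
    then show ?case
      using \<rho>_e_brk[OF \<open>valid i k\<close>] by (simp add: brk_scl_right e_space \<rho>_scl ad_linear)
  qed (simp_all add: brk_zero_right \<rho>_0 brk_add_right e_space \<rho>_add ad_linear filt_space)
  then show ?case using assms(2) by (simp add: brk_scl_left e_space \<rho>_scl ad_linear)
qed (use assms(2) in \<open>simp_all add: brk_zero_left \<rho>_0 brk_add_left \<rho>_add ad_linear filt_space\<close>)

lemma \<rho>_brk_funpow:
  assumes "x \<in> Ws" "y \<in> Ws"
  shows "(br x ^^ n) y \<in> Ws \<and> \<rho> ((br x ^^ n) y) = (ad (\<rho> x) ^^ n) (\<rho> y)"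
  by (induction n) (use assms in \<open>simp_all add: \<rho>_brk br_space\<close>)

interpretation ring_char_p "CHAR('k)" "TYPE('k oper)"
  by unfold_locales (simp_all add: prime_p odd_p of_nat_char_oper)

lemma \<rho>_S: "k \<le> l \<Longrightarrow> \<rho> (e (-1) k) = S k"
  by (simp add: \<rho>_e O.R_zero)

lemma \<rho>_commute:
  assumes "\<And>k m. c * O.R k m = O.R k m * c"
  shows "c * \<rho> x = \<rho> x * c"
proof -
  have "c * (scal d * O.R k m) = scal d * O.R k m * c" for d k m
    by (simp add: scal_left assms mult.assoc)
  then show ?thesis by (simp add: \<rho>_def sum_distrib_left sum_distrib_right case_prod_beta)
qed

lemma \<rho>_origin:
  assumes "y \<in> Wf 0"
  shows "app (\<rho> y) f 0 = \<phi> a y * f 0"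
  using assms
proof (induction rule: filt_induct)
  case (basis i k c)
  then have "nat (i + 1) = 1 \<longleftrightarrow> i = 0" "nat (i + 1) \<ge> 1" by auto
  then have "app (\<rho> (e i k)) f 0 = \<phi> a (e i k) * f 0"
    using basis by (simp add: \<rho>_e O.R_origin valid_def \<phi>_e del: One_nat_def)
  then show ?case by (simp add: \<rho>_scl \<phi>_scl app_simps app_scal)
qed (simp_all add: \<rho>_0 \<phi>_0 \<rho>_add \<phi>_add app_simps distrib_right)

lemma \<rho>_origin_power: "y \<in> Wf 0 \<Longrightarrow> app (\<rho> y ^ n) f 0 = \<phi> a y ^ n * f 0"
  by (induction n) (simp_all add: app_simps \<rho>_origin)

lemma commute_power: "x * y = y * x \<Longrightarrow> x ^ n * y = y * x ^ n" for x y :: "'r::ring_1"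
  by (induction n) (simp_all add: mult.assoc, simp flip: mult.assoc)

definition defect :: "'k witt \<Rightarrow> 'k oper" where
  "defect x = \<rho> x ^ CHAR('k) - \<rho> (pm x) - scal (\<chi> x ^ CHAR('k))"

text \<open>For j <= l the shift S_j is the image of e_{-1}t^j, and the p-th power of ad y is ad of
  the p-map, so the defect commutes with S_j; for j > l all operators involved do. At the origin the
  defect multiplies by \<phi>(y)^p - \<phi>(y^[p]) - \<chi>(y)^p, which is 0 by
  \<open>\<phi>_p\<close>.\<close>

lemma defect_filt0:
  assumes y: "y \<in> Wf 0"
  shows "defect y = 0"
proof (rule oper_zeroI)
  fix j
  have ys: "y \<in> Ws" using y filt_subset by blast
  show "defect y * S j = S j * defect y"
  proof (cases "j \<le> l")
    case True
    have "ad (\<rho> y ^ CHAR('k)) (\<rho> (e (-1) j)) = ad (\<rho> (pm y)) (\<rho> (e (-1) j))"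
      using \<rho>_brk_funpow[OF ys e_space, of "CHAR('k)" "-1" j] \<rho>_brk[OF pm_space[OF ys] e_space, of "-1" j]
      by (simp add: ad_power_p pm_brk[OF ys e_space])
    then show ?thesis
      using sc.\<sigma>_central[of "\<chi> y ^ CHAR('k)" "S j"]
      by (simp add: defect_def ad_def \<rho>_S[OF True] algebra_simps)
  next
    case False
    then have comm: "S j * \<rho> x = \<rho> x * S j" for x by (intro \<rho>_commute O.R_S_far) simp
    show ?thesis
      using sc.\<sigma>_central[of "\<chi> y ^ CHAR('k)" "S j"] comm[of "pm y"] commute_power[OF comm[of y, symmetric], of "CHAR('k)"]
      by (simp add: defect_def algebra_simps)
  qed
  fix f :: "(nat \<Rightarrow>\<^sub>0 nat) \<Rightarrow> 'k"
  show "app (defect y) f 0 = 0"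
    using y by (simp add: defect_def app_simps app_scal \<rho>_origin_power \<rho>_origin pm_filt0 \<phi>_p[OF a] algebra_simps)
qed

lemma \<rho>_jacobson_s:
  assumes "x \<in> Ws" "y \<in> Ws"
  shows "\<rho> (jacobson_s L i x y) = scal (inverse (of_nat i)) * ad_words (\<rho> x) (\<rho> y) (CHAR('k) - 1) (i - 1)"
proof -
  have "foldr (\<lambda>b. br (if b then x else y)) bs x \<in> Ws \<and>
    \<rho> (foldr (\<lambda>b. br (if b then x else y)) bs x) = foldr (\<lambda>b. ad (if b then \<rho> x else \<rho> y)) bs (\<rho> x)" for bs
    by (induction bs) (use assms in \<open>auto simp: \<rho>_brk br_space\<close>)
  then show ?thesis by (simp add: jacobson_s_def \<rho>_scl \<rho>_sum ad_words_def)
qed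

text \<open>Jacobson's formula holds in the Lie algebra by assumption and in the operator ring by
  \<open>jacobson\<close>, and \<rho> carries the terms of the one to those of the other.\<close>

lemma defect_add:
  assumes "x \<in> Ws" "y \<in> Ws"
  shows "defect (x + y) = defect x + defect y"
proof -
  have inv: "of_nat i * scal (inverse (of_nat i)) = (1 :: 'k oper)" if "i \<in> {1..CHAR('k) - 1}" for i
  proof -
    have "\<not> CHAR('k) dvd i" using that p_gt by (auto dest!: dvd_imp_le)
    then have "of_nat i \<noteq> (0 :: 'k)" by (simp add: of_nat_eq_0_iff_char_dvd)
    then show ?thesis unfolding of_nat_oper by (simp add: sc.\<sigma>_1 flip: sc.\<sigma>_mult)
  qed
  have "\<rho> (x + y) ^ CHAR('k) = \<rho> x ^ CHAR('k) + \<rho> y ^ CHAR('k) + \<rho> (\<Sum>i = 1..CHAR('k) - 1. jacobson_s L i x y)"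
    unfolding \<rho>_add \<rho>_sum \<rho>_jacobson_s[OF assms] by (rule jacobson[OF inv])
  then show ?thesis
    using assms by (simp add: defect_def pm_add \<rho>_add \<chi>_add frobenius_add sc.\<sigma>_add)
qed

text \<open>On arbitrary functions S_i^p is not the scalar \<chi>(e_{-1}t^i)^p, so the p-relation in
  degree -1 is imposed by restriction. For i > l the element e_{-1}t^i is 0, and the condition reads
  S_i^p f = 0.\<close>

definition V :: "((nat \<Rightarrow>\<^sub>0 nat) \<Rightarrow> 'k) set" where
  "V = {f. \<forall>i. app (S i ^ CHAR('k)) f = app (scal (\<chi> (e (-1) i) ^ CHAR('k))) f}"

text \<open>The p-th powers of the shifts are central in the Weyl algebra of characteristic p, since
  the commutator of S_i^p with x_i is p S_i^(p-1) = 0.\<close>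

lemma \<rho>_V:
  assumes f: "f \<in> V"
  shows "app (\<rho> x) f \<in> V"
proof -
  have "app (S i ^ CHAR('k)) (app (\<rho> x) f) = app (scal (\<chi> (e (-1) i) ^ CHAR('k))) (app (\<rho> x) f)" for i
  proof -
    have "S i ^ CHAR('k) * \<rho> x = \<rho> x * S i ^ CHAR('k)"
    proof (intro \<rho>_commute O.R_commute)
      show "S i ^ CHAR('k) * Pm j = Pm j * (S i ^ CHAR('k) :: 'k oper)" for j
        using S_power_Pm[of i "CHAR('k)" j, where 'k = 'k] by (simp add: of_nat_char_oper split: if_splits)
      show "S i ^ CHAR('k) * S j = S j * (S i ^ CHAR('k) :: 'k oper)" for j
        by (rule commute_power[OF S_comm])
    qed
    then have "app (S i ^ CHAR('k)) (app (\<rho> x) f) = app (\<rho> x) (app (S i ^ CHAR('k)) f)"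
      by (metis app_simps(6))
    also have "\<dots> = app (\<rho> x) (app (scal (\<chi> (e (-1) i) ^ CHAR('k))) f)"
      using f by (simp add: V_def)
    also have "\<dots> = app (scal (\<chi> (e (-1) i) ^ CHAR('k))) (app (\<rho> x) f)"
      by (metis app_simps(6) sc.\<sigma>_central)
    finally show ?thesis .
  qed
  then show ?thesis by (simp add: V_def)
qed

lemma defect_V:
  assumes x: "x \<in> Ws" and f: "f \<in> V"
  shows "app (defect x) f = (\<lambda>_. 0)"
  using x[folded filt_space]
proof (induction rule: filt_induct)
  case zero
  show ?case
    using defect_filt0[OF filt_zero] by (simp add: app_simps)
next
  case (add x y)
  then show ?case by (simp add: filt_space defect_add app_simps)
next
  case (basis i k c)
  have "app (defect (e i k)) f = (\<lambda>_. 0)"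
  proof (cases "i = -1")
    case True
    then have "k \<le> l" "pm (e i k) = 0" using basis by (auto simp: valid_def pm_e)
    then show ?thesis using f True by (simp add: defect_def \<rho>_S \<rho>_0 app_simps V_def)
  next
    case False
    then have "e i k \<in> Wf 0" using basis by (intro e_filt) simp
    then show ?thesis by (simp add: defect_filt0 app_simps)
  qed
  moreover have "defect (sc c (e i k)) = scal (c ^ CHAR('k)) * defect (e i k)"
  proof -
    have "(scal c * T) ^ n = scal (c ^ n) * T ^ n" for T :: "'k oper" and n
      by (induction n) (simp_all add: sc.\<sigma>_1 sc.\<sigma>_mult mult.assoc scal_left[of T])
    then show ?thesis
      by (simp add: defect_def \<rho>_scl pm_scl e_space \<chi>_scl power_mult_distrib right_diff_distrib sc.\<sigma>_mult)
  qed
  ultimately show ?case by (simp add: app_simps app_scal)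
qed

text \<open>The divided power coefficients of the exponential of the sum of all \<chi>(e_{-1}t^i)
  x_i. It is a common eigenfunction of the shifts, with value 1 (an empty product) at the
  origin.\<close>

definition vacuum :: "(nat \<Rightarrow>\<^sub>0 nat) \<Rightarrow> 'k" where
  "vacuum b = (\<Prod>i\<in>Poly_Mapping.keys b. \<chi> (e (-1) i) ^ Poly_Mapping.lookup b i)"

lemma vacuum_V: "vacuum \<in> V"
proof -
  have superset: "vacuum b = (\<Prod>i\<in>A. \<chi> (e (-1) i) ^ Poly_Mapping.lookup b i)"
    if "finite A" "Poly_Mapping.keys b \<subseteq> A" for A b
    unfolding vacuum_def using that by (intro prod.mono_neutral_left) (auto simp: in_keys_iff)
  have step: "vacuum (b + Poly_Mapping.single j 1) = \<chi> (e (-1) j) * vacuum b" for b j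
  proof -
    let ?A = "insert j (Poly_Mapping.keys b)"
    have "Poly_Mapping.keys (b + Poly_Mapping.single j 1) \<subseteq> ?A"
      using keys_add[of b "Poly_Mapping.single j 1"] by auto
    then have "vacuum (b + Poly_Mapping.single j 1)
        = (\<Prod>i\<in>?A. \<chi> (e (-1) i) ^ Poly_Mapping.lookup (b + Poly_Mapping.single j 1) i)"
      by (intro superset) auto
    also have "\<dots> = (\<Prod>i\<in>?A. \<chi> (e (-1) i) ^ Poly_Mapping.lookup b i * (if i = j then \<chi> (e (-1) j) else 1))"
      by (rule prod.cong) (auto simp: lookup_add lookup_single when_def)
    also have "\<dots> = (\<Prod>i\<in>?A. \<chi> (e (-1) i) ^ Poly_Mapping.lookup b i) * \<chi> (e (-1) j)"
      unfolding prod.distrib by (simp add: prod.delta)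
    also have "(\<Prod>i\<in>?A. \<chi> (e (-1) i) ^ Poly_Mapping.lookup b i) = vacuum b"
      by (rule superset[symmetric]) auto
    finally show ?thesis by (simp add: mult.commute)
  qed
  have S1: "app (S i) vacuum = (\<lambda>b. \<chi> (e (-1) i) * vacuum b)" for i
    by (simp add: fun_eq_iff app_S step del: One_nat_def)
  have "app (S i ^ n) vacuum = (\<lambda>b. \<chi> (e (-1) i) ^ n * vacuum b)" for i n
    by (induction n) (simp_all add: app_simps app_scale S1 mult.assoc mult.left_commute)
  then show ?thesis by (simp add: V_def app_scal)
qed

abbreviation "\<Phi> \<equiv> sc.free_eval \<rho>"

lemma \<Phi>_V:
  assumes "f \<in> carrier F" "v \<in> V"
  shows "app (\<Phi> f) v \<in> V"
  using assms
proof (induction arbitrary: v rule: free_alg_induct)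
  case (add f g)
  have "app (S i ^ CHAR('k)) (\<lambda>a. x a + y a) = app (scal (\<chi> (e (-1) i) ^ CHAR('k))) (\<lambda>a. x a + y a)"
    if "x \<in> V" "y \<in> V" for x y i
    using that by (simp add: V_def app_add)
  then show ?case using add by (simp add: sc.free_eval_add app_simps V_def)
next
  case (const c)
  then have "app (S i ^ CHAR('k)) (\<lambda>a. c * v a) = app (scal (\<chi> (e (-1) i) ^ CHAR('k))) (\<lambda>a. c * v a)" for i
    by (simp add: V_def app_scale)
  then show ?case by (simp add: sc.free_eval_const app_scal V_def)
next
  case (gen x f)
  then show ?case by (simp add: sc.free_eval_mult sc.free_eval_gen app_simps \<rho>_V)
qed

text \<open>The elements that act by zero on the stable space \<open>V\<close> form a two-sided
  ideal with all relations, hence contain \<open>K\<close>. The element 1 is not among them, since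
  \<open>vacuum\<close> lies in \<open>V\<close> and does not vanish at the origin.\<close>

lemma one_notin_K: "1 \<notin> K"
proof
  assume one: "1 \<in> K"
  define I where "I = {f \<in> carrier F. \<forall>v\<in>V. app (\<Phi> f) v = (\<lambda>_. 0)}"
  interpret F: ring F by (rule ring_free_alg)
  have "ideal I F"
  proof (rule idealI[OF ring_free_alg])
    have um: "\<Phi> (- f) = - \<Phi> f" for f :: "('k, 'k witt) free"
      using sc.free_eval_diff[of \<rho> 0 f] by (simp add: sc.free_eval_zero)
    show "subgroup I (add_monoid F)"
      by (intro F.add.subgroupI)
        (auto simp: I_def sc.free_eval_add um app_simps sc.free_eval_zero intro: exI[of _ 0])
    show "x \<otimes>\<^bsub>F\<^esub> f \<in> I" "f \<otimes>\<^bsub>F\<^esub> x \<in> I" if "f \<in> I" "x \<in> carrier F" for f x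
      using that \<Phi>_V by (auto simp: I_def sc.free_eval_mult app_simps app_zero)
  qed
  moreover have "f \<in> I" if f: "f \<in> env_rels L" for f
  proof -
    have "f \<in> carrier F" using f env_rels_closed by blast
    moreover have "\<Phi> f = 0"
      using f unfolding env_rels_def
      by (auto simp: L_simps(1) sc.free_eval_diff sc.free_eval_mult sc.free_eval_gen sc.free_eval_const
          \<rho>_add \<rho>_scl \<rho>_brk ad_def)
    ultimately show ?thesis by (simp add: I_def app_simps)
  qed
  moreover have "f \<in> I" if f: "f \<in> p_rels" for f
  proof -
    obtain x where x: "x \<in> Ws" "f = gen x ^ CHAR('k) - gen (pm x) - const (\<chi> x ^ CHAR('k))"
      using f by (auto simp: p_rels_def L_simps(1))
    have "f \<in> carrier F" using f p_rels_closed by blast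
    moreover have "\<Phi> f = defect x"
      by (simp add: x(2) defect_def sc.free_eval_diff sc.free_eval_gen sc.free_eval_const sc.free_eval_power)
    ultimately show ?thesis using defect_V[OF x(1)] by (simp add: I_def)
  qed
  ultimately have "K \<subseteq> I" by (intro K_minimal) auto
  then have "app (\<Phi> 1) vacuum = (\<lambda>_. 0)" using one vacuum_V by (auto simp: I_def)
  then have "vacuum 0 = 0" by (simp add: sc.free_eval_one app_simps)
  then show False by (simp add: vacuum_def)
qed

end

end

theorem theorem3p5:
  fixes l :: nat
    and pm :: "'k::alg_closed_field witt \<Rightarrow> 'k witt"
    and \<chi> :: "'k witt \<Rightarrow> 'k"
  assumes "CHAR('k) > 3"
    and "l \<ge> 1"
    and "restricted_lie_algebra (witt_alg l pm)"
    and "\<And>i k. -1 \<le> i \<Longrightarrow> i \<le> int CHAR('k) - 2 \<Longrightarrow> k \<le> l \<Longrightarrow>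
      pm (witt_e l i k) = (if i = 0 then witt_e l i (k * CHAR('k)) else 0)"
    and "linear_form (witt_alg l pm) \<chi>"
    and "height l \<chi> = 1"
    and "\<chi> (witt_e l (-1) l) \<noteq> 0"
    and "\<chi> (witt_e l 0 l) = 0"
  shows "(\<forall>a\<in>weights l \<chi>. \<forall>b\<in>weights l \<chi>.
      module_iso (red_env_alg (witt_alg l pm) \<chi>) (verma l pm \<chi> a) (verma l pm \<chi> b)) \<and>
    (\<exists>M :: ('k ured, 'k ured set) module.
      simple_module (red_env_alg (witt_alg l pm) \<chi>) M) \<and>
    (\<forall>(M :: ('k ured, 'm) module) (N :: ('k ured, 'n) module).
      simple_module (red_env_alg (witt_alg l pm) \<chi>) M \<longrightarrow>
      simple_module (red_env_alg (witt_alg l pm) \<chi>) N \<longrightarrow>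
      module_iso (red_env_alg (witt_alg l pm) \<chi>) M N)"
proof -
  interpret witt l pm \<chi>
    by (rule witt.intro[OF assms])
  obtain a where "a \<in> weights l \<chi>" using weights_nonempty by blast
  then have "1 \<notin> K" by (rule one_notin_K)
  then show ?thesis using verma_iso simple_module_exists simple_modules_iso by blast
qed

end
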